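(* Let $n\ge 3$ be an integer, let $S<0$, $r_0>0$ and $a\in\mathbb{R}$, put $\ell=\sqrt{-n(n-1)/S}$, and let $$V(r)=\frac{r^2}{\ell^2}\left(1+\frac{a}{r^{n-1}}-\frac{r_0^n}{r^n}\right),\qquad r>0.$$ Let $r_+>0$ be the largest positive root of $V$, and consider $$g=\frac{1}{V}\,dr^2+V\,d\phi^2+r^2\sum_{i=1}^{n-2}(d\theta^i)^2 ,\qquad r\ge r_+,$$ where $\theta^1,\dots,\theta^{n-2}$ are periodic with arbitrary periods and $\phi$ is periodic with period $$\beta:=\frac{4\pi\ell^2}{r_+\left(n-1+\frac{r_0^n}{r_+^n}\right)}.$$ Then $r=r_+$ is a removable singularity of $g$, and $g$ is a geodesically complete Riemannian metric with negative constant scalar curvature $S$ on $\mathbb{R}^2\times T^{n-2}$.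
   Context: The largest positive root $r_+$ exists because $V(r)\to+\infty$ as $r\to+\infty$ and $V(r)\to-\infty$ as $r\to0^+$; thus $V(r_+)=0$ and $V>0$ on $(r_+,\infty)$. A priori $g$ is a smooth Riemannian metric on $\{r>r_+\}\cong (r_+,\infty)\times S^1_\phi\times T^{n-2}$, with $T^{n-2}$ the torus with coordinates $\theta^1,\dots,\theta^{n-2}$. Saying that $r=r_+$ is a removable singularity means that, on adding the locus $r=r_+$, where each $\phi$-circle is collapsed to a point (so that $(r,\phi)$ play the role of polar coordinates on $\mathbb{R}^2$ with origin $r=r_+$ and the total space becomes $\mathbb{R}^2\times T^{n-2}$), the metric $g$ extends to a smooth Riemannian metric across that locus. $T^{n-2}$ denotes the $(n-2)$-dimensional torus. *)

theory Defs
  imports "HOL-Analysis.Analysis"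
begin

section \<open>Smooth functions on open subsets of Euclidean space\<close>

definition partial_deriv :: "'n::finite \<Rightarrow> (real^'n \<Rightarrow> real) \<Rightarrow> real^'n \<Rightarrow> real" where
  "partial_deriv i f x = frechet_derivative f (at x) (axis i 1)"

primrec Ck_on :: "nat \<Rightarrow> (real^'n::finite) set \<Rightarrow> (real^'n \<Rightarrow> real) \<Rightarrow> bool" where
  "Ck_on 0 U f \<longleftrightarrow> continuous_on U f"
| "Ck_on (Suc k) U f \<longleftrightarrow> f differentiable_on U \<and> (\<forall>i. Ck_on k U (partial_deriv i f))"

definition smooth_on :: "(real^'n::finite) set \<Rightarrow> (real^'n \<Rightarrow> real) \<Rightarrow> bool" where
  "smooth_on U f \<longleftrightarrow> (\<forall>k. Ck_on k U f)"


section \<open>Smooth manifolds and Riemannian metrics\<close>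

text \<open>
  A chart is a pair of its domain and its coordinate map; the coordinate map is only meaningful
  on the domain.
\<close>

type_synonym ('p, 'n) chart = "'p set \<times> ('p \<Rightarrow> real^'n)"

definition chart_image :: "('p, 'n::finite) chart \<Rightarrow> (real^'n) set" where
  "chart_image c = snd c ` fst c"

definition chart_overlap :: "('p, 'n::finite) chart \<Rightarrow> ('p, 'n) chart \<Rightarrow> (real^'n) set" where
  "chart_overlap c d = snd c ` (fst c \<inter> fst d)"

definition transition :: "('p, 'n::finite) chart \<Rightarrow> ('p, 'n) chart \<Rightarrow> real^'n \<Rightarrow> real^'n" where
  "transition c d = snd d \<circ> inv_into (fst c) (snd c)"

definition smooth_atlas :: "'p set \<Rightarrow> ('p, 'n::finite) chart set \<Rightarrow> bool" where
  "smooth_atlas M A \<longleftrightarrow>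
     (\<Union>c\<in>A. fst c) = M \<and>
     (\<forall>c\<in>A. inj_on (snd c) (fst c) \<and> open (chart_image c)) \<and>
     (\<forall>c\<in>A. \<forall>d\<in>A. open (chart_overlap c d) \<and>
        (\<forall>k. smooth_on (chart_overlap c d) (\<lambda>y. transition c d y $ k)))"

text \<open>
  A metric is given by its component matrices: \<open>h c y\<close> is the matrix of components, with respect
  to the coordinates of the chart \<open>c\<close>, at the point with coordinates \<open>y\<close>.
\<close>

type_synonym ('p, 'n) metric_field = "('p, 'n) chart \<Rightarrow> real^'n \<Rightarrow> real^'n^'n"

definition riemannian_metric ::
    "('p, 'n::finite) chart set \<Rightarrow> ('p, 'n) metric_field \<Rightarrow> bool" where
  "riemannian_metric A h \<longleftrightarrow>
     (\<forall>c\<in>A. \<forall>i j. smooth_on (chart_image c) (\<lambda>y. h c y $ i $ j)) \<and>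
     (\<forall>c\<in>A. \<forall>y\<in>chart_image c. transpose (h c y) = h c y \<and>
        (\<forall>v. v \<noteq> 0 \<longrightarrow> v \<bullet> (h c y *v v) > 0)) \<and>
     (\<forall>c\<in>A. \<forall>d\<in>A. \<forall>y\<in>chart_overlap c d.
        h c y = transpose (jacobian (transition c d) (at y))
                  ** h d (transition c d y) ** jacobian (transition c d) (at y))"

definition pullback_metric_on ::
    "('p, 'n::finite) chart set \<Rightarrow> ('p, 'n) metric_field \<Rightarrow> (real^'k::finite) set
       \<Rightarrow> (real^'k \<Rightarrow> 'p) \<Rightarrow> (real^'k \<Rightarrow> real^'k^'k) \<Rightarrow> bool" where
  "pullback_metric_on A h D F G \<longleftrightarrow>
     (\<forall>y\<in>D. F y \<in> (\<Union>c\<in>A. fst c)) \<and>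
     (\<forall>c\<in>A. \<forall>y\<in>D. F y \<in> fst c \<longrightarrow>
        (snd c \<circ> F) differentiable (at y) \<and>
        G y = transpose (jacobian (snd c \<circ> F) (at y))
                ** h c (snd c (F y)) ** jacobian (snd c \<circ> F) (at y))"


section \<open>Curvature and geodesics\<close>

definition christoffel ::
    "(real^'n::finite \<Rightarrow> real^'n^'n) \<Rightarrow> 'n \<Rightarrow> 'n \<Rightarrow> 'n \<Rightarrow> real^'n \<Rightarrow> real" where
  "christoffel G k i j x =
     (1/2) * (\<Sum>l\<in>UNIV. matrix_inv (G x) $ k $ l *
        (partial_deriv i (\<lambda>y. G y $ j $ l) x + partial_deriv j (\<lambda>y. G y $ i $ l) x
          - partial_deriv l (\<lambda>y. G y $ i $ j) x))"

definition ricci :: "(real^'n::finite \<Rightarrow> real^'n^'n) \<Rightarrow> 'n \<Rightarrow> 'n \<Rightarrow> real^'n \<Rightarrow> real" where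
  "ricci G i j x =
     (\<Sum>k\<in>UNIV. partial_deriv k (christoffel G k i j) x - partial_deriv j (christoffel G k i k) x
        + (\<Sum>l\<in>UNIV. christoffel G k k l x * christoffel G l i j x
                     - christoffel G k j l x * christoffel G l i k x))"

definition scalar_curvature :: "(real^'n::finite \<Rightarrow> real^'n^'n) \<Rightarrow> real^'n \<Rightarrow> real" where
  "scalar_curvature G x = (\<Sum>i\<in>UNIV. \<Sum>j\<in>UNIV. matrix_inv (G x) $ i $ j * ricci G i j x)"

definition constant_scalar_curvature ::
    "('p, 'n::finite) chart set \<Rightarrow> ('p, 'n) metric_field \<Rightarrow> real \<Rightarrow> bool" where
  "constant_scalar_curvature A h S \<longleftrightarrow>
     (\<forall>c\<in>A. \<forall>y\<in>chart_image c. scalar_curvature (h c) y = S)"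

text \<open>Geodesics are affinely parametrised and defined on open intervals.\<close>

definition geodesic_on ::
    "('p, 'n::finite) chart set \<Rightarrow> ('p, 'n) metric_field \<Rightarrow> real set \<Rightarrow> (real \<Rightarrow> 'p) \<Rightarrow> bool" where
  "geodesic_on A h I \<gamma> \<longleftrightarrow>
     open I \<and> is_interval I \<and> (\<forall>t\<in>I. \<gamma> t \<in> (\<Union>c\<in>A. fst c)) \<and>
     (\<forall>c\<in>A. open {t\<in>I. \<gamma> t \<in> fst c} \<and>
        (\<exists>u' u''. \<forall>t\<in>{t\<in>I. \<gamma> t \<in> fst c}.
           ((\<lambda>s. snd c (\<gamma> s)) has_vector_derivative u' t) (at t) \<and>
           (u' has_vector_derivative u'' t) (at t) \<and>
           (\<forall>k. u'' t $ k + (\<Sum>i\<in>UNIV. \<Sum>j\<in>UNIV.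
                  christoffel (h c) k i j (snd c (\<gamma> t)) * u' t $ i * u' t $ j) = 0)))"

definition geodesically_complete ::
    "('p, 'n::finite) chart set \<Rightarrow> ('p, 'n) metric_field \<Rightarrow> bool" where
  "geodesically_complete A h \<longleftrightarrow>
     (\<forall>I \<gamma>. I \<noteq> {} \<and> geodesic_on A h I \<gamma> \<longrightarrow>
        (\<exists>\<gamma>'. geodesic_on A h UNIV \<gamma>' \<and> (\<forall>t\<in>I. \<gamma>' t = \<gamma> t)))"


section \<open>The product of the plane with a torus\<close>

definition torus_rel :: "('m::finite \<Rightarrow> real) \<Rightarrow> ((real^'m) \<times> (real^'m)) set" where
  "torus_rel P = {(x, y). \<forall>i. \<exists>k::int. x $ i - y $ i = of_int k * P i}"

definition torus :: "('m::finite \<Rightarrow> real) \<Rightarrow> (real^'m) set set" where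
  "torus P = UNIV // torus_rel P"

definition period_box :: "('m::finite \<Rightarrow> real) \<Rightarrow> real^'m \<Rightarrow> (real^'m) set" where
  "period_box P c = {\<theta>. \<forall>i. \<bar>\<theta> $ i - c $ i\<bar> < P i / 2}"

definition plane_torus :: "('m::finite \<Rightarrow> real) \<Rightarrow> ((real^2) \<times> (real^'m) set) set" where
  "plane_torus P = UNIV \<times> torus P"

text \<open>
  The coordinate index type is \<open>2 + 'm\<close>: the indices \<open>Inl 1\<close>, \<open>Inl 2\<close> belong to the plane and
  \<open>Inr i\<close> to the \<open>i\<close>-th circle of the torus. A class that meets a period box meets it in
  exactly one point, so \<^const>\<open>the_elem\<close> picks the representative in that box.
\<close>

definition plane_torus_chart ::
    "('m::finite \<Rightarrow> real) \<Rightarrow> real^'m \<Rightarrow> ((real^2) \<times> (real^'m) set, 2 + 'm) chart" where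
  "plane_torus_chart P c =
     (UNIV \<times> {q \<in> torus P. q \<inter> period_box P c \<noteq> {}},
      \<lambda>(z, q). \<chi> k. case k of Inl a \<Rightarrow> z $ a | Inr i \<Rightarrow> the_elem (q \<inter> period_box P c) $ i)"

definition plane_torus_atlas ::
    "('m::finite \<Rightarrow> real) \<Rightarrow> ((real^2) \<times> (real^'m) set, 2 + 'm) chart set" where
  "plane_torus_atlas P = range (plane_torus_chart P)"


section \<open>The metric in the coordinates \<open>r\<close>, \<open>\<phi>\<close>, \<open>\<theta>\<close>\<close>

definition potential :: "nat \<Rightarrow> real \<Rightarrow> real \<Rightarrow> real \<Rightarrow> real \<Rightarrow> real" where
  "potential n l a r0 r = r^2 / l^2 * (1 + a / r^(n - 1) - r0^n / r^n)"

text \<open>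
  Here the coordinate \<open>Inl 1\<close> is \<open>r\<close>, \<open>Inl 2\<close> is \<open>\<phi>\<close> and \<open>Inr i\<close> is \<open>\<theta>\<^sup>i\<close>.
\<close>

definition warped_metric :: "(real \<Rightarrow> real) \<Rightarrow> real^(2 + 'm::finite) \<Rightarrow> real^(2 + 'm)^(2 + 'm)" where
  "warped_metric V y =
     (\<chi> i j. if i \<noteq> j then 0 else
        (case i of Inl b \<Rightarrow> if b = 1 then 1 / V (y $ Inl 1) else V (y $ Inl 1)
                 | Inr _ \<Rightarrow> (y $ Inl 1)^2))"

text \<open>
  A polar radius is an orientation preserving diffeomorphism of \<open>(r\<^sub>+, \<infinity>)\<close> onto \<open>(0, \<infinity>)\<close>;
  \<open>\<rho> r\<close> is the distance from the origin of the plane at which the circle of radial coordinate \<open>r\<close>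
  is placed.
\<close>

definition polar_radius :: "real \<Rightarrow> (real \<Rightarrow> real) \<Rightarrow> bool" where
  "polar_radius rp \<rho> \<longleftrightarrow>
     bij_betw \<rho> {rp<..} {0<..} \<and>
     (\<forall>k. \<forall>r>rp. (deriv ^^ k) \<rho> field_differentiable (at r)) \<and>
     (\<forall>r>rp. deriv \<rho> r > 0)"

definition polar_map ::
    "real \<Rightarrow> ('m::finite \<Rightarrow> real) \<Rightarrow> (real \<Rightarrow> real) \<Rightarrow> real^(2 + 'm) \<Rightarrow> (real^2) \<times> (real^'m) set" where
  "polar_map \<beta> P \<rho> y =
     (vector [\<rho> (y $ Inl 1) * cos (2 * pi * y $ Inl 2 / \<beta>),
              \<rho> (y $ Inl 1) * sin (2 * pi * y $ Inl 2 / \<beta>)],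
      torus_rel P `` {\<chi> i. y $ Inr i})"

text \<open>
  Collapsing each \<open>\<phi>\<close>-circle at \<open>r = r\<^sub>+\<close> to a point, the metric \<open>G\<close>, given in the
  coordinates \<open>r > r\<^sub>+\<close>, \<open>\<phi>\<close> (modulo \<open>\<beta>\<close>) and \<open>\<theta>\<close> (modulo \<open>P\<close>), extends to the smooth
  Riemannian metric \<open>h\<close> on the product of the plane and the torus.
\<close>

definition extends_across_axis ::
    "real \<Rightarrow> real \<Rightarrow> ('m::finite \<Rightarrow> real) \<Rightarrow> (real^(2 + 'm) \<Rightarrow> real^(2 + 'm)^(2 + 'm))
       \<Rightarrow> ((real^2) \<times> (real^'m) set, 2 + 'm) metric_field \<Rightarrow> bool" where
  "extends_across_axis rp \<beta> P G h \<longleftrightarrow>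
     riemannian_metric (plane_torus_atlas P) h \<and>
     (\<exists>\<rho>. polar_radius rp \<rho> \<and>
        pullback_metric_on (plane_torus_atlas P) h {y. y $ Inl 1 > rp} (polar_map \<beta> P \<rho>) G)"

section \<open>The atlas, the polar map and the largest root\<close>

lemma partial_deriv_cong:
  assumes "open U" "x \<in> U" "\<And>y. y \<in> U \<Longrightarrow> f y = g y"
  shows "partial_deriv i f x = partial_deriv i g x"
proof -
  have "(f has_derivative D) (at x) \<longleftrightarrow> (g has_derivative D) (at x)" for D
    using has_derivative_transform_within_open[of f D x UNIV U g]
      has_derivative_transform_within_open[of g D x UNIV U f] assms by auto
  then show ?thesis by (simp add: partial_deriv_def frechet_derivative_def)
qed

lemma Ck_on_cong:
  assumes "open U" "\<And>y. y \<in> U \<Longrightarrow> f y = g y" "Ck_on k U f"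
  shows "Ck_on k U g"
  using assms
proof (induction k arbitrary: f g)
  case 0
  then show ?case by (simp cong: continuous_on_cong)
next
  case (Suc k)
  have "g differentiable_on U"
    unfolding differentiable_on_def
  proof
    fix x assume "x \<in> U"
    then have "f differentiable (at x within U)"
      using Suc.prems(3) by (auto simp: differentiable_on_def)
    then show "g differentiable (at x within U)"
      using differentiable_transform_within[of f x U 1 g] \<open>x \<in> U\<close> Suc.prems(2) by auto
  qed
  moreover have "Ck_on k U (partial_deriv i g)" for i
    using Suc.IH[of "partial_deriv i f" "partial_deriv i g"] Suc.prems partial_deriv_cong[of U _ f g i]
    by auto
  ultimately show ?case by simp
qed

lemma Ck_on_local:
  assumes "\<And>x. x \<in> U \<Longrightarrow> \<exists>W. open W \<and> x \<in> W \<and> W \<subseteq> U \<and> Ck_on k W f"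
  shows "Ck_on k U f"
  using assms
proof (induction k arbitrary: f)
  case 0
  have "open U" by (subst open_subopen) (use 0 in blast)
  moreover have "isCont f x" if "x \<in> U" for x
    using 0[OF that] continuous_on_eq_continuous_at by fastforce
  ultimately show ?case by (auto intro: continuous_at_imp_continuous_on)
next
  case (Suc k)
  have "f differentiable (at x within U)" if x: "x \<in> U" for x
  proof -
    obtain W where "open W" "x \<in> W" "f differentiable_on W" using Suc.prems[OF x] by auto
    then have "f differentiable (at x)"
      by (simp add: differentiable_on_eq_differentiable_at)
    then show ?thesis by (rule differentiable_at_withinI)
  qed
  moreover have "Ck_on k U (partial_deriv i f)" for i
    using Suc.prems by (intro Suc.IH) (metis Ck_on.simps(2))
  ultimately show ?case by (simp add: differentiable_on_def)
qed

lemma Ck_on_const: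
  fixes U :: "(real^'n::finite) set"
  shows "Ck_on k U (\<lambda>y. b)"
proof (induction k arbitrary: b)
  case (Suc k)
  have "partial_deriv i (\<lambda>y::real^'n. b) = (\<lambda>y. 0)" for i
    by (auto simp: partial_deriv_def frechet_derivative_const)
  with Suc show ?case by simp
qed simp

lemma Ck_on_coordinate:
  fixes U :: "(real^'n::finite) set"
  shows "Ck_on k U (\<lambda>y. y $ j + b)"
proof -
  have d: "((\<lambda>y::real^'n. y $ j + b) has_derivative (\<lambda>v. v $ j)) (at x within V)" for x V
    by (auto intro!: derivative_eq_intros bounded_linear_imp_has_derivative
        bounded_linear_vec_nth)
  then have df: "(\<lambda>y::real^'n. y $ j + b) differentiable_on V" for V
    unfolding differentiable_on_def differentiable_def by blast
  have "partial_deriv i (\<lambda>y::real^'n. y $ j + b) = (\<lambda>y. axis i 1 $ j)" for i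
    using frechet_derivative_at[OF d[of _ UNIV], symmetric] by (auto simp: partial_deriv_def)
  with df show ?thesis
    by (cases k) (auto simp: Ck_on_const intro: differentiable_imp_continuous_on)
qed

lemma equiv_torus_rel: "equiv UNIV (torus_rel P)"
proof (rule equivI)
  show "refl (torus_rel P)"
    by (auto simp: refl_on_def torus_rel_def intro!: exI[of _ 0])
  show "sym (torus_rel P)"
  proof (rule symI)
    fix x y assume "(x, y) \<in> torus_rel P"
    then have "\<forall>i. \<exists>k::int. x $ i - y $ i = of_int k * P i" by (simp add: torus_rel_def)
    then have "\<exists>k::int. y $ i - x $ i = of_int k * P i" for i
      by (metis minus_diff_eq mult_minus_left of_int_minus)
    then show "(y, x) \<in> torus_rel P" by (simp add: torus_rel_def)
  qed
  show "trans (torus_rel P)"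
  proof (rule transI)
    fix x y z assume a: "(x, y) \<in> torus_rel P" "(y, z) \<in> torus_rel P"
    have "\<exists>k::int. x $ i - z $ i = of_int k * P i" for i
    proof -
      obtain k k' :: int where "x $ i - y $ i = of_int k * P i" "y $ i - z $ i = of_int k' * P i"
        using a by (auto simp: torus_rel_def) blast
      then show ?thesis by (intro exI[of _ "k + k'"]) (simp add: algebra_simps)
    qed
    then show "(x, z) \<in> torus_rel P" by (simp add: torus_rel_def)
  qed
qed simp

lemma torus_rel_box_unique:
  assumes "\<forall>i. P i > 0" "(x, y) \<in> torus_rel P" "x \<in> period_box P c" "y \<in> period_box P c"
  shows "x = y"
proof -
  have "x $ i = y $ i" for i
  proof -
    obtain k :: int where k: "x $ i - y $ i = of_int k * P i"
      using assms(2) by (auto simp: torus_rel_def)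
    have b: "\<bar>x $ i - c $ i\<bar> < P i / 2" "\<bar>y $ i - c $ i\<bar> < P i / 2"
      using assms(3,4) by (simp_all add: period_box_def)
    have "\<bar>x $ i - y $ i\<bar> < P i" using b by linarith
    then have "\<bar>real_of_int k\<bar> * P i < 1 * P i"
      using k assms(1)[rule_format, of i] by (simp add: abs_mult)
    then have "\<bar>real_of_int k\<bar> < 1"
      using assms(1)[rule_format, of i] by (simp only: mult_less_cancel_right_pos)
    then have "k = 0" by linarith
    with k show ?thesis by simp
  qed
  then show ?thesis by (simp add: vec_eq_iff)
qed

definition plane_part :: "real^(2 + 'm::finite) \<Rightarrow> real^2" where
  "plane_part y = (\<chi> a. y $ Inl a)"

definition torus_part :: "real^(2 + 'm::finite) \<Rightarrow> real^'m" where
  "torus_part y = (\<chi> i. y $ Inr i)"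

definition plane_torus_proj ::
    "('m::finite \<Rightarrow> real) \<Rightarrow> real^(2 + 'm) \<Rightarrow> (real^2) \<times> (real^'m) set" where
  "plane_torus_proj P y = (plane_part y, torus_rel P `` {torus_part y})"

lemma parts_eqI: "plane_part y = plane_part z \<Longrightarrow> torus_part y = torus_part z \<Longrightarrow> y = z"
proof -
  assume "plane_part y = plane_part z" "torus_part y = torus_part z"
  then have "y $ Inl a = z $ Inl a" "y $ Inr i = z $ Inr i" for a i
    by (simp_all add: plane_part_def torus_part_def vec_eq_iff)
  then have "y $ k = z $ k" for k by (cases k) auto
  then show "y = z" by (simp add: vec_eq_iff)
qed

lemma the_elem_box:
  assumes "\<forall>i. P i > 0" "(\<theta>, x) \<in> torus_rel P" "x \<in> period_box P c"
  shows "the_elem (torus_rel P `` {\<theta>} \<inter> period_box P c) = x"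
proof -
  have "torus_rel P `` {\<theta>} \<inter> period_box P c = {x}"
  proof (intro equalityI subsetI)
    fix z assume z: "z \<in> torus_rel P `` {\<theta>} \<inter> period_box P c"
    then have "(x, z) \<in> torus_rel P"
      using assms(2) equiv_torus_rel[of P] by (meson IntD1 Image_singleton_iff equivE symE transE)
    then show "z \<in> {x}" using torus_rel_box_unique[OF assms(1)] z assms(3) by auto
  qed (use assms in auto)
  then show ?thesis by simp
qed

lemma plane_torus_proj_in_dom:
  "plane_torus_proj P y \<in> fst (plane_torus_chart P c) \<longleftrightarrow>
     (\<exists>x. (torus_part y, x) \<in> torus_rel P \<and> x \<in> period_box P c)"
  by (auto simp: plane_torus_proj_def plane_torus_chart_def torus_def quotient_def)

lemma plane_torus_proj_surj: "p \<in> plane_torus P \<Longrightarrow> \<exists>y. p = plane_torus_proj P y"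
proof -
  assume "p \<in> plane_torus P"
  then obtain z \<theta> where p: "p = (z, torus_rel P `` {\<theta>})"
    by (auto simp: plane_torus_def torus_def quotient_def)
  show ?thesis
    by (rule exI[of _ "\<chi> k. case k of Inl a \<Rightarrow> z $ a | Inr i \<Rightarrow> \<theta> $ i"])
       (simp add: p plane_torus_proj_def plane_part_def torus_part_def)
qed

lemma plane_torus_chart_proj:
  assumes "\<forall>i. P i > 0" "(torus_part y, x) \<in> torus_rel P" "x \<in> period_box P c"
  shows "plane_part (snd (plane_torus_chart P c) (plane_torus_proj P y)) = plane_part y"
    and "torus_part (snd (plane_torus_chart P c) (plane_torus_proj P y)) = x"
  using the_elem_box[OF assms]
  by (simp_all add: plane_torus_chart_def plane_torus_proj_def plane_part_def torus_part_def)

lemma plane_torus_chart_proj_box: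
  assumes "\<forall>i. P i > 0" "torus_part y \<in> period_box P c"
  shows "snd (plane_torus_chart P c) (plane_torus_proj P y) = y"
    and "plane_torus_proj P y \<in> fst (plane_torus_chart P c)"
proof -
  have r: "(torus_part y, torus_part y) \<in> torus_rel P"
    using equiv_torus_rel[of P] by (auto simp: equiv_def refl_on_def)
  show "snd (plane_torus_chart P c) (plane_torus_proj P y) = y"
    using plane_torus_chart_proj[OF assms(1) r assms(2)] by (rule parts_eqI)
  show "plane_torus_proj P y \<in> fst (plane_torus_chart P c)"
    using r assms(2) plane_torus_proj_in_dom by blast
qed

lemma plane_torus_dom_rep:
  assumes "\<forall>i. P i > 0" "p \<in> fst (plane_torus_chart P c)"
  shows "\<exists>y. torus_part y \<in> period_box P c \<and> p = plane_torus_proj P y"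
proof -
  have "p \<in> plane_torus P" using assms(2) by (auto simp: plane_torus_chart_def plane_torus_def)
  then obtain y where y: "p = plane_torus_proj P y" using plane_torus_proj_surj by blast
  then obtain x where x: "(torus_part y, x) \<in> torus_rel P" "x \<in> period_box P c"
    using assms(2) plane_torus_proj_in_dom by blast
  define y' where "y' = snd (plane_torus_chart P c) (plane_torus_proj P y)"
  have "plane_part y' = plane_part y" "torus_part y' = x"
    unfolding y'_def using plane_torus_chart_proj[OF assms(1) x] by auto
  moreover have "torus_rel P `` {x} = torus_rel P `` {torus_part y}"
    using x(1) equiv_class_eq[OF equiv_torus_rel] by metis
  ultimately show ?thesis using x(2) y by (intro exI[of _ y']) (auto simp: plane_torus_proj_def)
qed

lemma plane_torus_chart_image:
  assumes "\<forall>i. P i > 0"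
  shows "chart_image (plane_torus_chart P c) = {y. torus_part y \<in> period_box P c}"
  unfolding chart_image_def
  using plane_torus_chart_proj_box[OF assms] plane_torus_dom_rep[OF assms]
  by (force simp: image_iff)

lemma plane_torus_chart_inj:
  assumes "\<forall>i. P i > 0"
  shows "inj_on (snd (plane_torus_chart P c)) (fst (plane_torus_chart P c))"
  by (rule inj_onI) (metis plane_torus_dom_rep[OF assms] plane_torus_chart_proj_box(1)[OF assms])

lemma plane_torus_inv_chart:
  assumes "\<forall>i. P i > 0" "torus_part y \<in> period_box P c"
  shows "inv_into (fst (plane_torus_chart P c)) (snd (plane_torus_chart P c)) y = plane_torus_proj P y"
  using plane_torus_chart_proj_box[OF assms] plane_torus_chart_inj[OF assms(1)]
  by (metis inv_into_f_f)

definition lattice_shift :: "('m::finite \<Rightarrow> real) \<Rightarrow> ('m \<Rightarrow> int) \<Rightarrow> real^(2 + 'm)" where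
  "lattice_shift P k = (\<chi> j. case j of Inl a \<Rightarrow> 0 | Inr i \<Rightarrow> of_int (k i) * P i)"

definition shift_overlap ::
    "('m::finite \<Rightarrow> real) \<Rightarrow> real^'m \<Rightarrow> real^'m \<Rightarrow> ('m \<Rightarrow> int) \<Rightarrow> (real^(2 + 'm)) set" where
  "shift_overlap P c d k =
     {y. torus_part y \<in> period_box P c \<and> torus_part (y + lattice_shift P k) \<in> period_box P d}"

lemma open_torus_part_box: "open {y. torus_part (y + b) \<in> period_box P c}"
proof -
  have "{y. torus_part (y + b) \<in> period_box P c} = (\<Inter>i. {y. \<bar>y $ Inr i + b $ Inr i - c $ i\<bar> < P i / 2})"
    by (auto simp: period_box_def torus_part_def)
  moreover have "open {y. \<bar>y $ Inr i + b $ Inr i - c $ i\<bar> < P i / 2}" for i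
    by (intro open_Collect_less continuous_intros)
  ultimately show ?thesis by (simp only:) (intro open_INT finite ballI)
qed

lemma open_shift_overlap: "open (shift_overlap P c d k)"
  using open_Int[OF open_torus_part_box[of 0] open_torus_part_box]
  by (simp add: shift_overlap_def Collect_conj_eq)

lemma torus_rel_shift: "(torus_part y, torus_part (y + lattice_shift P k)) \<in> torus_rel P"
proof -
  have "\<exists>j::int. torus_part y $ i - torus_part (y + lattice_shift P k) $ i = of_int j * P i" for i
    by (rule exI[of _ "- k i"]) (simp add: torus_part_def lattice_shift_def)
  then show ?thesis by (simp add: torus_rel_def)
qed

lemma torus_rel_shiftE:
  assumes "(torus_part y, x) \<in> torus_rel P"
  obtains k where "x = torus_part (y + lattice_shift P k)"
proof -
  obtain k where k: "\<And>i. torus_part y $ i - x $ i = real_of_int (k i) * P i"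
    using assms unfolding torus_rel_def by (auto dest!: choice)
  have "x $ i = y $ Inr i - real_of_int (k i) * P i" for i
    using k[of i] by (simp add: torus_part_def)
  then have "x = torus_part (y + lattice_shift P (\<lambda>i. - k i))"
    by (simp add: vec_eq_iff torus_part_def lattice_shift_def)
  then show ?thesis by (rule that)
qed

lemma plane_torus_overlap:
  assumes P: "\<forall>i. P i > 0"
  shows "chart_overlap (plane_torus_chart P c) (plane_torus_chart P d) = (\<Union>k. shift_overlap P c d k)"
proof (intro equalityI subsetI)
  fix y assume "y \<in> chart_overlap (plane_torus_chart P c) (plane_torus_chart P d)"
  then obtain p where p: "p \<in> fst (plane_torus_chart P c)" "p \<in> fst (plane_torus_chart P d)"
    "y = snd (plane_torus_chart P c) p"
    by (auto simp: chart_overlap_def)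
  obtain y' where "torus_part y' \<in> period_box P c" "p = plane_torus_proj P y'"
    using plane_torus_dom_rep[OF P p(1)] by blast
  then have y: "torus_part y \<in> period_box P c" "p = plane_torus_proj P y"
    using p(3) plane_torus_chart_proj_box(1)[OF P] by auto
  then obtain x where "(torus_part y, x) \<in> torus_rel P" "x \<in> period_box P d"
    using p(2) plane_torus_proj_in_dom by blast
  then show "y \<in> (\<Union>k. shift_overlap P c d k)"
    using y(1) by (auto simp: shift_overlap_def elim: torus_rel_shiftE)
next
  fix y assume "y \<in> (\<Union>k. shift_overlap P c d k)"
  then obtain k where k: "torus_part y \<in> period_box P c"
    "torus_part (y + lattice_shift P k) \<in> period_box P d"
    by (auto simp: shift_overlap_def)
  have "plane_torus_proj P y \<in> fst (plane_torus_chart P d)"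
    using plane_torus_proj_in_dom torus_rel_shift k(2) by blast
  then show "y \<in> chart_overlap (plane_torus_chart P c) (plane_torus_chart P d)"
    using plane_torus_chart_proj_box[OF P k(1)] unfolding chart_overlap_def
    by (metis IntI image_eqI)
qed

lemma plane_torus_transition:
  assumes P: "\<forall>i. P i > 0" and y: "y \<in> shift_overlap P c d k"
  shows "transition (plane_torus_chart P c) (plane_torus_chart P d) y = y + lattice_shift P k"
proof -
  have k: "torus_part y \<in> period_box P c" "torus_part (y + lattice_shift P k) \<in> period_box P d"
    using y by (auto simp: shift_overlap_def)
  have "plane_part (y + lattice_shift P k) = plane_part y"
    by (simp add: plane_part_def lattice_shift_def vec_eq_iff)
  then show ?thesis
    using plane_torus_chart_proj[OF P torus_rel_shift k(2)]
    by (simp add: transition_def plane_torus_inv_chart[OF P k(1)] parts_eqI)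
qed

lemma smooth_atlas_plane_torus:
  assumes P: "\<forall>i. P i > 0"
  shows "smooth_atlas (plane_torus P) (plane_torus_atlas P)"
  unfolding smooth_atlas_def
proof (intro conjI ballI allI)
  show "(\<Union>c\<in>plane_torus_atlas P. fst c) = plane_torus P"
  proof (intro equalityI subsetI)
    fix p assume "p \<in> plane_torus P"
    then obtain y where y: "p = plane_torus_proj P y" using plane_torus_proj_surj by blast
    have "torus_part y \<in> period_box P (torus_part y)" using P by (simp add: period_box_def)
    then show "p \<in> (\<Union>c\<in>plane_torus_atlas P. fst c)"
      using y plane_torus_chart_proj_box(2)[OF P] unfolding plane_torus_atlas_def by blast
  next
    fix p assume "p \<in> (\<Union>c\<in>plane_torus_atlas P. fst c)"
    then obtain c where "p \<in> fst (plane_torus_chart P c)" unfolding plane_torus_atlas_def by blast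
    then show "p \<in> plane_torus P" by (auto simp: plane_torus_chart_def plane_torus_def)
  qed
next
  fix c assume "c \<in> plane_torus_atlas P"
  then obtain c' where c: "c = plane_torus_chart P c'" by (auto simp: plane_torus_atlas_def)
  show "inj_on (snd c) (fst c)" using plane_torus_chart_inj[OF P] c by blast
  show "open (chart_image c)"
    using open_torus_part_box[of 0 P c'] by (simp add: c plane_torus_chart_image[OF P])
  fix d assume "d \<in> plane_torus_atlas P"
  then obtain d' where d: "d = plane_torus_chart P d'" by (auto simp: plane_torus_atlas_def)
  show "open (chart_overlap c d)"
    by (simp add: c d plane_torus_overlap[OF P] open_UN open_shift_overlap)
  fix j
  show "smooth_on (chart_overlap c d) (\<lambda>y. transition c d y $ j)"
    unfolding smooth_on_def
  proof (intro allI Ck_on_local)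
    fix n x assume "x \<in> chart_overlap c d"
    then obtain k where k: "x \<in> shift_overlap P c' d' k"
      unfolding c d plane_torus_overlap[OF P] by blast
    have "Ck_on n (shift_overlap P c' d' k) (\<lambda>y. transition c d y $ j)"
      by (rule Ck_on_cong[OF open_shift_overlap _ Ck_on_coordinate[of n _ j "lattice_shift P k $ j"]])
         (simp add: plane_torus_transition[OF P] c d)
    moreover have "shift_overlap P c' d' k \<subseteq> chart_overlap c d"
      unfolding c d plane_torus_overlap[OF P] by blast
    ultimately show "\<exists>W. open W \<and> x \<in> W \<and> W \<subseteq> chart_overlap c d \<and> Ck_on n W (\<lambda>y. transition c d y $ j)"
      using k open_shift_overlap[of P c' d' k] by (intro exI[of _ "shift_overlap P c' d' k"] conjI)
  qed
qed

text \<open>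
  The polar map identifies the product of \<open>(r\<^sub>+, \<infinity>)\<close>, the circle of length \<open>\<beta>\<close> and the torus
  with the complement of the axis.
\<close>

lemma polar_map_eq_iff:
  assumes \<rho>: "polar_radius rp \<rho>" and "\<beta> > 0" and r: "y $ Inl 1 > rp" "z $ Inl 1 > rp"
  shows "polar_map \<beta> P \<rho> y = polar_map \<beta> P \<rho> z \<longleftrightarrow>
     y $ Inl 1 = z $ Inl 1 \<and> (\<exists>k::int. y $ Inl 2 - z $ Inl 2 = of_int k * \<beta>) \<and>
     ((\<chi> i. y $ Inr i), (\<chi> i. z $ Inr i)) \<in> torus_rel P"
proof -
  let ?s = "\<rho> (y $ Inl 1)" and ?t = "\<rho> (z $ Inl 1)"
  let ?x = "2 * pi * y $ Inl 2 / \<beta>" and ?w = "2 * pi * z $ Inl 2 / \<beta>"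
  have bij: "bij_betw \<rho> {rp<..} {0<..}" using \<rho> by (simp add: polar_radius_def)
  have pos: "?s > 0" "?t > 0" using bij_betwE[OF bij] r by auto
  have inj: "?s = ?t \<longleftrightarrow> y $ Inl 1 = z $ Inl 1"
    using bij r by (auto simp: bij_betw_def inj_on_def)
  have ang: "cos ?x = cos ?w \<and> sin ?x = sin ?w \<longleftrightarrow> (\<exists>k::int. y $ Inl 2 - z $ Inl 2 = of_int k * \<beta>)"
  proof -
    have "cos ?x = cos ?w \<and> sin ?x = sin ?w \<longleftrightarrow> (\<exists>k::int. ?x = ?w + 2 * pi * k)"
      using sin_cos_eq_iff[of ?x ?w] by (simp add: conj_commute mult_ac)
    also have "\<dots> \<longleftrightarrow> (\<exists>k::int. y $ Inl 2 - z $ Inl 2 = of_int k * \<beta>)"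
    proof (intro ex_cong1)
      fix k :: int
      have "?x = ?w + 2 * pi * k \<longleftrightarrow> 2 * pi * (y $ Inl 2 - z $ Inl 2 - of_int k * \<beta>) = 0"
      proof -
        have "?x - ?w - 2 * pi * k = 2 * pi * (y $ Inl 2 - z $ Inl 2 - of_int k * \<beta>) / \<beta>"
          using \<open>\<beta> > 0\<close> by (simp add: field_simps)
        moreover have "?x = ?w + 2 * pi * k \<longleftrightarrow> ?x - ?w - 2 * pi * k = 0" by argo
        ultimately show ?thesis using \<open>\<beta> > 0\<close> by simp
      qed
      then show "?x = ?w + 2 * pi * k \<longleftrightarrow> y $ Inl 2 - z $ Inl 2 = of_int k * \<beta>" by simp
    qed
    finally show ?thesis .
  qed
  have "?s * cos ?x = ?t * cos ?w \<and> ?s * sin ?x = ?t * sin ?w \<longleftrightarrow>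
      ?s = ?t \<and> cos ?x = cos ?w \<and> sin ?x = sin ?w" (is "?L \<longleftrightarrow> ?R")
  proof
    assume L: ?L
    have "?s^2 = (?s * cos ?x)^2 + (?s * sin ?x)^2"
      by (simp add: power_mult_distrib flip: distrib_left)
    also have "\<dots> = ?t^2" using L by (simp add: power_mult_distrib flip: distrib_left)
    finally have "?s = ?t" using pos by (simp add: power2_eq_iff_nonneg)
    with L pos show ?R by auto
  qed auto
  moreover have "torus_rel P `` {\<chi> i. y $ Inr i} = torus_rel P `` {\<chi> i. z $ Inr i} \<longleftrightarrow>
      ((\<chi> i. y $ Inr i), (\<chi> i. z $ Inr i)) \<in> torus_rel P"
    using eq_equiv_class_iff[OF equiv_torus_rel] by blast
  moreover have "vector [p, q] = (vector [p', q'] :: real^2) \<longleftrightarrow> p = p' \<and> q = q'" for p q p' q'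
    by (metis vector_2)
  ultimately show ?thesis unfolding polar_map_def prod.inject using inj ang by auto
qed

lemma polar_map_image:
  fixes P :: "'m::finite \<Rightarrow> real"
  assumes \<rho>: "polar_radius rp \<rho>" and "\<beta> > 0"
  shows "polar_map \<beta> P \<rho> ` {y. y $ Inl 1 > rp} = (- {0}) \<times> torus P"
proof (intro equalityI subsetI)
  have bij: "bij_betw \<rho> {rp<..} {0<..}" using \<rho> by (simp add: polar_radius_def)
  fix p assume "p \<in> polar_map \<beta> P \<rho> ` {y. y $ Inl 1 > rp}"
  then obtain y where y: "y $ Inl 1 > rp" and p: "p = polar_map \<beta> P \<rho> y" by auto
  have s: "\<rho> (y $ Inl 1) > 0" using bij_betwE[OF bij] y by auto
  have "fst p \<noteq> 0"
  proof
    assume "fst p = 0"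
    then have "fst p $ 1 = 0" "fst p $ 2 = 0" by auto
    then have "cos (2 * pi * y $ Inl 2 / \<beta>) = 0" "sin (2 * pi * y $ Inl 2 / \<beta>) = 0"
      using s unfolding p polar_map_def by auto
    then show False by (metis cos_zero_iff_int sin_zero_abs_cos_one abs_zero zero_neq_one)
  qed
  then show "p \<in> (- {0}) \<times> torus P"
    by (auto simp: p polar_map_def torus_def quotient_def)
next
  have bij: "bij_betw \<rho> {rp<..} {0<..}" using \<rho> by (simp add: polar_radius_def)
  fix p :: "(real^2) \<times> (real^'m) set" assume "p \<in> (- {0}) \<times> torus P"
  then obtain z \<theta> where p: "p = (z, torus_rel P `` {\<theta>})" "z \<noteq> 0"
    by (auto simp: torus_def quotient_def)
  define s where "s = sqrt ((z $ 1)^2 + (z $ 2)^2)"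
  have "(z $ 1)^2 + (z $ 2)^2 \<noteq> 0"
    using p(2) by (auto simp: vec_eq_iff forall_2 sum_power2_eq_zero_iff)
  then have s: "s > 0" "s^2 = (z $ 1)^2 + (z $ 2)^2"
    by (auto simp: s_def less_le)
  have "(z $ 1 / s)^2 + (z $ 2 / s)^2 = 1"
  proof -
    have "(z $ 1 / s)^2 + (z $ 2 / s)^2 = ((z $ 1)^2 + (z $ 2)^2) / s^2"
      by (simp only: power_divide add_divide_distrib)
    then show ?thesis using s by (metis divide_self less_irrefl power_not_zero)
  qed
  then obtain t where t: "z $ 1 / s = cos t" "z $ 2 / s = sin t"
    using sincos_total_2pi by metis
  obtain r where r: "r > rp" "\<rho> r = s"
    using bij s(1) by (metis bij_betw_imp_surj_on greaterThan_iff imageE)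
  define y :: "real^(2 + 'm)" where
    "y = (\<chi> k. case k of Inl a \<Rightarrow> if a = 1 then r else t * \<beta> / (2 * pi) | Inr i \<Rightarrow> \<theta> $ i)"
  have "polar_map \<beta> P \<rho> y = p"
    using s(1) \<open>\<beta> > 0\<close> r t
    by (simp add: polar_map_def p y_def vec_eq_iff forall_2 field_simps)
  moreover have "y $ Inl 1 > rp" using r by (simp add: y_def)
  ultimately show "p \<in> polar_map \<beta> P \<rho> ` {y. y $ Inl 1 > rp}" by blast
qed

lemma largest_root_exists:
  assumes "n \<ge> 3" "l > 0" "r0 > 0"
  shows "\<exists>rp>0. potential n l a r0 rp = 0 \<and> (\<forall>r>0. potential n l a r0 r = 0 \<longrightarrow> r \<le> rp)"
proof -
  define f where "f r = r^n + a * r - r0^n" for r :: real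
  have root: "potential n l a r0 r = 0 \<longleftrightarrow> f r = 0" if "r > 0" for r
  proof -
    have n: "r^n = r * r^(n - 1)" using assms(1) by (metis power_eq_if not_numeral_le_zero)
    have "f r = r^n * (1 + a / r^(n - 1) - r0^n / r^n)"
      using that by (simp add: f_def field_simps n)
    then show ?thesis using that assms(2) by (simp add: potential_def)
  qed
  define R where "R = 1 + \<bar>a\<bar> + r0^n"
  have big: "f r > 0" if "r \<ge> R" for r
  proof -
    have r: "r \<ge> 1" "r > 0" using that zero_less_power[OF assms(3), of n] abs_ge_zero[of a] unfolding R_def by linarith+
    have "r^2 \<le> r^n" using r assms(1) by (intro power_increasing) auto
    moreover have "r * R \<le> r^2" using r that by (simp add: power2_eq_square)
    moreover have "r0^n \<le> r * r0^n" using r assms(3) by simp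
    moreover have "r * R = r + r * \<bar>a\<bar> + r * r0^n" by (simp add: R_def algebra_simps)
    moreover have "r * \<bar>a\<bar> \<ge> - (a * r)" using r
      by (metis abs_ge_minus_self abs_minus_cancel less_le mult.commute mult_left_mono mult_minus_left)
    ultimately show ?thesis using r by (simp add: f_def)
  qed
  have cont: "continuous_on A f" for A unfolding f_def by (intro continuous_intros)
  have f0: "f 0 < 0" using assms by (simp add: f_def power_0_left)
  have R: "R > 0" using assms(3) zero_less_power[of r0 n] by (simp add: R_def add_pos_pos)
  let ?Z = "{r \<in> {0..R}. f r = 0}"
  have "\<exists>r\<ge>0. r \<le> R \<and> f r = 0"
    using IVT'[of f 0 0 R] f0 big[of R] R cont by auto
  then have "?Z \<noteq> {}" by auto
  moreover have "compact ?Z"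
    using continuous_closed_preimage_constant[OF cont closed_atLeastAtMost, of 0 R 0]
    unfolding compact_eq_bounded_closed
    by (auto intro: bounded_subset[OF bounded_closed_interval])
  ultimately obtain rp where rp: "rp \<in> ?Z" "\<forall>r\<in>?Z. r \<le> rp"
    using compact_attains_sup by blast
  have "rp > 0" using rp(1) f0 by (cases "rp = 0") auto
  moreover have "r \<le> rp" if "r > 0" "f r = 0" for r
    using rp(2) that big[of r] by force
  ultimately show ?thesis using root rp(1) by auto
qed

end

theory Submission
  imports Defs
begin

text \<open>
  Put \<open>m = n - 2\<close>, \<open>u = r - r\<^sub>+\<close> and \<open>\<kappa> = \<beta> / (2 * pi)\<close>, and let \<open>x\<close> be the point of the plane with
  polar coordinates \<open>(sqrt u, \<phi> / \<kappa>)\<close>. Since \<open>V\<close> vanishes at \<open>r\<^sub>+\<close>, it has the form \<open>u * W u\<close> with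
  \<open>W\<close> smooth and positive up to \<open>u = 0\<close>, and
  \<open>dr\<^sup>2 / V + V d\<phi>\<^sup>2 = \<kappa>\<^sup>2 W \<bar>dx\<bar>\<^sup>2 + B (x \<bullet> dx)\<^sup>2\<close> with \<open>B = (4 - \<kappa>\<^sup>2 W\<^sup>2) / (u W)\<close>.
  The value \<open>W 0\<close> is the derivative of \<open>V\<close> at \<open>r\<^sub>+\<close>, and the prescribed period \<open>\<beta>\<close> is the one with
  \<open>\<kappa> * W 0 = 2\<close>. So the numerator of \<open>B\<close> vanishes on the axis, \<open>B\<close> is smooth there, and with it the
  metric. It is positive definite because its eigenvalues in the plane are \<open>\<kappa>\<^sup>2 W\<close> in the angular and
  \<open>4 / W\<close> in the radial direction. As \<open>V\<close> is a rational function, \<open>W\<close> and \<open>B\<close> are quotients of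
  polynomials; the locale \<open>polar_plane\<close> studies the metric for arbitrary such data, and
  \<open>polar_metric_extends_warped_metric\<close> states the extension across the axis.

  The curvature is computed in Cartesian coordinates of the plane, where the formulas hold on the axis
  as well. The plane part has constant determinant, so its connection is trace free
  (\<open>trace_free\<close>), which shortens the Ricci tensor. The scalar curvature is
  \<open>- (r\<^sup>m V)'' / r\<^sup>m\<close> (\<open>scalar_curvature_polar_metric\<close>), where
  \<open>r\<^sup>m V = (r\<^sup>n + a r - r\<^sub>0\<^sup>n) / l\<^sup>2\<close>, hence constant.

  For completeness, the geodesic equation is solved on the universal covering \<open>\<real>\<^sup>2 \<times> \<real>\<^sup>m\<close>, where it is
  autonomous with a vector field that is Lipschitz on balls. Solutions exist for all times as soon as they
  stay bounded in bounded time (\<open>ode_global_solution\<close>). The energy \<open>E\<close> is conserved, so the radial speed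
  is at most \<open>sqrt (V * E)\<close>, and \<open>V\<close> grows at most quadratically; this bounds the radius
  exponentially in time and then the whole velocity (\<open>flow_line_a_priori_bound\<close>). A geodesic of the
  quotient is locally the image of such a solution, and by uniqueness it is so globally
  (\<open>geodesically_complete_plane_torus\<close>).
\<close>

section \<open>Global solutions of autonomous differential equations\<close>

lemma antiderivative_on_line:
  fixes g :: "real \<Rightarrow> 'a::banach"
  assumes "continuous_on UNIV g"
  shows "\<exists>G. G 0 = 0 \<and> (\<forall>t. (G has_vector_derivative g t) (at t))"
proof -
  define G where "G t = (if 0 \<le> t then integral {0..t} g else - integral {t..0} g)" for t
  have int: "g integrable_on {a..b}" for a b
    by (rule integrable_continuous_real, rule continuous_on_subset[OF assms]) simp
  have G: "G t = integral {-M..t} g - integral {-M..0} g" if "-M \<le> t" "0 \<le> M" for M t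
    using Henstock_Kurzweil_Integration.integral_combine[OF _ _ int, of "-M" 0 t] Henstock_Kurzweil_Integration.integral_combine[OF _ _ int, of "-M" t 0] that
    by (auto simp: G_def algebra_simps)
  have "(G has_vector_derivative g t) (at t)" for t
  proof -
    define M where "M = \<bar>t\<bar> + 1"
    have t: "t \<in> {-M..M}" "t \<in> {-M<..<M}" "0 \<le> M" by (auto simp: M_def)
    have "((\<lambda>u. integral {-M..u} g) has_vector_derivative g t) (at t within {-M..M})"
      by (rule integral_has_vector_derivative[OF continuous_on_subset[OF assms] t(1)]) simp
    then have "((\<lambda>u. integral {-M..u} g) has_vector_derivative g t) (at t)"
      using has_vector_derivative_within_subset[of _ _ t "{-M..M}" "{-M<..<M}"] t(2)
      by (metis greaterThanLessThan_subseteq_atLeastAtMost_iff has_vector_derivative_at_within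
          has_vector_derivative_within_open open_greaterThanLessThan order_refl)
    then have "((\<lambda>u. integral {-M..u} g - integral {-M..0} g) has_vector_derivative g t) (at t)"
      by (auto intro!: derivative_eq_intros)
    then show ?thesis
    proof (rule has_vector_derivative_transform_within_open[of _ _ _ "{-M<..<M}"])
      show "integral {-M..s} g - integral {-M..0} g = G s" if "s \<in> {-M<..<M}" for s
        using G[of M s] that t(3) by auto
    qed (use t(2) in auto)
  qed
  moreover have "G 0 = 0" by (simp add: G_def)
  ultimately show ?thesis by blast
qed

text \<open>The rate \<open>K\<close> in the weight turns into the factor \<open>1 / K\<close>, which makes the integral operator contract.\<close>

lemma antiderivative_exp_bound:
  fixes G :: "real \<Rightarrow> 'a::real_normed_vector"
  assumes der: "\<And>t. (G has_vector_derivative g t) (at t)" and "G 0 = 0" and "K > 0"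
    and bnd: "\<And>t. norm (g t) \<le> M * exp (K * \<bar>t\<bar>)"
  shows "norm (G t) \<le> M / K * exp (K * \<bar>t\<bar>)"
proof -
  have M: "M \<ge> 0" using order_trans[OF norm_ge_zero bnd[of 0]] by simp
  have pos: "norm (F t) \<le> M / K * exp (K * t)"
    if F: "\<And>t. (F has_vector_derivative f t) (at t)" "F 0 = 0"
      "\<And>t. t > 0 \<Longrightarrow> norm (f t) \<le> M * exp (K * t)" and t: "t > 0"
    for F :: "real \<Rightarrow> 'a" and f t
  proof -
    have "norm (F t - F 0) \<le> M / K * exp (K * t) - M / K * exp (K * 0)"
    proof (rule differentiable_bound_general[where f' = f and \<phi>' = "\<lambda>t. M * exp (K * t)"])
      show "continuous_on {0..t} F"
        by (meson F(1) continuous_at_imp_continuous_on has_vector_derivative_continuous)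
    qed (use F t \<open>K > 0\<close> in \<open>auto intro!: continuous_intros derivative_eq_intros
            simp flip: has_real_derivative_iff_has_vector_derivative\<close>)
    then show ?thesis using F(2) M \<open>K > 0\<close>
      by (metis add_increasing2 diff_add_cancel diff_zero divide_nonneg_pos exp_ge_zero mult_nonneg_nonneg order_trans add_le_cancel_left le_add_same_cancel1)
  qed
  consider "t > 0" | "t < 0" | "t = 0" by linarith
  then show ?thesis
  proof cases
    case 1
    show ?thesis using pos[of G g t] der assms(2) bnd 1 by (simp add: abs_of_pos) (metis abs_of_pos)
  next
    case 2
    have "((\<lambda>s. G (- s)) has_vector_derivative - g (- s)) (at s)" for s
    proof -
      have "(uminus has_vector_derivative - 1) (at s)" by (auto intro!: derivative_eq_intros)
      then show ?thesis
        using vector_diff_chain_at[of uminus "-1" s G "g (- s)"] der by (simp add: o_def)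
    qed
    moreover have "norm (- g (- s)) \<le> M * exp (K * s)" if "s > 0" for s
      using bnd[of "- s"] that by simp
    ultimately show ?thesis using pos[of "\<lambda>s. G (- s)" "\<lambda>s. - g (- s)" "- t"] assms(2) 2 by simp
  next
    case 3
    then show ?thesis using assms(2,3) M by simp
  qed
qed

text \<open>
  Weighting a curve by \<open>exp (- K * \<bar>t\<bar>)\<close> with \<open>K > L\<close> turns the integral operator of the equation
  into a contraction on the bounded continuous functions on the whole line, so no continuation of
  local solutions is needed.
\<close>

lemma lipschitz_ode_solution:
  fixes f :: "'a::banach \<Rightarrow> 'a"
  assumes lip: "L-lipschitz_on UNIV f" and bnd: "\<And>z. norm (f z) \<le> M"
  shows "\<exists>z. z 0 = z0 \<and> (\<forall>t. (z has_vector_derivative f (z t)) (at t))"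
proof -
  define K where "K = L + 1"
  have L: "L \<ge> 0" using lip by (rule lipschitz_on_nonneg)
  have K: "K > 0" "L / K < 1" using L by (simp_all add: K_def)
  have M: "M \<ge> 0" using order_trans[OF norm_ge_zero bnd] .
  have fcont: "continuous_on UNIV f" using lip by (rule lipschitz_on_continuous_on)
  define c where "c w t = f (exp (K * \<bar>t\<bar>) *\<^sub>R apply_bcontfun w t)" for w :: "real \<Rightarrow>\<^sub>C 'a" and t
  have "continuous_on UNIV (c w)" for w
    unfolding c_def by (rule continuous_on_compose2[OF fcont]) (auto intro!: continuous_intros)
  then have "\<exists>G. G 0 = 0 \<and> (\<forall>t. (G has_vector_derivative c w t) (at t))" for w
    by (rule antiderivative_on_line)
  then obtain G where G: "\<And>w. G w 0 = 0" "\<And>w t. (G w has_vector_derivative c w t) (at t)"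
    by metis
  define \<Phi> where "\<Phi> w t = exp (- K * \<bar>t\<bar>) *\<^sub>R (z0 + G w t)" for w t
  have "\<Phi> w \<in> bcontfun" for w
  proof (rule bcontfun_normI)
    have "continuous_on UNIV (G w)"
      by (meson G(2) continuous_at_imp_continuous_on has_vector_derivative_continuous)
    then show "continuous_on UNIV (\<Phi> w)" unfolding \<Phi>_def by (intro continuous_intros)
    fix t
    have "norm (c w s) \<le> M * exp (K * \<bar>s\<bar>)" for s
    proof -
      have "norm (c w s) \<le> M * 1" using bnd by (simp add: c_def)
      also have "\<dots> \<le> M * exp (K * \<bar>s\<bar>)" using M K by (intro mult_left_mono) auto
      finally show ?thesis .
    qed
    then have "norm (G w t) \<le> M / K * exp (K * \<bar>t\<bar>)"
      by (rule antiderivative_exp_bound[OF G(2,1) K(1)])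
    then have "exp (- K * \<bar>t\<bar>) * norm (G w t) \<le> exp (- K * \<bar>t\<bar>) * (M / K * exp (K * \<bar>t\<bar>))"
      by (rule mult_left_mono) simp
    also have "\<dots> = M / K" by (simp add: exp_minus field_simps)
    finally have a: "exp (- K * \<bar>t\<bar>) * norm (G w t) \<le> M / K" .
    have b: "exp (- K * \<bar>t\<bar>) * norm z0 \<le> 1 * norm z0" using K by (intro mult_right_mono) auto
    have "norm (\<Phi> w t) = exp (- K * \<bar>t\<bar>) * norm (z0 + G w t)" by (simp add: \<Phi>_def)
    also have "\<dots> \<le> exp (- K * \<bar>t\<bar>) * (norm z0 + norm (G w t))"
      by (intro mult_left_mono norm_triangle_ineq) simp
    finally show "norm (\<Phi> w t) \<le> norm z0 + M / K" using a b by (simp add: distrib_left)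
  qed
  then have ap: "apply_bcontfun (Bcontfun (\<Phi> w)) = \<Phi> w" for w by (simp add: Bcontfun_inverse)
  have "\<exists>!w. Bcontfun (\<Phi> w) = w"
  proof (rule banach_fix_type)
    show "0 \<le> L / K" "L / K < 1" using L K by auto
    show "\<forall>v w. dist (Bcontfun (\<Phi> v)) (Bcontfun (\<Phi> w)) \<le> L / K * dist v w"
    proof (intro allI dist_bound)
      fix v w t
      have "norm (G v t - G w t) \<le> (L * dist v w) / K * exp (K * \<bar>t\<bar>)"
      proof (rule antiderivative_exp_bound[where g = "\<lambda>t. c v t - c w t"])
        show "((\<lambda>t. G v t - G w t) has_vector_derivative c v t - c w t) (at t)" for t
          using G(2) by (auto intro!: derivative_eq_intros)
        fix t
        have "norm (c v t - c w t) \<le> L * norm (exp (K * \<bar>t\<bar>) *\<^sub>R v t - exp (K * \<bar>t\<bar>) *\<^sub>R w t)"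
          unfolding c_def by (rule lipschitz_on_normD[OF lip]) auto
        also have "\<dots> = L * (exp (K * \<bar>t\<bar>) * dist (v t) (w t))"
          by (simp add: dist_norm flip: scaleR_diff_right)
        also have "\<dots> \<le> L * (exp (K * \<bar>t\<bar>) * dist v w)"
          using L dist_bounded by (intro mult_left_mono) auto
        finally show "norm (c v t - c w t) \<le> L * dist v w * exp (K * \<bar>t\<bar>)" by (simp add: mult_ac)
      qed (use G K in auto)
      then have "exp (- K * \<bar>t\<bar>) * norm (G v t - G w t)
          \<le> exp (- K * \<bar>t\<bar>) * ((L * dist v w) / K * exp (K * \<bar>t\<bar>))"
        by (rule mult_left_mono) simp
      also have "\<dots> = L / K * dist v w" by (simp add: exp_minus field_simps)
      finally show "dist (Bcontfun (\<Phi> v) t) (Bcontfun (\<Phi> w) t) \<le> L / K * dist v w"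
        by (simp add: ap \<Phi>_def dist_norm flip: scaleR_diff_right)
    qed
  qed
  then obtain w where w: "Bcontfun (\<Phi> w) = w" by blast
  define z where "z t = z0 + G w t" for t
  have z: "z t = exp (K * \<bar>t\<bar>) *\<^sub>R apply_bcontfun w t" for t
  proof -
    have "apply_bcontfun w t = \<Phi> w t" using ap[of w] w by simp
    then show ?thesis by (simp add: z_def \<Phi>_def flip: exp_add)
  qed
  have "(z has_vector_derivative c w t) (at t)" for t
    unfolding z_def using G(2) by (auto intro!: derivative_eq_intros)
  then have "(z has_vector_derivative f (z t)) (at t)" for t by (simp add: c_def z)
  moreover have "z 0 = z0" by (simp add: z_def G)
  ultimately show ?thesis by blast
qed

text \<open>
  On a finite-dimensional space this is local Lipschitz continuity; the balls are the ones to which the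
  vector field is cut off below.
\<close>

definition lipschitz_on_balls :: "('a::real_normed_vector \<Rightarrow> 'b::real_normed_vector) \<Rightarrow> bool" where
  "lipschitz_on_balls f \<longleftrightarrow> (\<forall>R. \<exists>L. L-lipschitz_on (cball 0 R) f)"

text \<open>
  Two solutions stay in a common ball, and with the Lipschitz constant \<open>L\<close> of that ball,
  \<open>exp (- 2 * L * t)\<close> times their squared distance is nonincreasing and \<open>exp (2 * L * t)\<close> times it
  nondecreasing. So agreement at one end of the interval spreads over it.
\<close>

lemma ode_unique_forward:
  fixes f :: "'a::euclidean_space \<Rightarrow> 'a"
  assumes lip: "lipschitz_on_balls f" and "a \<le> b"
    and x: "\<And>t. t \<in> {a..b} \<Longrightarrow> (x has_vector_derivative f (x t)) (at t)"
    and y: "\<And>t. t \<in> {a..b} \<Longrightarrow> (y has_vector_derivative f (y t)) (at t)"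
    and xy: "x s = y s" and s: "s = a \<or> s = b" and t: "t \<in> {a..b}"
  shows "x t = y t"
proof -
  have "continuous_on {a..b} x" "continuous_on {a..b} y"
    using x y by (meson continuous_at_imp_continuous_on has_vector_derivative_continuous)+
  then have "bounded (x ` {a..b} \<union> y ` {a..b})"
    by (simp add: compact_imp_bounded compact_continuous_image)
  then obtain R where R: "\<And>t. t \<in> {a..b} \<Longrightarrow> x t \<in> cball 0 R \<and> y t \<in> cball 0 R"
    unfolding bounded_iff by (metis Un_iff image_eqI mem_cball_0)
  obtain L where L: "L-lipschitz_on (cball 0 R) f" using lip by (auto simp: lipschitz_on_balls_def)
  define \<psi> where "\<psi> K t = exp (K * t) * ((x t - y t) \<bullet> (x t - y t))" for K t
  have der: "(\<psi> K has_real_derivative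
      exp (K * t) * (K * ((x t - y t) \<bullet> (x t - y t)) + 2 * ((x t - y t) \<bullet> (f (x t) - f (y t)))))
      (at t)" if "t \<in> {a..b}" for K t
  proof -
    have "((\<lambda>t. x t - y t) has_derivative (\<lambda>h. h *\<^sub>R (f (x t) - f (y t)))) (at t)"
      using has_vector_derivative_diff[OF x y] that by (simp add: has_vector_derivative_def)
    from has_derivative_inner[OF this this]
    have "((\<lambda>t. (x t - y t) \<bullet> (x t - y t)) has_real_derivative
        2 * ((x t - y t) \<bullet> (f (x t) - f (y t)))) (at t)"
      unfolding has_field_derivative_def
      by (rule has_derivative_eq_rhs) (simp add: fun_eq_iff inner_commute mult_ac)
    moreover have "((\<lambda>t. exp (K * t)) has_real_derivative K * exp (K * t)) (at t)"
      by (auto intro!: derivative_eq_intros)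
    ultimately show ?thesis unfolding \<psi>_def using DERIV_mult by (fastforce simp: algebra_simps elim!: DERIV_cong)
  qed
  have est: "\<bar>(x t - y t) \<bullet> (f (x t) - f (y t))\<bar> \<le> L * ((x t - y t) \<bullet> (x t - y t))"
    if "t \<in> {a..b}" for t
  proof -
    have "\<bar>(x t - y t) \<bullet> (f (x t) - f (y t))\<bar> \<le> norm (x t - y t) * norm (f (x t) - f (y t))"
      by (rule Cauchy_Schwarz_ineq2)
    also have "\<dots> \<le> norm (x t - y t) * (L * norm (x t - y t))"
      using lipschitz_on_normD[OF L] R that by (intro mult_left_mono) auto
    finally show ?thesis by (simp add: dot_square_norm power2_eq_square mult_ac)
  qed
  have nonneg: "\<psi> K t \<ge> 0" for K t by (simp add: \<psi>_def)
  have zero: "\<psi> K s = 0" for K by (simp add: \<psi>_def xy)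
  have "\<exists>K. \<psi> K t \<le> \<psi> K s"
    using s
  proof
    assume "s = a"
    have "\<psi> (- 2 * L) t \<le> \<psi> (- 2 * L) a"
    proof (rule DERIV_nonpos_imp_nonincreasing[where f = "\<psi> (- 2 * L)"])
      fix v assume v: "a \<le> v" "v \<le> t"
      then have "(\<psi> (- 2 * L) has_real_derivative
          exp (- 2 * L * v) * (- 2 * L * ((x v - y v) \<bullet> (x v - y v)) + 2 * ((x v - y v) \<bullet> (f (x v) - f (y v)))))
          (at v)"
        using der[of v "-2 * L"] t by simp
      moreover have "exp (- 2 * L * v) * (- 2 * L * ((x v - y v) \<bullet> (x v - y v)) + 2 * ((x v - y v) \<bullet> (f (x v) - f (y v)))) \<le> 0"
        using est[of v] t v by (intro mult_nonneg_nonpos) (auto simp: abs_le_iff)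
      ultimately show "\<exists>d. (\<psi> (- 2 * L) has_real_derivative d) (at v) \<and> d \<le> 0" by blast
    qed (use t in auto)
    then show ?thesis using \<open>s = a\<close> by auto
  next
    assume "s = b"
    have "\<psi> (2 * L) t \<le> \<psi> (2 * L) b"
    proof (rule DERIV_nonneg_imp_nondecreasing[where f = "\<psi> (2 * L)"])
      fix v assume v: "t \<le> v" "v \<le> b"
      then have "(\<psi> (2 * L) has_real_derivative
          exp (2 * L * v) * (2 * L * ((x v - y v) \<bullet> (x v - y v)) + 2 * ((x v - y v) \<bullet> (f (x v) - f (y v)))))
          (at v)"
        using der[of v "2 * L"] t by simp
      moreover have "exp (2 * L * v) * (2 * L * ((x v - y v) \<bullet> (x v - y v)) + 2 * ((x v - y v) \<bullet> (f (x v) - f (y v)))) \<ge> 0"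
        using est[of v] t v by (intro mult_nonneg_nonneg) (auto simp: abs_le_iff)
      ultimately show "\<exists>d. (\<psi> (2 * L) has_real_derivative d) (at v) \<and> d \<ge> 0" by blast
    qed (use t in auto)
    then show ?thesis using \<open>s = b\<close> by auto
  qed
  then obtain K where "\<psi> K t = 0" using zero nonneg by (metis order_antisym)
  then show ?thesis by (simp add: \<psi>_def)
qed

lemma ode_unique:
  fixes f :: "'a::euclidean_space \<Rightarrow> 'a"
  assumes lip: "lipschitz_on_balls f" and I: "is_interval I"
    and x: "\<And>t. t \<in> I \<Longrightarrow> (x has_vector_derivative f (x t)) (at t)"
    and y: "\<And>t. t \<in> I \<Longrightarrow> (y has_vector_derivative f (y t)) (at t)"
    and s: "s \<in> I" "x s = y s" and t: "t \<in> I"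
  shows "x t = y t"
proof -
  have sub: "{s..t} \<subseteq> I" "{t..s} \<subseteq> I"
    using mem_is_interval_1_I[OF I s(1) t] mem_is_interval_1_I[OF I t s(1)] by auto
  show ?thesis
  proof (cases "s \<le> t")
    case True
    show ?thesis
      by (rule ode_unique_forward[OF lip True, of x y s t])
         (use sub s True x y in auto)
  next
    case False
    show ?thesis
      by (rule ode_unique_forward[OF lip, of t s x y s t])
         (use sub s False x y in auto)
  qed
qed

text \<open>
  Composing \<open>f\<close> with the nearest point projection onto a ball makes it globally Lipschitz and
  bounded. The a priori bound keeps the solution of the modified equation inside the ball on
  \<open>[-T, T]\<close>, where both equations agree.
\<close>

lemma ode_solution_on_interval:
  fixes f :: "'a::euclidean_space \<Rightarrow> 'a"
  assumes lip: "lipschitz_on_balls f"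
    and apriori: "\<And>\<tau> z. 0 \<le> \<tau> \<Longrightarrow> \<tau> \<le> T \<Longrightarrow> z 0 = z0 \<Longrightarrow>
        (\<And>t. t \<in> {-\<tau>..\<tau>} \<Longrightarrow> (z has_vector_derivative f (z t)) (at t within {-\<tau>..\<tau>})) \<Longrightarrow>
        (\<And>t. t \<in> {-\<tau>..\<tau>} \<Longrightarrow> norm (z t) < R)"
    and T: "T \<ge> 0"
  shows "\<exists>z. z 0 = z0 \<and> (\<forall>t\<in>{-T<..<T}. (z has_vector_derivative f (z t)) (at t))"
proof -
  \<comment> \<open>The a priori bound on the degenerate interval, on which every curve is a solution.\<close>
  have "norm z0 < R"
  proof -
    have "at (0::real) within {0} = bot" by (simp add: at_within_eq_bot_iff)
    then have "((\<lambda>t::real. z0) has_vector_derivative f z0) (at 0 within {0})"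
      by (simp add: has_vector_derivative_def has_derivative_def bounded_linear_scaleR_left)
    then show ?thesis using apriori[of 0 "\<lambda>t. z0" 0] T by simp
  qed
  then have R: "R > 0" by (metis norm_ge_zero order_le_less_trans)
  define B where "B = cball (0::'a) R"
  have B: "convex B" "closed B" "B \<noteq> {}" "compact B" using R by (auto simp: B_def)
  obtain L where L: "L-lipschitz_on B f" using lip by (auto simp: lipschitz_on_balls_def B_def)
  define g where "g z = f (closest_point B z)" for z
  have "L-lipschitz_on UNIV g"
  proof (rule lipschitz_onI)
    fix x y
    have "dist (g x) (g y) \<le> L * dist (closest_point B x) (closest_point B y)"
      unfolding g_def using lipschitz_onD[OF L] closest_point_in_set[OF B(2,3)] by blast
    also have "\<dots> \<le> L * dist x y"
      using closest_point_lipschitz[OF B(1-3)] lipschitz_on_nonneg[OF L] by (rule mult_left_mono)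
    finally show "dist (g x) (g y) \<le> L * dist x y" .
  qed (rule lipschitz_on_nonneg[OF L])
  moreover have "bounded (f ` B)"
    using compact_continuous_image[OF lipschitz_on_continuous_on[OF L] B(4)] by (rule compact_imp_bounded)
  then obtain M where "\<And>z. norm (g z) \<le> M"
    unfolding g_def bounded_iff using closest_point_in_set[OF B(2,3)] by blast
  ultimately obtain z where z: "z 0 = z0" "\<And>t. (z has_vector_derivative g (z t)) (at t)"
    using lipschitz_ode_solution by metis
  have gf: "g x = f x" if "norm x \<le> R" for x
    using that by (simp add: g_def B_def closest_point_self)
  have zcont: "continuous_on A z" for A
    by (meson z(2) continuous_at_imp_continuous_on has_vector_derivative_continuous)
  have inside: "norm (z t) < R" if "t \<in> {-T..T}" for t
  proof (rule ccontr)
    assume "\<not> norm (z t) < R"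
    define S where "S = {t \<in> {-T..T}. R \<le> norm (z t)}"
    have "closed S"
      unfolding S_def by (intro continuous_closed_preimage_constant closed_Collect_le continuous_on_closed_Collect_le continuous_intros zcont closed_atLeastAtMost)
    then have "compact S"
      unfolding compact_eq_bounded_closed
      by (auto simp: S_def intro: bounded_subset[OF bounded_closed_interval[of "-T" T]])
    moreover have "S \<noteq> {}" using that \<open>\<not> norm (z t) < R\<close> by (auto simp: S_def)
    moreover have "continuous_on S abs" by (intro continuous_intros)
    \<comment> \<open>\<open>\<sigma>\<close> is a time of least modulus at which the solution has left the open ball.\<close>
    ultimately obtain \<sigma> where \<sigma>: "\<sigma> \<in> S" "\<And>s. s \<in> S \<Longrightarrow> \<bar>\<sigma>\<bar> \<le> \<bar>s\<bar>"
      using continuous_attains_inf[of S abs] by auto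
    define \<tau> where "\<tau> = \<bar>\<sigma>\<bar>"
    have \<tau>: "0 \<le> \<tau>" "\<tau> \<le> T" "\<sigma> \<in> {-\<tau>..\<tau>}" using \<sigma> by (auto simp: \<tau>_def S_def)
    have "\<sigma> \<noteq> 0" using \<sigma> z(1) \<open>norm z0 < R\<close> by (auto simp: S_def)
    then have cl: "closure {-\<tau><..<\<tau>} = {-\<tau>..\<tau>}" by (simp add: \<tau>_def closure_greaterThanLessThan)
    have le: "norm (z s) \<le> R" if "s \<in> {-\<tau>..\<tau>}" for s
    proof (rule continuous_le_on_closure[of "{-\<tau><..<\<tau>}" "\<lambda>s. norm (z s)"])
      show "s \<in> closure {-\<tau><..<\<tau>}" using that by (simp only: cl)
      fix v assume v: "v \<in> {-\<tau><..<\<tau>}"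
      then have "v \<notin> S" using \<sigma>(2)[of v] by (auto simp: \<tau>_def)
      then show "norm (z v) \<le> R" using v \<tau>(2) by (auto simp: S_def)
    qed (intro continuous_intros zcont)
    have "norm (z \<sigma>) < R"
    proof (rule apriori[where \<tau> = \<tau> and z = z, OF \<tau>(1,2) z(1) _ \<tau>(3)])
      fix s assume "s \<in> {-\<tau>..\<tau>}"
      then show "(z has_vector_derivative f (z s)) (at s within {-\<tau>..\<tau>})"
        using has_vector_derivative_at_within[OF z(2)[of s]] gf[OF le] by simp
    qed
    then show False using \<sigma>(1) by (simp add: S_def)
  qed
  have "(z has_vector_derivative f (z t)) (at t)" if "t \<in> {-T<..<T}" for t
  proof -
    have "g (z t) = f (z t)" using gf inside[of t] that by simp
    then show ?thesis using z(2)[of t] by simp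
  qed
  with z(1) show ?thesis by blast
qed

text \<open>By uniqueness the solutions on the intervals \<open>(-N, N)\<close> fit together.\<close>

lemma ode_global_solution:
  fixes f :: "'a::euclidean_space \<Rightarrow> 'a"
  assumes lip: "lipschitz_on_balls f"
    and apriori: "\<And>T. T \<ge> 0 \<Longrightarrow> \<exists>R. \<forall>\<tau> z. 0 \<le> \<tau> \<longrightarrow> \<tau> \<le> T \<longrightarrow> z 0 = z0 \<longrightarrow>
        (\<forall>t\<in>{-\<tau>..\<tau>}. (z has_vector_derivative f (z t)) (at t within {-\<tau>..\<tau>})) \<longrightarrow>
        (\<forall>t\<in>{-\<tau>..\<tau>}. norm (z t) < R)"
  shows "\<exists>z. z 0 = z0 \<and> (\<forall>t. (z has_vector_derivative f (z t)) (at t))"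
proof -
  have "\<exists>z. z 0 = z0 \<and> (\<forall>t\<in>{-real N<..<real N}. (z has_vector_derivative f (z t)) (at t))" for N :: nat
  proof -
    have "real N \<ge> 0" by simp
    from apriori[OF this] obtain R where R: "\<forall>\<tau> z. 0 \<le> \<tau> \<longrightarrow> \<tau> \<le> real N \<longrightarrow> z 0 = z0 \<longrightarrow>
        (\<forall>t\<in>{-\<tau>..\<tau>}. (z has_vector_derivative f (z t)) (at t within {-\<tau>..\<tau>})) \<longrightarrow>
        (\<forall>t\<in>{-\<tau>..\<tau>}. norm (z t) < R)" ..
    show ?thesis
    proof (rule ode_solution_on_interval[OF lip, where R = R])
      fix \<tau> z t
      assume "0 \<le> \<tau>" "\<tau> \<le> real N" "z 0 = z0" "t \<in> {-\<tau>..\<tau>}"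
        "\<And>t. t \<in> {-\<tau>..\<tau>} \<Longrightarrow> (z has_vector_derivative f (z t)) (at t within {-\<tau>..\<tau>})"
      then show "norm (z t) < R" using R[rule_format, of \<tau> z t] by simp
    qed simp
  qed
  then have "\<forall>N::nat. \<exists>z. z 0 = z0 \<and>
      (\<forall>t\<in>{-real N<..<real N}. (z has_vector_derivative f (z t)) (at t))" by blast
  from choice[OF this] obtain \<zeta> where \<zeta>: "\<And>N. \<zeta> N 0 = z0"
    "\<And>N t. t \<in> {-real N<..<real N} \<Longrightarrow> (\<zeta> N has_vector_derivative f (\<zeta> N t)) (at t)"
    by blast
  have agree: "\<zeta> N t = \<zeta> M t" if "\<bar>t\<bar> < real N" "\<bar>t\<bar> < real M" for N M t
  proof (rule ode_unique[OF lip, of "{- min (real N) (real M)<..<min (real N) (real M)}" _ _ 0])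
    show "is_interval {- min (real N) (real M)<..<min (real N) (real M)}"
      by (simp add: is_interval_def Basis_real_def)
  qed (use \<zeta> that in auto)
  define idx where "idx t = nat \<lceil>\<bar>t\<bar>\<rceil> + 1" for t :: real
  have idx: "\<bar>t\<bar> < real (idx t)" for t unfolding idx_def by linarith
  define z where "z t = \<zeta> (idx t) t" for t
  have "(z has_vector_derivative f (z t)) (at t)" for t
  proof (rule has_vector_derivative_transform_within_open)
    show "(\<zeta> (idx t) has_vector_derivative f (z t)) (at t)"
      unfolding z_def using idx[of t] by (intro \<zeta>(2)) auto
    show "t \<in> {- real (idx t)<..<real (idx t)}" using idx[of t] by auto
    show "\<zeta> (idx t) s = z s" if "s \<in> {- real (idx t)<..<real (idx t)}" for s
      unfolding z_def using that idx[of s] by (intro agree) auto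
  qed simp
  moreover have "z 0 = z0" by (simp add: z_def \<zeta>)
  ultimately show ?thesis by blast
qed

section \<open>Calculus of smooth functions of several variables\<close>

lemma partial_deriv_eqI: "(f has_derivative D) (at x) \<Longrightarrow> partial_deriv i f x = D (axis i 1)"
  by (simp add: partial_deriv_def frechet_derivative_at[symmetric])

lemma has_derivative_partials:
  fixes f :: "real^'n::finite \<Rightarrow> real"
  assumes "f differentiable (at x)"
  shows "(f has_derivative (\<lambda>h. \<Sum>i\<in>UNIV. h $ i * partial_deriv i f x)) (at x)"
proof -
  have d: "(f has_derivative frechet_derivative f (at x)) (at x)"
    using assms by (simp add: frechet_derivative_works)
  then have lin: "linear (frechet_derivative f (at x))" by (rule has_derivative_linear)
  have "frechet_derivative f (at x) = (\<lambda>h. \<Sum>i\<in>UNIV. h $ i * partial_deriv i f x)"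
  proof
    fix h :: "real^'n"
    have "frechet_derivative f (at x) h = frechet_derivative f (at x) (\<Sum>i\<in>UNIV. h $ i *\<^sub>R axis i 1)"
      by (metis basis_expansion scalar_mult_eq_scaleR)
    also have "\<dots> = (\<Sum>i\<in>UNIV. h $ i * partial_deriv i f x)"
      by (simp add: linear_sum[OF lin] linear_scale[OF lin] partial_deriv_def)
    finally show "frechet_derivative f (at x) h = (\<Sum>i\<in>UNIV. h $ i * partial_deriv i f x)" .
  qed
  with d show ?thesis by simp
qed

lemma Ck_on_Suc_differentiable: "Ck_on (Suc k) UNIV f \<Longrightarrow> f differentiable (at x)"
  by (simp add: differentiable_on_def)

lemma Ck_on_SucI:
  assumes "\<And>x. f differentiable (at x)" "\<And>i. Ck_on k UNIV (partial_deriv i f)"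
  shows "Ck_on (Suc k) UNIV f"
  using assms by (simp add: differentiable_on_def)

lemma Ck_on_Suc_imp: "Ck_on (Suc k) UNIV f \<Longrightarrow> Ck_on k UNIV f"
proof (induction k arbitrary: f)
  case 0
  then show ?case by (simp add: differentiable_imp_continuous_on)
qed auto

lemma Ck_on_add: "Ck_on k UNIV f \<Longrightarrow> Ck_on k UNIV g \<Longrightarrow> Ck_on k UNIV (\<lambda>x. f x + g x)"
proof (induction k arbitrary: f g)
  case 0
  then show ?case by (auto intro: continuous_intros)
next
  case (Suc k)
  have d: "f differentiable (at x)" "g differentiable (at x)" for x
    using Suc.prems Ck_on_Suc_differentiable by blast+
  have "partial_deriv i (\<lambda>x. f x + g x) = (\<lambda>x. partial_deriv i f x + partial_deriv i g x)" for i
  proof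
    fix x
    have "((\<lambda>x. f x + g x) has_derivative
        (\<lambda>h. frechet_derivative f (at x) h + frechet_derivative g (at x) h)) (at x)"
      using d by (intro has_derivative_add) (simp_all add: frechet_derivative_works)
    from partial_deriv_eqI[OF this]
    show "partial_deriv i (\<lambda>x. f x + g x) x = partial_deriv i f x + partial_deriv i g x"
      by (simp add: partial_deriv_def)
  qed
  then show ?case
    using Suc by (intro Ck_on_SucI) (auto intro: differentiable_add d)
qed

lemma Ck_on_mult: "Ck_on k UNIV f \<Longrightarrow> Ck_on k UNIV g \<Longrightarrow> Ck_on k UNIV (\<lambda>x. f x * g x)"
proof (induction k arbitrary: f g)
  case 0
  then show ?case by (auto intro: continuous_intros)
next
  case (Suc k)
  have d: "f differentiable (at x)" "g differentiable (at x)" for x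
    using Suc.prems Ck_on_Suc_differentiable by blast+
  have "partial_deriv i (\<lambda>x. f x * g x) = (\<lambda>x. f x * partial_deriv i g x + partial_deriv i f x * g x)" for i
  proof
    fix x
    have "((\<lambda>x. f x * g x) has_derivative
        (\<lambda>h. f x * frechet_derivative g (at x) h + frechet_derivative f (at x) h * g x)) (at x)"
      using d by (intro has_derivative_mult) (simp_all add: frechet_derivative_works)
    from partial_deriv_eqI[OF this]
    show "partial_deriv i (\<lambda>x. f x * g x) x = f x * partial_deriv i g x + partial_deriv i f x * g x"
      by (simp add: partial_deriv_def)
  qed
  moreover have "Ck_on k UNIV (\<lambda>x. f x * partial_deriv i g x + partial_deriv i f x * g x)" for i
    using Suc.prems Ck_on_Suc_imp by (intro Ck_on_add Suc.IH) auto
  ultimately show ?case by (intro Ck_on_SucI) (auto intro: differentiable_mult d)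
qed

lemma Ck_on_cmult: "Ck_on k UNIV f \<Longrightarrow> Ck_on k UNIV (\<lambda>x. c * f x)"
  by (intro Ck_on_mult Ck_on_const)

lemma Ck_on_diff: "Ck_on k UNIV f \<Longrightarrow> Ck_on k UNIV g \<Longrightarrow> Ck_on k UNIV (\<lambda>x. f x - g x)"
  using Ck_on_add[OF _ Ck_on_cmult[of k g "-1"], of f] by simp

lemma Ck_on_inverse:
  "Ck_on k UNIV f \<Longrightarrow> (\<And>x. f x \<noteq> 0) \<Longrightarrow> Ck_on k UNIV (\<lambda>x. inverse (f x))"
proof (induction k arbitrary: f)
  case 0
  then show ?case by (auto intro: continuous_intros)
next
  case (Suc k)
  have d: "f differentiable (at x)" for x
    using Suc.prems Ck_on_Suc_differentiable by blast
  have "partial_deriv i (\<lambda>x. inverse (f x)) =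
      (\<lambda>x. -1 * (inverse (f x) * inverse (f x) * partial_deriv i f x))" for i
  proof
    fix x
    have "((\<lambda>x. inverse (f x)) has_derivative
        (\<lambda>h. - (inverse (f x) * frechet_derivative f (at x) h * inverse (f x)))) (at x)"
      using d Suc.prems(2) by (intro Deriv.has_derivative_inverse) (simp_all add: frechet_derivative_works)
    from partial_deriv_eqI[OF this]
    show "partial_deriv i (\<lambda>x. inverse (f x)) x = -1 * (inverse (f x) * inverse (f x) * partial_deriv i f x)"
      by (simp add: partial_deriv_def)
  qed
  moreover have "Ck_on k UNIV (\<lambda>x. -1 * (inverse (f x) * inverse (f x) * partial_deriv i f x))" for i
    using Suc Ck_on_Suc_imp by (intro Ck_on_cmult Ck_on_mult Suc.IH) auto
  ultimately show ?case using Suc.prems(2)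
    by (intro Ck_on_SucI) (auto intro: differentiable_inverse d)
qed

lemma Ck_on_sum: "(\<And>i. i \<in> A \<Longrightarrow> Ck_on k UNIV (f i)) \<Longrightarrow> Ck_on k UNIV (\<lambda>x. \<Sum>i\<in>A. f i x)"
  by (induction A rule: infinite_finite_induct) (auto intro: Ck_on_const Ck_on_add)

lemma Ck_on_poly: "Ck_on k UNIV f \<Longrightarrow> Ck_on k UNIV (\<lambda>x. poly p (f x))"
  by (induction p) (auto intro: Ck_on_const Ck_on_add Ck_on_mult)

lemma Ck_on_component: "Ck_on k UNIV (\<lambda>y. y $ j)"
  using Ck_on_coordinate[of k UNIV j 0] by simp

lemma Ck_on_subset: "Ck_on k U f \<Longrightarrow> V \<subseteq> U \<Longrightarrow> Ck_on k V f"
  by (induction k arbitrary: f) (auto intro: continuous_on_subset differentiable_on_subset)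

lemma smooth_on_UNIV_partial: "smooth_on UNIV f \<Longrightarrow> smooth_on UNIV (partial_deriv i f)"
  unfolding smooth_on_def by (metis Ck_on.simps(2))

lemma smooth_on_UNIV_differentiable: "smooth_on UNIV f \<Longrightarrow> f differentiable (at x)"
  unfolding smooth_on_def by (metis Ck_on_Suc_differentiable)

text \<open>The vector field of the geodesic equation is polynomial in the velocity with smooth
  coefficients; the following closure rules make it Lipschitz on every ball.\<close>

lemma lipschitz_on_ballsI:
  fixes f :: "'a::real_normed_vector \<Rightarrow> 'b::real_normed_vector"
  assumes "\<And>R. R \<ge> 0 \<Longrightarrow> \<exists>L\<ge>0. \<forall>x\<in>cball 0 R. \<forall>y\<in>cball 0 R. norm (f x - f y) \<le> L * norm (x - y)"
  shows "lipschitz_on_balls f"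
  unfolding lipschitz_on_balls_def
proof
  fix R
  show "\<exists>L. L-lipschitz_on (cball 0 R) f"
  proof (cases "R \<ge> 0")
    case True
    then show ?thesis using assms[OF True] by (auto simp: lipschitz_on_def dist_norm)
  next
    case False
    then have "cball (0::'a) R = {}" by simp
    then show ?thesis by (intro exI[of _ 0]) (simp add: lipschitz_on_def)
  qed
qed

lemma lipschitz_on_ballsD:
  fixes f :: "'a::real_normed_vector \<Rightarrow> 'b::real_normed_vector"
  assumes "lipschitz_on_balls f"
  shows "\<exists>L\<ge>0. \<forall>x\<in>cball 0 R. \<forall>y\<in>cball 0 R. norm (f x - f y) \<le> L * norm (x - y)"
  using assms unfolding lipschitz_on_balls_def lipschitz_on_def dist_norm by blast

lemma lipschitz_on_balls_const: "lipschitz_on_balls (\<lambda>x. c)"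
  by (rule lipschitz_on_ballsI) (auto intro: exI[of _ 0])

lemma lipschitz_on_balls_linear:
  assumes "bounded_linear f"
  shows "lipschitz_on_balls f"
proof (rule lipschitz_on_ballsI)
  obtain K where K: "K > 0" "\<And>x. norm (f x) \<le> norm x * K"
    using bounded_linear.pos_bounded[OF assms] by blast
  have "norm (f x - f y) \<le> K * norm (x - y)" for x y
    using K(2)[of "x - y"] by (simp add: linear_diff[OF bounded_linear.linear[OF assms]] mult.commute)
  then show "\<exists>L\<ge>0. \<forall>x\<in>cball 0 R. \<forall>y\<in>cball 0 R. norm (f x - f y) \<le> L * norm (x - y)" for R
    using K(1) by (meson less_imp_le)
qed

lemma lipschitz_on_balls_add:
  assumes "lipschitz_on_balls f" "lipschitz_on_balls g"
  shows "lipschitz_on_balls (\<lambda>x. f x + g x)"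
proof (rule lipschitz_on_ballsI)
  fix R :: real
  obtain L where L: "L \<ge> 0" "\<forall>x\<in>cball 0 R. \<forall>y\<in>cball 0 R. norm (f x - f y) \<le> L * norm (x - y)"
    using lipschitz_on_ballsD[OF assms(1)] by blast
  obtain M where M: "M \<ge> 0" "\<forall>x\<in>cball 0 R. \<forall>y\<in>cball 0 R. norm (g x - g y) \<le> M * norm (x - y)"
    using lipschitz_on_ballsD[OF assms(2)] by blast
  have "norm (f x + g x - (f y + g y)) \<le> (L + M) * norm (x - y)"
    if "x \<in> cball 0 R" "y \<in> cball 0 R" for x y
    using norm_diff_triangle_ineq[of "f x" "g x" "f y" "g y"] L(2) M(2) that
    by (force simp: distrib_right)
  then show "\<exists>L\<ge>0. \<forall>x\<in>cball 0 R. \<forall>y\<in>cball 0 R. norm (f x + g x - (f y + g y)) \<le> L * norm (x - y)"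
    using L(1) M(1) by (intro exI[of _ "L + M"]) auto
qed

lemma lipschitz_on_balls_sum:
  "(\<And>i. i \<in> A \<Longrightarrow> lipschitz_on_balls (f i)) \<Longrightarrow> lipschitz_on_balls (\<lambda>x. \<Sum>i\<in>A. f i x)"
  by (induction A rule: infinite_finite_induct)
     (auto intro: lipschitz_on_balls_const lipschitz_on_balls_add)

lemma lipschitz_on_balls_mult:
  fixes f g :: "'a::real_normed_vector \<Rightarrow> real"
  assumes "lipschitz_on_balls f" "lipschitz_on_balls g"
  shows "lipschitz_on_balls (\<lambda>x. f x * g x)"
proof (rule lipschitz_on_ballsI)
  fix R :: real assume R: "R \<ge> 0"
  obtain L where L: "L \<ge> 0" "\<forall>x\<in>cball 0 R. \<forall>y\<in>cball 0 R. norm (f x - f y) \<le> L * norm (x - y)"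
    using lipschitz_on_ballsD[OF assms(1)] by blast
  obtain M where M: "M \<ge> 0" "\<forall>x\<in>cball 0 R. \<forall>y\<in>cball 0 R. norm (g x - g y) \<le> M * norm (x - y)"
    using lipschitz_on_ballsD[OF assms(2)] by blast
  have bnd: "\<bar>h x\<bar> \<le> \<bar>h 0\<bar> + K * R"
    if "K \<ge> 0" "\<forall>x\<in>cball 0 R. \<forall>y\<in>cball 0 R. norm (h x - h y) \<le> K * norm (x - y)" "x \<in> cball 0 R"
    for h :: "'a \<Rightarrow> real" and K x
  proof -
    have "\<bar>h x - h 0\<bar> \<le> K * norm (x - 0)" using that(2,3) R by (metis centre_in_cball real_norm_def)
    also have "\<dots> \<le> K * R" using that(1,3) by (intro mult_left_mono) auto
    finally show ?thesis by linarith
  qed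
  define F G where "F = \<bar>f 0\<bar> + L * R" and "G = \<bar>g 0\<bar> + M * R"
  have "\<bar>f x * g x - f y * g y\<bar> \<le> (F * M + G * L) * norm (x - y)"
    if x: "x \<in> cball 0 R" and y: "y \<in> cball 0 R" for x y
  proof -
    have "f x * g x - f y * g y = f x * (g x - g y) + g y * (f x - f y)" by (simp add: algebra_simps)
    then have "\<bar>f x * g x - f y * g y\<bar> \<le> \<bar>f x\<bar> * \<bar>g x - g y\<bar> + \<bar>g y\<bar> * \<bar>f x - f y\<bar>"
      by (metis abs_mult abs_triangle_ineq)
    also have "\<dots> \<le> F * (M * norm (x - y)) + G * (L * norm (x - y))"
      using bnd[OF L x] bnd[OF M y] L M x y unfolding F_def G_def
      by (intro add_mono mult_mono) auto
    finally show ?thesis by (simp add: algebra_simps)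
  qed
  moreover have "F * M + G * L \<ge> 0" using L M R by (simp add: F_def G_def)
  ultimately show "\<exists>L\<ge>0. \<forall>x\<in>cball 0 R. \<forall>y\<in>cball 0 R. norm (f x * g x - f y * g y) \<le> L * norm (x - y)"
    by (intro exI[of _ "F * M + G * L"]) auto
qed

lemma lipschitz_on_balls_compose_fst:
  assumes "lipschitz_on_balls f"
  shows "lipschitz_on_balls (\<lambda>z::'a::real_normed_vector \<times> 'c::real_normed_vector. f (fst z))"
proof (rule lipschitz_on_ballsI)
  fix R :: real
  obtain L where L: "L \<ge> 0" "\<forall>x\<in>cball 0 R. \<forall>y\<in>cball 0 R. norm (f x - f y) \<le> L * norm (x - y)"
    using lipschitz_on_ballsD[OF assms] by blast
  have "norm (f (fst z) - f (fst w)) \<le> L * norm (z - w)"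
    if "z \<in> cball 0 R" "w \<in> cball 0 R" for z w :: "'a \<times> 'c"
  proof -
    have nf: "norm (fst v) \<le> norm v" for v :: "'a \<times> 'c"
      by (metis norm_fst_le surjective_pairing)
    have "fst z \<in> cball 0 R" "fst w \<in> cball 0 R" "norm (fst z - fst w) \<le> norm (z - w)"
      using that order_trans[OF nf[of z]] order_trans[OF nf[of w]] nf[of "z - w"] by auto
    then show ?thesis using L by (meson mult_left_mono order_trans)
  qed
  then show "\<exists>L\<ge>0. \<forall>z\<in>cball (0::'a \<times> 'c) R. \<forall>w\<in>cball 0 R. norm (f (fst z) - f (fst w)) \<le> L * norm (z - w)"
    using L(1) by blast
qed

lemma lipschitz_on_balls_Pair:
  assumes "lipschitz_on_balls f" "lipschitz_on_balls g"
  shows "lipschitz_on_balls (\<lambda>x. (f x, g x))"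
proof (rule lipschitz_on_ballsI)
  fix R :: real
  obtain L where L: "L \<ge> 0" "\<forall>x\<in>cball 0 R. \<forall>y\<in>cball 0 R. norm (f x - f y) \<le> L * norm (x - y)"
    using lipschitz_on_ballsD[OF assms(1)] by blast
  obtain M where M: "M \<ge> 0" "\<forall>x\<in>cball 0 R. \<forall>y\<in>cball 0 R. norm (g x - g y) \<le> M * norm (x - y)"
    using lipschitz_on_ballsD[OF assms(2)] by blast
  have "norm ((f x, g x) - (f y, g y)) \<le> (L + M) * norm (x - y)"
    if "x \<in> cball 0 R" "y \<in> cball 0 R" for x y
    using norm_Pair_le[of "f x - f y" "g x - g y"] L(2) M(2) that by (force simp: distrib_right)
  then show "\<exists>L\<ge>0. \<forall>x\<in>cball 0 R. \<forall>y\<in>cball 0 R. norm ((f x, g x) - (f y, g y)) \<le> L * norm (x - y)"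
    using L(1) M(1) by (intro exI[of _ "L + M"]) auto
qed

lemma lipschitz_on_balls_vec:
  fixes f :: "'a::real_normed_vector \<Rightarrow> real^'n::finite"
  assumes "\<And>k. lipschitz_on_balls (\<lambda>x. f x $ k)"
  shows "lipschitz_on_balls f"
proof (rule lipschitz_on_ballsI)
  fix R :: real
  have "\<forall>k. \<exists>L\<ge>0. \<forall>x\<in>cball 0 R. \<forall>y\<in>cball 0 R. norm (f x $ k - f y $ k) \<le> L * norm (x - y)"
    using lipschitz_on_ballsD[OF assms] by blast
  then obtain L where L: "\<And>k. L k \<ge> 0"
    "\<And>k x y. x \<in> cball 0 R \<Longrightarrow> y \<in> cball 0 R \<Longrightarrow> norm (f x $ k - f y $ k) \<le> L k * norm (x - y)"
    by metis
  have "norm (f x - f y) \<le> (\<Sum>k\<in>UNIV. L k) * norm (x - y)"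
    if "x \<in> cball 0 R" "y \<in> cball 0 R" for x y
  proof -
    have "norm (f x - f y) \<le> (\<Sum>k\<in>UNIV. \<bar>(f x - f y) $ k\<bar>)" by (rule norm_le_l1_cart)
    also have "\<dots> \<le> (\<Sum>k\<in>UNIV. L k * norm (x - y))" using L(2)[OF that] by (intro sum_mono) simp
    finally show ?thesis by (simp add: sum_distrib_right)
  qed
  then show "\<exists>L\<ge>0. \<forall>x\<in>cball 0 R. \<forall>y\<in>cball 0 R. norm (f x - f y) \<le> L * norm (x - y)"
    using L(1) by (intro exI[of _ "\<Sum>k\<in>UNIV. L k"]) (auto intro: sum_nonneg)
qed

lemma lipschitz_on_balls_C1:
  fixes f :: "real^'n::finite \<Rightarrow> real"
  assumes "Ck_on (Suc 0) UNIV f"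
  shows "lipschitz_on_balls f"
proof (rule lipschitz_on_ballsI)
  fix R :: real assume R: "R \<ge> 0"
  have "\<exists>B\<ge>0. \<forall>x\<in>cball 0 R. \<bar>partial_deriv i f x\<bar> \<le> B" for i
  proof -
    have "continuous_on (cball 0 R) (partial_deriv i f)"
      using assms by (auto intro: continuous_on_subset)
    then have "bounded (partial_deriv i f ` cball 0 R)"
      by (simp add: compact_imp_bounded compact_continuous_image)
    then show ?thesis unfolding bounded_pos by (auto intro: less_imp_le)
  qed
  then obtain B where B: "\<And>i. B i \<ge> 0" "\<And>i x. x \<in> cball 0 R \<Longrightarrow> \<bar>partial_deriv i f x\<bar> \<le> B i"
    by metis
  have "norm (f x - f y) \<le> (\<Sum>i\<in>UNIV. B i) * norm (x - y)" if "x \<in> cball 0 R" "y \<in> cball 0 R" for x y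
  proof (rule differentiable_bound[OF convex_cball _ _ that])
    fix z :: "real^'n" assume z: "z \<in> cball 0 R"
    show "(f has_derivative (\<lambda>h. \<Sum>i\<in>UNIV. h $ i * partial_deriv i f z)) (at z within cball 0 R)"
      using has_derivative_partials[OF Ck_on_Suc_differentiable[OF assms]]
      by (rule has_derivative_at_withinI)
    show "onorm (\<lambda>h. \<Sum>i\<in>UNIV. h $ i * partial_deriv i f z) \<le> (\<Sum>i\<in>UNIV. B i)"
    proof (rule onorm_le)
      fix h :: "real^'n"
      have "norm (\<Sum>i\<in>UNIV. h $ i * partial_deriv i f z) \<le> (\<Sum>i\<in>UNIV. \<bar>h $ i * partial_deriv i f z\<bar>)"
        using sum_abs by simp
      also have "\<dots> \<le> (\<Sum>i\<in>UNIV. B i * norm h)"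
      proof (rule sum_mono)
        fix i
        have "\<bar>h $ i * partial_deriv i f z\<bar> \<le> norm h * B i"
          unfolding abs_mult using B(2)[OF z] component_le_norm_cart[of h i] by (intro mult_mono) auto
        then show "\<bar>h $ i * partial_deriv i f z\<bar> \<le> B i * norm h" by (simp add: mult.commute)
      qed
      finally show "norm (\<Sum>i\<in>UNIV. h $ i * partial_deriv i f z) \<le> (\<Sum>i\<in>UNIV. B i) * norm h"
        by (simp add: sum_distrib_right)
    qed
  qed
  then show "\<exists>L\<ge>0. \<forall>x\<in>cball 0 R. \<forall>y\<in>cball 0 R. norm (f x - f y) \<le> L * norm (x - y)"
    using B(1) by (intro exI[of _ "\<Sum>i\<in>UNIV. B i"]) (auto intro: sum_nonneg)
qed

section \<open>The geodesic flow\<close>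

definition geodesic_field :: "(real^'n::finite \<Rightarrow> real^'n^'n) \<Rightarrow> (real^'n) \<times> (real^'n) \<Rightarrow> (real^'n) \<times> (real^'n)" where
  "geodesic_field G z =
     (snd z, \<chi> k. - (\<Sum>i\<in>UNIV. \<Sum>j\<in>UNIV. christoffel G k i j (fst z) * snd z $ i * snd z $ j))"

definition geodesic_flow_line :: "(real^'n::finite \<Rightarrow> real^'n^'n) \<Rightarrow> (real \<Rightarrow> (real^'n) \<times> (real^'n)) \<Rightarrow> bool" where
  "geodesic_flow_line G z \<longleftrightarrow> (\<forall>t. (z has_vector_derivative geodesic_field G (z t)) (at t))"

lemma lipschitz_geodesic_field:
  assumes "\<And>k i j. Ck_on (Suc 0) UNIV (christoffel G k i j)"
  shows "lipschitz_on_balls (geodesic_field G)"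
proof -
  have v: "lipschitz_on_balls (\<lambda>z::(real^'a) \<times> (real^'a). snd z $ i)" for i
    by (intro lipschitz_on_balls_linear bounded_linear_compose[OF bounded_linear_vec_nth bounded_linear_snd])
  have "lipschitz_on_balls (\<lambda>z. \<chi> k. - (\<Sum>i\<in>UNIV. \<Sum>j\<in>UNIV. christoffel G k i j (fst z) * snd z $ i * snd z $ j))"
  proof (rule lipschitz_on_balls_vec)
    fix k
    have "lipschitz_on_balls (\<lambda>z. -1 * (\<Sum>i\<in>UNIV. \<Sum>j\<in>UNIV. christoffel G k i j (fst z) * snd z $ i * snd z $ j))"
      by (intro lipschitz_on_balls_mult lipschitz_on_balls_const lipschitz_on_balls_sum v
          lipschitz_on_balls_compose_fst lipschitz_on_balls_C1 assms)
    then show "lipschitz_on_balls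
        (\<lambda>z. (\<chi> k. - (\<Sum>i\<in>UNIV. \<Sum>j\<in>UNIV. christoffel G k i j (fst z) * snd z $ i * snd z $ j)) $ k)"
      by simp
  qed
  then show ?thesis unfolding geodesic_field_def
    by (rule lipschitz_on_balls_Pair[OF lipschitz_on_balls_linear[OF bounded_linear_snd]])
qed

text \<open>Lowering the upper index removes the inverse metric, which makes the energy balance computable.\<close>

lemma christoffel_lower:
  assumes "invertible (G x)"
  shows "(\<Sum>k\<in>UNIV. G x $ j $ k * christoffel G k a b x) =
     (1/2) * (partial_deriv a (\<lambda>y. G y $ b $ j) x + partial_deriv b (\<lambda>y. G y $ a $ j) x
       - partial_deriv j (\<lambda>y. G y $ a $ b) x)"
proof -
  define D where "D l = partial_deriv a (\<lambda>y. G y $ b $ l) x + partial_deriv b (\<lambda>y. G y $ a $ l) x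
       - partial_deriv l (\<lambda>y. G y $ a $ b) x" for l
  have inv: "(\<Sum>k\<in>UNIV. G x $ j $ k * matrix_inv (G x) $ k $ l) = (if j = l then 1 else 0)" for l
  proof -
    have "G x ** matrix_inv (G x) = mat 1"
      using assms unfolding invertible_def matrix_inv_def
      by (metis (mono_tags, lifting) someI_ex)
    then have "(G x ** matrix_inv (G x)) $ j $ l = mat 1 $ j $ l" by simp
    then show ?thesis by (simp add: matrix_matrix_mult_def mat_def)
  qed
  have "(\<Sum>k\<in>UNIV. G x $ j $ k * christoffel G k a b x) =
      (\<Sum>k\<in>UNIV. \<Sum>l\<in>UNIV. (1/2) * (G x $ j $ k * matrix_inv (G x) $ k $ l) * D l)"
    by (simp add: christoffel_def D_def sum_distrib_left mult_ac)
  also have "\<dots> = (\<Sum>l\<in>UNIV. \<Sum>k\<in>UNIV. (1/2) * (G x $ j $ k * matrix_inv (G x) $ k $ l) * D l)"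
    by (rule sum.swap)
  also have "\<dots> = (\<Sum>l\<in>UNIV. (1/2) * (\<Sum>k\<in>UNIV. G x $ j $ k * matrix_inv (G x) $ k $ l) * D l)"
    by (simp add: sum_distrib_left sum_distrib_right mult_ac)
  also have "\<dots> = (1/2) * D j"
    by (simp only: inv) (simp add: if_distrib if_distribR cong: if_cong)
  finally show ?thesis by (simp add: D_def)
qed

lemma flow_components:
  assumes "(z has_vector_derivative geodesic_field G (z t)) (at t within A)"
  shows "((\<lambda>t. fst (z t)) has_vector_derivative snd (z t)) (at t within A)"
    and "((\<lambda>t. snd (z t)) has_vector_derivative snd (geodesic_field G (z t))) (at t within A)"
proof -
  have d: "(z has_derivative (\<lambda>h. h *\<^sub>R geodesic_field G (z t))) (at t within A)"
    using assms by (simp add: has_vector_derivative_def)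
  show "((\<lambda>t. fst (z t)) has_vector_derivative snd (z t)) (at t within A)"
    using has_derivative_fst[OF d] by (simp add: has_vector_derivative_def geodesic_field_def)
  show "((\<lambda>t. snd (z t)) has_vector_derivative snd (geodesic_field G (z t))) (at t within A)"
    using has_derivative_snd[OF d] by (simp add: has_vector_derivative_def)
qed

lemma has_vector_derivative_component:
  assumes "(f has_vector_derivative f') (at t within A)"
  shows "((\<lambda>t. f t $ i) has_real_derivative f' $ i) (at t within A)"
  using bounded_linear.has_vector_derivative[OF bounded_linear_vec_nth assms]
  by (simp add: has_real_derivative_iff_has_vector_derivative)

text \<open>
  With \<open>T = \<Sum> \<partial>\<^sub>i G\<^sub>j\<^sub>k v\<^sub>i v\<^sub>j v\<^sub>k\<close>, the motion of the base point contributes \<open>T\<close> to the derivative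
  of the energy, and the geodesic acceleration contributes \<open>- T / 2\<close> through each of the two velocity factors.
\<close>

lemma energy_constant:
  fixes G :: "real^'n::finite \<Rightarrow> real^'n^'n"
  assumes diff: "\<And>i j x. (\<lambda>y. G y $ i $ j) differentiable (at x)"
    and sym: "\<And>x i j. G x $ i $ j = G x $ j $ i" and inv: "\<And>x. invertible (G x)"
    and z: "(z has_vector_derivative geodesic_field G (z t)) (at t within A)"
  shows "((\<lambda>t. \<Sum>i\<in>UNIV. \<Sum>j\<in>UNIV. G (fst (z t)) $ i $ j * snd (z t) $ i * snd (z t) $ j)
           has_real_derivative 0) (at t within A)"
proof -
  define x v w where "x = fst (z t)" and "v = snd (z t)" and "w = snd (geodesic_field G (z t))"
  define d where "d k i j = partial_deriv k (\<lambda>y. G y $ i $ j) x" for k i j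
  have x: "((\<lambda>t. fst (z t)) has_vector_derivative v) (at t within A)"
    and v: "((\<lambda>t. snd (z t) $ i) has_real_derivative w $ i) (at t within A)" for i
    using flow_components[OF z] has_vector_derivative_component by (auto simp: v_def w_def)
  have "((\<lambda>t. G (fst (z t)) $ i $ j) has_real_derivative (\<Sum>k\<in>UNIV. v $ k * d k i j)) (at t within A)" for i j
  proof -
    have x': "((\<lambda>t. fst (z t)) has_derivative (\<lambda>h. h *\<^sub>R v)) (at t within A)"
      using x by (simp add: has_vector_derivative_def)
    have "((\<lambda>y. G y $ i $ j) has_derivative (\<lambda>h. \<Sum>k\<in>UNIV. h $ k * d k i j)) (at x)"
      unfolding d_def by (rule has_derivative_partials[OF diff])
    from has_derivative_compose[OF x' this[unfolded x_def]]
    show ?thesis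
      by (auto simp: has_field_derivative_def sum_distrib_left mult_ac elim!: has_derivative_eq_rhs)
  qed
  then have der: "((\<lambda>t. \<Sum>i\<in>UNIV. \<Sum>j\<in>UNIV. G (fst (z t)) $ i $ j * snd (z t) $ i * snd (z t) $ j)
     has_real_derivative (\<Sum>i\<in>UNIV. \<Sum>j\<in>UNIV.
        ((\<Sum>k\<in>UNIV. v $ k * d k i j) * v $ i + w $ i * G x $ i $ j) * v $ j + w $ j * (G x $ i $ j * v $ i))) (at t within A)"
    unfolding x_def v_def by (intro DERIV_sum DERIV_mult v)
  have s12: "(\<Sum>i\<in>UNIV. \<Sum>j\<in>UNIV. \<Sum>k\<in>UNIV. g i j k) = (\<Sum>i\<in>UNIV. \<Sum>j\<in>UNIV. \<Sum>k\<in>UNIV. g j i k)"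
    and s23: "(\<Sum>i\<in>UNIV. \<Sum>j\<in>UNIV. \<Sum>k\<in>UNIV. g i j k) = (\<Sum>i\<in>UNIV. \<Sum>j\<in>UNIV. \<Sum>k\<in>UNIV. g i k j)"
    for g :: "'n \<Rightarrow> 'n \<Rightarrow> 'n \<Rightarrow> real"
    by (rule sum.swap) (intro sum.cong refl sum.swap)
  \<comment> \<open>The same cubic sum with its indices permuted.\<close>
  define f where "f i j k = d i j k * v $ i * v $ j * v $ k" for i j k
  define T where "T = (\<Sum>i\<in>UNIV. \<Sum>j\<in>UNIV. \<Sum>k\<in>UNIV. f i j k)"
  have T1: "(\<Sum>i\<in>UNIV. \<Sum>j\<in>UNIV. \<Sum>k\<in>UNIV. f j k i) = T"
    unfolding T_def s23[of f] by (rule s12[symmetric])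
  have T2: "(\<Sum>i\<in>UNIV. \<Sum>j\<in>UNIV. \<Sum>k\<in>UNIV. f k j i) = T"
    unfolding T1[symmetric] by (rule s23)
  have T3: "(\<Sum>i\<in>UNIV. \<Sum>j\<in>UNIV. \<Sum>k\<in>UNIV. f k i j) = T"
    unfolding T_def s12[of f] by (rule s23)
  have acc: "(\<Sum>i\<in>UNIV. w $ i * G x $ i $ j) = - (\<Sum>a\<in>UNIV. \<Sum>b\<in>UNIV. (1/2) * (d a b j + d b a j - d j a b) * v $ a * v $ b)" for j
  proof -
    have "(\<Sum>i\<in>UNIV. w $ i * G x $ i $ j)
        = - (\<Sum>i\<in>UNIV. \<Sum>a\<in>UNIV. \<Sum>b\<in>UNIV. G x $ j $ i * christoffel G i a b x * v $ a * v $ b)"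
      by (simp add: w_def geodesic_field_def x_def v_def sym[of _ _ j] sum_distrib_left sum_distrib_right mult_ac flip: sum_negf)
    also have "(\<Sum>i\<in>UNIV. \<Sum>a\<in>UNIV. \<Sum>b\<in>UNIV. G x $ j $ i * christoffel G i a b x * v $ a * v $ b)
        = (\<Sum>a\<in>UNIV. \<Sum>i\<in>UNIV. \<Sum>b\<in>UNIV. G x $ j $ i * christoffel G i a b x * v $ a * v $ b)"
      by (rule sum.swap)
    also have "\<dots> = (\<Sum>a\<in>UNIV. \<Sum>b\<in>UNIV. \<Sum>i\<in>UNIV. G x $ j $ i * christoffel G i a b x * v $ a * v $ b)"
      by (intro sum.cong refl sum.swap)
    also have "\<dots> = (\<Sum>a\<in>UNIV. \<Sum>b\<in>UNIV. (\<Sum>i\<in>UNIV. G x $ j $ i * christoffel G i a b x) * v $ a * v $ b)"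
      by (simp add: sum_distrib_right)
    finally show ?thesis by (simp add: christoffel_lower[of G x, OF inv] d_def)
  qed
  have half: "(\<Sum>j\<in>UNIV. (\<Sum>i\<in>UNIV. w $ i * G x $ i $ j) * v $ j) = - T / 2"
  proof -
    have "(\<Sum>j\<in>UNIV. (\<Sum>i\<in>UNIV. w $ i * G x $ i $ j) * v $ j)
      = - (1/2) * (\<Sum>j\<in>UNIV. \<Sum>a\<in>UNIV. \<Sum>b\<in>UNIV. f a b j + f b a j - f j a b)"
      by (simp only: acc)
         (simp add: f_def sum_distrib_left sum_distrib_right algebra_simps flip: sum_negf)
    also have "\<dots> = - (1/2) * (T + T - T)"
      by (simp only: sum.distrib sum_subtractf T1 T2) (simp add: T_def)
    finally show ?thesis by simp
  qed
  have "(\<Sum>i\<in>UNIV. \<Sum>j\<in>UNIV.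
        ((\<Sum>k\<in>UNIV. v $ k * d k i j) * v $ i + w $ i * G x $ i $ j) * v $ j + w $ j * (G x $ i $ j * v $ i))
      = (\<Sum>i\<in>UNIV. \<Sum>j\<in>UNIV. \<Sum>k\<in>UNIV. f k i j) + (\<Sum>i\<in>UNIV. \<Sum>j\<in>UNIV. w $ i * G x $ i $ j * v $ j) + (\<Sum>i\<in>UNIV. \<Sum>j\<in>UNIV. w $ j * G x $ i $ j * v $ i)"
    by (simp add: f_def sum_distrib_left sum_distrib_right sum.distrib algebra_simps)
  also have "(\<Sum>i\<in>UNIV. \<Sum>j\<in>UNIV. w $ i * G x $ i $ j * v $ j) = - T / 2"
    unfolding half[symmetric] by (subst sum.swap) (simp add: sum_distrib_right)
  also have "(\<Sum>i\<in>UNIV. \<Sum>j\<in>UNIV. w $ j * G x $ i $ j * v $ i) = - T / 2"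
    unfolding half[symmetric] by (simp add: sum_distrib_right) (intro sum.cong refl, subst sym, rule refl)
  finally show ?thesis using der T3 by simp
qed

section \<open>Geodesics on the product of the plane and a torus\<close>

lemma partial_deriv_shift:
  assumes "\<And>y. f (y + b) = f y"
  shows "partial_deriv i f (x + b) = partial_deriv i f x"
proof -
  have sh: "(f has_derivative D) (at (x + b))"
    if D: "(f has_derivative D) (at x)" and f: "\<And>y. f (y + b) = f y" for b x D
  proof -
    have "((\<lambda>y. y - b) has_derivative (\<lambda>h. h)) (at (x + b))" by (auto intro!: derivative_eq_intros)
    from has_derivative_compose[OF this, of f D] D
    have "((\<lambda>y. f (y - b)) has_derivative D) (at (x + b))" by simp
    moreover have "f (y - b) = f y" for y using f[of "y - b"] by simp
    ultimately show ?thesis by simp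
  qed
  have "f (y + (- b)) = f y" for y using assms[of "y - b"] by simp
  then have "(f has_derivative D) (at (x + b)) \<longleftrightarrow> (f has_derivative D) (at x)" for D
    using sh[of D "x + b" "- b"] sh[of D x b] assms by auto
  then show ?thesis by (simp add: partial_deriv_def frechet_derivative_def)
qed

lemma christoffel_shift:
  assumes "\<And>y. G (y + b) = G y"
  shows "christoffel G k i j (x + b) = christoffel G k i j x"
  unfolding christoffel_def by (simp add: assms partial_deriv_shift[of _ b])

lemma plane_torus_proj_shift: "plane_torus_proj P (y + lattice_shift P k) = plane_torus_proj P y"
proof -
  have "plane_part (y + lattice_shift P k) = plane_part y"
    by (simp add: plane_part_def lattice_shift_def vec_eq_iff)
  moreover have "torus_rel P `` {torus_part (y + lattice_shift P k)} = torus_rel P `` {torus_part y}"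
    using equiv_class_eq[OF equiv_torus_rel torus_rel_shift] by metis
  ultimately show ?thesis by (simp add: plane_torus_proj_def)
qed

lemma plane_torus_proj_chart:
  assumes "\<forall>i. P i > 0" "p \<in> fst (plane_torus_chart P c)"
  shows "plane_torus_proj P (snd (plane_torus_chart P c) p) = p"
  using plane_torus_dom_rep[OF assms] plane_torus_chart_proj_box(1)[OF assms(1)] by metis

text \<open>In a chart, the universal covering map is locally a translation by a lattice vector.\<close>

lemma plane_torus_chart_near:
  assumes P: "\<forall>i. P i > 0" and y: "plane_torus_proj P y \<in> fst (plane_torus_chart P c)"
  obtains U k where "open U" "y \<in> U"
    "\<And>x. x \<in> U \<Longrightarrow> plane_torus_proj P x \<in> fst (plane_torus_chart P c)"
    "\<And>x. x \<in> U \<Longrightarrow> snd (plane_torus_chart P c) (plane_torus_proj P x) = x + lattice_shift P k"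
proof -
  obtain \<theta> where \<theta>: "(torus_part y, \<theta>) \<in> torus_rel P" "\<theta> \<in> period_box P c"
    using y plane_torus_proj_in_dom by blast
  obtain k where k: "\<theta> = torus_part (y + lattice_shift P k)" using \<theta>(1) by (rule torus_rel_shiftE)
  show ?thesis
  proof (rule that)
    show "open {x. torus_part (x + lattice_shift P k) \<in> period_box P c}" by (rule open_torus_part_box)
    show "y \<in> {x. torus_part (x + lattice_shift P k) \<in> period_box P c}" using \<theta> k by simp
    fix x assume "x \<in> {x. torus_part (x + lattice_shift P k) \<in> period_box P c}"
    then have "torus_part (x + lattice_shift P k) \<in> period_box P c" by simp
    from plane_torus_chart_proj_box[OF P this]
    show "plane_torus_proj P x \<in> fst (plane_torus_chart P c)"
      "snd (plane_torus_chart P c) (plane_torus_proj P x) = x + lattice_shift P k"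
      by (simp_all add: plane_torus_proj_shift)
  qed
qed

context
  fixes P :: "'m::finite \<Rightarrow> real" and H :: "real^(2 + 'm) \<Rightarrow> real^(2 + 'm)^(2 + 'm)"
  assumes P: "\<forall>i. P i > 0"
    and periodic: "\<And>y k. H (y + lattice_shift P k) = H y"
    and lip: "lipschitz_on_balls (geodesic_field H)"
begin

lemma flow_line_continuous: "geodesic_flow_line H z \<Longrightarrow> continuous_on UNIV (\<lambda>t. fst (z t))"
  unfolding geodesic_flow_line_def
  by (intro continuous_on_fst) (meson continuous_at_imp_continuous_on has_vector_derivative_continuous)

lemma flow_line_open_vimage:
  assumes "geodesic_flow_line H z" "open U"
  shows "open {t. fst (z t) \<in> U}"
  using open_vimage[OF assms(2) flow_line_continuous[OF assms(1)]] by (simp add: vimage_def)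

lemma flow_line_shift:
  assumes "geodesic_flow_line H z"
  shows "geodesic_flow_line H (\<lambda>t. (fst (z t) + lattice_shift P k, snd (z t)))"
  unfolding geodesic_flow_line_def
proof
  fix t
  have f: "geodesic_field H (fst (z t) + lattice_shift P k, snd (z t)) = geodesic_field H (z t)"
    by (simp add: geodesic_field_def christoffel_shift[of H, OF periodic])
  have "(z has_derivative (\<lambda>h. h *\<^sub>R geodesic_field H (z t))) (at t)"
    using assms by (simp add: geodesic_flow_line_def has_vector_derivative_def)
  then have "((\<lambda>t. z t + (lattice_shift P k, 0)) has_derivative (\<lambda>h. h *\<^sub>R geodesic_field H (z t))) (at t)"
    by (auto intro!: derivative_eq_intros)
  moreover have "(\<lambda>t. z t + (lattice_shift P k, 0)) = (\<lambda>t. (fst (z t) + lattice_shift P k, snd (z t)))"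
    by (simp add: plus_prod_def)
  ultimately show "((\<lambda>t. (fst (z t) + lattice_shift P k, snd (z t))) has_vector_derivative
        geodesic_field H (fst (z t) + lattice_shift P k, snd (z t))) (at t)"
    by (simp add: f has_vector_derivative_def)
qed

lemma flow_line_projects_to_geodesic:
  assumes z: "geodesic_flow_line H z"
  shows "geodesic_on (plane_torus_atlas P) (\<lambda>c. H) UNIV (\<lambda>t. plane_torus_proj P (fst (z t)))"
  unfolding geodesic_on_def
proof (intro conjI ballI)
  fix t
  have "torus_part (fst (z t)) \<in> period_box P (torus_part (fst (z t)))" using P by (simp add: period_box_def)
  then show "plane_torus_proj P (fst (z t)) \<in> (\<Union>c\<in>plane_torus_atlas P. fst c)"
    using plane_torus_chart_proj_box(2)[OF P] unfolding plane_torus_atlas_def by blast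
next
  fix c assume "c \<in> plane_torus_atlas P"
  then obtain d where c: "c = plane_torus_chart P d" by (auto simp: plane_torus_atlas_def)
  let ?\<gamma> = "\<lambda>t. plane_torus_proj P (fst (z t))"
  have loc: "\<exists>S k. open S \<and> t \<in> S \<and> (\<forall>s\<in>S. ?\<gamma> s \<in> fst c \<and> snd c (?\<gamma> s) = fst (z s) + lattice_shift P k)"
    if t: "?\<gamma> t \<in> fst c" for t
  proof -
    obtain U k where U: "open U" "fst (z t) \<in> U" "\<And>x. x \<in> U \<Longrightarrow> plane_torus_proj P x \<in> fst c"
      "\<And>x. x \<in> U \<Longrightarrow> snd c (plane_torus_proj P x) = x + lattice_shift P k"
      using plane_torus_chart_near[OF P] t unfolding c by metis
    show ?thesis
      using U flow_line_open_vimage[OF z U(1)] by (intro exI[of _ "{t. fst (z t) \<in> U}"] exI[of _ k]) auto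
  qed
  show "open {t \<in> UNIV. ?\<gamma> t \<in> fst c}"
  proof (subst open_subopen, intro ballI)
    fix t assume "t \<in> {t \<in> UNIV. ?\<gamma> t \<in> fst c}"
    then obtain S where "open S" "t \<in> S" "\<forall>s\<in>S. ?\<gamma> s \<in> fst c" using loc[of t] by auto
    then show "\<exists>S. open S \<and> t \<in> S \<and> S \<subseteq> {t \<in> UNIV. ?\<gamma> t \<in> fst c}" by (intro exI[of _ S]) auto
  qed
  show "\<exists>u' u''. \<forall>t\<in>{t \<in> UNIV. ?\<gamma> t \<in> fst c}.
           ((\<lambda>s. snd c (?\<gamma> s)) has_vector_derivative u' t) (at t) \<and>
           (u' has_vector_derivative u'' t) (at t) \<and>
           (\<forall>k. u'' t $ k + (\<Sum>i\<in>UNIV. \<Sum>j\<in>UNIV.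
                  christoffel H k i j (snd c (?\<gamma> t)) * u' t $ i * u' t $ j) = 0)"
  proof (rule exI[of _ "\<lambda>t. snd (z t)"], rule exI[of _ "\<lambda>t. snd (geodesic_field H (z t))"], intro ballI conjI allI)
    fix t assume "t \<in> {t \<in> UNIV. ?\<gamma> t \<in> fst c}"
    then obtain S k where S: "open S" "t \<in> S" "\<And>s. s \<in> S \<Longrightarrow> snd c (?\<gamma> s) = fst (z s) + lattice_shift P k"
      using loc[of t] by auto
    have zt: "(z has_vector_derivative geodesic_field H (z t)) (at t)"
      using z by (simp add: geodesic_flow_line_def)
    show "((\<lambda>s. snd c (?\<gamma> s)) has_vector_derivative snd (z t)) (at t)"
    proof (rule has_vector_derivative_transform_within_open[OF _ S(1,2)])
      show "((\<lambda>s. fst (z s) + lattice_shift P k) has_vector_derivative snd (z t)) (at t)"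
        using flow_components(1)[OF zt] by (auto intro!: derivative_eq_intros)
    qed (simp add: S(3))
    show "((\<lambda>t. snd (z t)) has_vector_derivative snd (geodesic_field H (z t))) (at t)"
      by (rule flow_components(2)[OF zt])
    fix i
    show "snd (geodesic_field H (z t)) $ i + (\<Sum>a\<in>UNIV. \<Sum>b\<in>UNIV.
        christoffel H i a b (snd c (?\<gamma> t)) * snd (z t) $ a * snd (z t) $ b) = 0"
      by (simp add: geodesic_field_def S(2,3) christoffel_shift[of H, OF periodic])
  qed
qed simp_all

text \<open>
  In a chart around a point of agreement both flow lines are translates by lattice vectors of one and the
  same curve near that time, so position and velocity of the translates agree there.
\<close>

lemma flow_lines_agree:
  assumes z: "geodesic_flow_line H z" and w: "geodesic_flow_line H w" and S: "open S" "s \<in> S"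
    and eq: "\<And>t. t \<in> S \<Longrightarrow> plane_torus_proj P (fst (z t)) = plane_torus_proj P (fst (w t))"
  shows "plane_torus_proj P (fst (z t)) = plane_torus_proj P (fst (w t))"
proof -
  define c where "c = plane_torus_chart P (torus_part (fst (z s)))"
  have "torus_part (fst (z s)) \<in> period_box P (torus_part (fst (z s)))" using P by (simp add: period_box_def)
  then have dom: "plane_torus_proj P (fst (z s)) \<in> fst c"
    using plane_torus_chart_proj_box(2)[OF P] unfolding c_def by blast
  obtain U k where U: "open U" "fst (z s) \<in> U"
    "\<And>x. x \<in> U \<Longrightarrow> snd c (plane_torus_proj P x) = x + lattice_shift P k"
    using plane_torus_chart_near[OF P] dom unfolding c_def by metis
  have "plane_torus_proj P (fst (w s)) \<in> fst c" using dom eq[OF S(2)] by simp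
  then obtain U' k' where U': "open U'" "fst (w s) \<in> U'"
    "\<And>x. x \<in> U' \<Longrightarrow> snd c (plane_torus_proj P x) = x + lattice_shift P k'"
    using plane_torus_chart_near[OF P] unfolding c_def by metis
  define z' w' where "z' = (\<lambda>t. (fst (z t) + lattice_shift P k, snd (z t)))"
    and "w' = (\<lambda>t. (fst (w t) + lattice_shift P k', snd (w t)))"
  have flow: "geodesic_flow_line H z'" "geodesic_flow_line H w'"
    unfolding z'_def w'_def using flow_line_shift z w by blast+
  define N where "N = S \<inter> {t. fst (z t) \<in> U} \<inter> {t. fst (w t) \<in> U'}"
  have N: "open N" "s \<in> N"
    using S U(2) U'(2) flow_line_open_vimage[OF z U(1)] flow_line_open_vimage[OF w U'(1)]
    by (auto simp: N_def intro!: open_Int)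
  have fst_eq: "fst (z' t) = fst (w' t)" if "t \<in> N" for t
    using that U(3)[of "fst (z t)"] U'(3)[of "fst (w t)"] eq[of t] by (auto simp: N_def z'_def w'_def)
  have "((\<lambda>t. fst (z' t)) has_vector_derivative snd (z' s)) (at s)"
    "((\<lambda>t. fst (w' t)) has_vector_derivative snd (w' s)) (at s)"
    using flow flow_components(1) unfolding geodesic_flow_line_def by blast+
  then have "snd (z' s) = snd (w' s)"
    using has_vector_derivative_transform_within_open[OF _ N, of "\<lambda>t. fst (z' t)" _ "\<lambda>t. fst (w' t)"]
      fst_eq vector_derivative_unique_at by blast
  then have s: "z' s = w' s" using fst_eq[OF N(2)] by (simp add: prod_eq_iff)
  have "z' t = w' t"
    by (rule ode_unique[where x = z' and y = w', OF lip is_interval_univ _ _ _ s]) (use flow in \<open>auto simp: geodesic_flow_line_def\<close>)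
  then have "fst (z t) + lattice_shift P k = fst (w t) + lattice_shift P k'"
    by (simp add: z'_def w'_def)
  then show ?thesis by (metis plane_torus_proj_shift)
qed

text \<open>The flow line with the initial data that the geodesic has in a chart follows it by uniqueness.\<close>

lemma geodesic_locally_flow_line:
  assumes global: "\<And>z0. \<exists>z. z 0 = z0 \<and> geodesic_flow_line H z"
    and \<gamma>: "geodesic_on (plane_torus_atlas P) (\<lambda>c. H) I \<gamma>" and s: "s \<in> I"
  shows "\<exists>z e. geodesic_flow_line H z \<and> e > 0 \<and> (\<forall>t\<in>ball s e. \<gamma> t = plane_torus_proj P (fst (z t)))"
proof -
  obtain c where c: "\<gamma> s \<in> fst c" "c \<in> plane_torus_atlas P" using \<gamma> s unfolding geodesic_on_def by blast
  then obtain d where d: "c = plane_torus_chart P d" by (auto simp: plane_torus_atlas_def)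
  define J where "J = {t \<in> I. \<gamma> t \<in> fst c}"
  obtain u' u'' where u: "open J" "\<And>t. t \<in> J \<Longrightarrow> ((\<lambda>s. snd c (\<gamma> s)) has_vector_derivative u' t) (at t)"
    "\<And>t. t \<in> J \<Longrightarrow> (u' has_vector_derivative u'' t) (at t)"
    "\<And>t k. t \<in> J \<Longrightarrow> u'' t $ k + (\<Sum>i\<in>UNIV. \<Sum>j\<in>UNIV.
        christoffel H k i j (snd c (\<gamma> t)) * u' t $ i * u' t $ j) = 0"
    using \<gamma> c(2) unfolding geodesic_on_def J_def by blast
  have "s \<in> J" using s c(1) by (simp add: J_def)
  then obtain e where e: "e > 0" "ball s e \<subseteq> J" using u(1) open_contains_ball by blast
  define x where "x t = (snd c (\<gamma> t), u' t)" for t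
  have x: "(x has_vector_derivative geodesic_field H (x t)) (at t)" if "t \<in> ball s e" for t
  proof -
    have t: "t \<in> J" using that e by blast
    have "geodesic_field H (x t) = (u' t, u'' t)"
    proof -
      have "u'' t $ k = - (\<Sum>i\<in>UNIV. \<Sum>j\<in>UNIV. christoffel H k i j (snd c (\<gamma> t)) * u' t $ i * u' t $ j)" for k
        using u(4)[OF t, of k] by linarith
      then show ?thesis by (simp add: geodesic_field_def x_def vec_eq_iff)
    qed
    then show ?thesis
      using has_vector_derivative_Pair[OF u(2,3)[OF t]] by (simp add: x_def[abs_def])
  qed
  obtain y where y: "y 0 = x s" "geodesic_flow_line H y" using global by blast
  define z where "z t = y (t - s)" for t
  have z: "(z has_vector_derivative geodesic_field H (z t)) (at t)" for t
  proof -
    have "((\<lambda>t. t - s) has_vector_derivative 1) (at t)" by (auto intro!: derivative_eq_intros)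
    from vector_diff_chain_at[OF this, of y] y(2) show ?thesis
      by (simp add: geodesic_flow_line_def z_def[abs_def] o_def)
  qed
  have "x t = z t" if "t \<in> ball s e" for t
  proof (rule ode_unique[OF lip _ x z _ _ that])
    show "is_interval (ball s e)" by (simp add: is_interval_convex_1)
    show "s \<in> ball s e" using e(1) by simp
    show "x s = z s" by (simp add: z_def y)
  qed
  then have "plane_torus_proj P (fst (z t)) = \<gamma> t" if "t \<in> ball s e" for t
    using plane_torus_proj_chart[OF P, of "\<gamma> t" d] that e(2) unfolding J_def d
    by (metis (no_types, lifting) d fst_conv mem_Collect_eq subsetD x_def)
  then show ?thesis using z e(1) unfolding geodesic_flow_line_def by metis
qed

text \<open>
  Near each of its points a geodesic is the image of a complete flow line. That image does not
  change along the geodesic, since two flow lines whose images agree near one time differ by a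
  lattice vector.
\<close>

theorem geodesically_complete_plane_torus:
  assumes global: "\<And>z0. \<exists>z. z 0 = z0 \<and> geodesic_flow_line H z"
  shows "geodesically_complete (plane_torus_atlas P) (\<lambda>c. H)"
  unfolding geodesically_complete_def
proof (intro allI impI, elim conjE)
  fix I :: "real set" and \<gamma> assume "I \<noteq> {}" and \<gamma>: "geodesic_on (plane_torus_atlas P) (\<lambda>c. H) I \<gamma>"
  have I: "connected I" using \<gamma> by (simp add: geodesic_on_def is_interval_connected_1)
  obtain s where s: "s \<in> I" using \<open>I \<noteq> {}\<close> by blast
  have "\<forall>s\<in>I. \<exists>z. geodesic_flow_line H z \<and>
      (\<exists>e>0. \<forall>t\<in>ball s e. \<gamma> t = plane_torus_proj P (fst (z t)))"
    using geodesic_locally_flow_line[OF global \<gamma>] by blast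
  from bchoice[OF this] obtain z where "\<forall>s\<in>I. geodesic_flow_line H (z s) \<and>
      (\<exists>e>0. \<forall>t\<in>ball s e. \<gamma> t = plane_torus_proj P (fst (z s t)))" ..
  then have z: "\<And>s. s \<in> I \<Longrightarrow> geodesic_flow_line H (z s)"
    "\<And>s. s \<in> I \<Longrightarrow> \<exists>e>0. \<forall>t\<in>ball s e. \<gamma> t = plane_torus_proj P (fst (z s t))" by blast+
  define f where "f s = (\<lambda>t. plane_torus_proj P (fst (z s t)))" for s
  have "\<forall>a\<in>I. eventually (\<lambda>b. f a = f b) (at a within I)"
  proof
    fix a assume a: "a \<in> I"
    obtain e where e: "e > 0" "\<And>t. t \<in> ball a e \<Longrightarrow> \<gamma> t = f a t" using z(2)[OF a] by (auto simp: f_def)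
    have "f a = f b" if b: "b \<in> ball a e" "b \<in> I" for b
    proof -
      obtain e' where e': "e' > 0" "\<And>t. t \<in> ball b e' \<Longrightarrow> \<gamma> t = f b t" using z(2)[OF b(2)] by (auto simp: f_def)
      have "f a t = f b t" for t
        unfolding f_def
      proof (rule flow_lines_agree[OF z(1)[OF a] z(1)[OF b(2)], of "ball a e \<inter> ball b e'" b])
        fix t assume "t \<in> ball a e \<inter> ball b e'"
        then have "f a t = f b t" using e(2)[of t] e'(2)[of t] by simp
        then show "plane_torus_proj P (fst (z a t)) = plane_torus_proj P (fst (z b t))" by (simp add: f_def)
      qed (use b e' in auto)
      then show ?thesis by blast
    qed
    then show "eventually (\<lambda>b. f a = f b) (at a within I)"
      unfolding eventually_at using e(1) by (metis dist_commute mem_ball)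
  qed
  then have const: "f t = f s" if "t \<in> I" for t
    using connected_local_const[OF I that s] by blast
  have "\<forall>t\<in>I. f s t = \<gamma> t"
  proof
    fix t assume t: "t \<in> I"
    then have "\<gamma> t = f t t" using z(2)[OF t] unfolding f_def by (metis centre_in_ball)
    then show "f s t = \<gamma> t" using const[OF t] by simp
  qed
  moreover have "geodesic_on (plane_torus_atlas P) (\<lambda>c. H) UNIV (f s)"
    unfolding f_def by (rule flow_line_projects_to_geodesic[OF z(1)[OF s]])
  ultimately show "\<exists>\<gamma>'. geodesic_on (plane_torus_atlas P) (\<lambda>c. H) UNIV \<gamma>' \<and> (\<forall>t\<in>I. \<gamma>' t = \<gamma> t)" by blast
qed

end

section \<open>Index sums and rational functions\<close>

lemma sum_plane_torus:
  fixes f :: "2 + 'm::finite \<Rightarrow> 'a::comm_monoid_add"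
  shows "(\<Sum>k\<in>UNIV. f k) = f (Inl 1) + f (Inl 2) + (\<Sum>i\<in>UNIV. f (Inr i))"
proof -
  have "(\<Sum>k\<in>UNIV. f k) = (\<Sum>k\<in>UNIV <+> UNIV. f k)" by simp
  also have "\<dots> = (\<Sum>a\<in>UNIV. f (Inl a)) + (\<Sum>i\<in>UNIV. f (Inr i))"
    by (simp add: sum.Plus del: UNIV_Plus_UNIV)
  finally show ?thesis by (simp add: sum_2)
qed

lemma matrix_inv_eqI:
  fixes A :: "real^'n::finite^'n"
  assumes "A ** B = mat 1"
  shows "matrix_inv A = B"
proof -
  have "B ** A = mat 1" using assms by (simp add: matrix_left_right_inverse)
  then have "A ** matrix_inv A = mat 1 \<and> matrix_inv A ** A = mat 1"
    unfolding matrix_inv_def using assms by (rule_tac someI[of _ B]) simp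
  then show ?thesis by (metis \<open>B ** A = mat 1\<close> matrix_mul_assoc matrix_mul_lid matrix_mul_rid)
qed

lemma quadratic_form_sum:
  fixes A :: "real^'n::finite^'n"
  shows "v \<bullet> (A *v v) = (\<Sum>i\<in>UNIV. \<Sum>j\<in>UNIV. A $ i $ j * v $ i * v $ j)"
  by (simp add: inner_vec_def matrix_vector_mult_def sum_distrib_left mult_ac)

text \<open>
  A rational function is kept as a pair of polynomials, so that its derivatives are again of this form and
  are defined wherever the original denominator does not vanish.
\<close>

definition ratio :: "real poly \<times> real poly \<Rightarrow> real \<Rightarrow> real" where
  "ratio x u = poly (fst x) u / poly (snd x) u"

definition ratio_deriv :: "real poly \<times> real poly \<Rightarrow> real poly \<times> real poly" where
  "ratio_deriv x = (pderiv (fst x) * snd x - fst x * pderiv (snd x), snd x * snd x)"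

lemma snd_ratio_deriv [simp]: "snd (ratio_deriv x) = snd x * snd x"
  by (simp add: ratio_deriv_def)

lemma ratio_has_derivative:
  assumes "poly (snd x) u \<noteq> 0"
  shows "(ratio x has_real_derivative ratio (ratio_deriv x) u) (at u)"
  unfolding ratio_def[abs_def]
  using DERIV_divide[OF poly_DERIV[of "fst x"] poly_DERIV assms]
  by (simp add: ratio_deriv_def mult_ac)

text \<open>
  The identities between the radial functions are known for \<open>u \<ge> 0\<close> only. This lemma differentiates them
  up to the axis \<open>u = 0\<close>.
\<close>

lemma zero_derivative_on_halfline:
  assumes d: "(f has_real_derivative d) (at u)" and f: "\<And>v. v \<ge> u \<Longrightarrow> f v = 0"
  shows "d = 0"
proof (rule ccontr)
  assume "d \<noteq> 0"
  then consider "d > 0" | "d < 0" by linarith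
  then show False
  proof cases
    case 1
    obtain e where "e > 0" "\<forall>h>0. h < e \<longrightarrow> f u < f (u + h)" using DERIV_pos_inc_right[OF d 1] by blast
    then have "f u < f (u + e / 2)" by simp
    then show False using f \<open>e > 0\<close> by simp
  next
    case 2
    obtain e where "e > 0" "\<forall>h>0. h < e \<longrightarrow> f u > f (u + h)" using DERIV_neg_dec_right[OF d 2] by blast
    then have "f u > f (u + e / 2)" by simp
    then show False using f \<open>e > 0\<close> by simp
  qed
qed

section \<open>The rotationally symmetric metric\<close>

definition usq :: "real^(2 + 'm::finite) \<Rightarrow> real" where
  "usq y = (y $ Inl 1)^2 + (y $ Inl 2)^2"

lemma usq_nonneg [simp]: "usq y \<ge> 0" by (simp add: usq_def)

lemma usq_has_derivative:
  "(usq has_derivative (\<lambda>h. 2 * y $ Inl 1 * h $ Inl 1 + 2 * y $ Inl 2 * h $ Inl 2)) (at y)"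
  unfolding usq_def[abs_def]
  by (auto intro!: derivative_eq_intros bounded_linear_imp_has_derivative bounded_linear_vec_nth
      simp: fun_eq_iff algebra_simps)

lemma radial_has_derivative:
  assumes "(\<phi> has_real_derivative d) (at (usq y))"
  shows "((\<lambda>y. \<phi> (usq y)) has_derivative
    (\<lambda>h. d * (2 * y $ Inl 1 * h $ Inl 1 + 2 * y $ Inl 2 * h $ Inl 2))) (at y)"
  using has_derivative_compose[OF usq_has_derivative assms[unfolded has_field_derivative_def]] by simp

lemma component_has_derivative: "((\<lambda>y. y $ k) has_derivative (\<lambda>h. h $ k)) (at y)"
  by (rule bounded_linear_imp_has_derivative[OF bounded_linear_vec_nth])

lemma axis_nth: "axis i (1::real) $ j = (if i = j then 1 else 0)"
  by (simp add: axis_def)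

lemma partial_radial:
  assumes "(\<phi> has_real_derivative d) (at (usq y))"
  shows "partial_deriv (Inl c) (\<lambda>y. \<phi> (usq y)) y = 2 * d * y $ Inl c"
    and "partial_deriv (Inr i) (\<lambda>y. \<phi> (usq y)) y = 0"
  using exhaust_2[of c] by (auto simp: partial_deriv_eqI[OF radial_has_derivative[OF assms]] axis_nth)

text \<open>The shapes of functions that occur as components of the metric and as Christoffel symbols.\<close>

lemma partial_radial_tensor2:
  assumes "(\<phi> has_real_derivative d) (at (usq y))" "(\<psi> has_real_derivative e) (at (usq y))"
  shows "partial_deriv (Inl c) (\<lambda>y. \<alpha> * \<phi> (usq y) + \<psi> (usq y) * y $ Inl a * y $ Inl b) y =
      2 * \<alpha> * d * y $ Inl c + 2 * e * y $ Inl c * y $ Inl a * y $ Inl b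
      + \<psi> (usq y) * ((if a = c then y $ Inl b else 0) + (if b = c then y $ Inl a else 0))"
    and "partial_deriv (Inr i) (\<lambda>y. \<alpha> * \<phi> (usq y) + \<psi> (usq y) * y $ Inl a * y $ Inl b) y = 0"
proof -
  have "((\<lambda>y. \<alpha> * \<phi> (usq y) + \<psi> (usq y) * y $ Inl a * y $ Inl b) has_derivative
     (\<lambda>h. \<alpha> * (d * (2 * y $ Inl 1 * h $ Inl 1 + 2 * y $ Inl 2 * h $ Inl 2))
        + (\<psi> (usq y) * y $ Inl a * h $ Inl b + (\<psi> (usq y) * h $ Inl a
        + e * (2 * y $ Inl 1 * h $ Inl 1 + 2 * y $ Inl 2 * h $ Inl 2) * y $ Inl a) * y $ Inl b))) (at y)"
    by (intro has_derivative_add has_derivative_mult has_derivative_mult_right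
        radial_has_derivative assms component_has_derivative)
  note D = partial_deriv_eqI[OF this]
  show "partial_deriv (Inl c) (\<lambda>y. \<alpha> * \<phi> (usq y) + \<psi> (usq y) * y $ Inl a * y $ Inl b) y =
      2 * \<alpha> * d * y $ Inl c + 2 * e * y $ Inl c * y $ Inl a * y $ Inl b
      + \<psi> (usq y) * ((if a = c then y $ Inl b else 0) + (if b = c then y $ Inl a else 0))"
    unfolding D using exhaust_2[of c] by (auto simp: axis_nth algebra_simps)
  show "partial_deriv (Inr i) (\<lambda>y. \<alpha> * \<phi> (usq y) + \<psi> (usq y) * y $ Inl a * y $ Inl b) y = 0"
    unfolding D by (simp add: axis_nth)
qed

lemma partial_radial_tensor1:
  assumes "(\<phi> has_real_derivative d) (at (usq y))"
  shows "partial_deriv (Inl c) (\<lambda>y. \<phi> (usq y) * y $ Inl a) y =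
      2 * d * y $ Inl c * y $ Inl a + (if a = c then \<phi> (usq y) else 0)"
proof -
  have "((\<lambda>y. \<phi> (usq y) * y $ Inl a) has_derivative
     (\<lambda>h. \<phi> (usq y) * h $ Inl a + d * (2 * y $ Inl 1 * h $ Inl 1 + 2 * y $ Inl 2 * h $ Inl 2) * y $ Inl a)) (at y)"
    by (intro has_derivative_mult radial_has_derivative assms component_has_derivative)
  from partial_deriv_eqI[OF this] show ?thesis
    using exhaust_2[of c] by (auto simp: axis_nth algebra_simps)
qed

lemma partial_radial_tensor3:
  assumes "(\<phi> has_real_derivative d) (at (usq y))" "(\<psi> has_real_derivative e) (at (usq y))"
    "(\<omega> has_real_derivative f) (at (usq y))"
  shows "partial_deriv (Inl k) (\<lambda>y. \<phi> (usq y) * (\<beta> * y $ Inl b + \<gamma> * y $ Inl c)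
        + y $ Inl a * (\<alpha> * \<psi> (usq y) + \<omega> (usq y) * y $ Inl b * y $ Inl c)) y =
      2 * d * y $ Inl k * (\<beta> * y $ Inl b + \<gamma> * y $ Inl c)
      + \<phi> (usq y) * (\<beta> * (if b = k then 1 else 0) + \<gamma> * (if c = k then 1 else 0))
      + (if a = k then 1 else 0) * (\<alpha> * \<psi> (usq y) + \<omega> (usq y) * y $ Inl b * y $ Inl c)
      + y $ Inl a * (2 * \<alpha> * e * y $ Inl k + 2 * f * y $ Inl k * y $ Inl b * y $ Inl c
          + \<omega> (usq y) * ((if b = k then y $ Inl c else 0) + (if c = k then y $ Inl b else 0)))"
proof -
  have "((\<lambda>y. \<phi> (usq y) * (\<beta> * y $ Inl b + \<gamma> * y $ Inl c)
        + y $ Inl a * (\<alpha> * \<psi> (usq y) + \<omega> (usq y) * y $ Inl b * y $ Inl c)) has_derivative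
     (\<lambda>h. (\<phi> (usq y) * (\<beta> * h $ Inl b + \<gamma> * h $ Inl c)
         + d * (2 * y $ Inl 1 * h $ Inl 1 + 2 * y $ Inl 2 * h $ Inl 2) * (\<beta> * y $ Inl b + \<gamma> * y $ Inl c))
       + (y $ Inl a * (\<alpha> * (e * (2 * y $ Inl 1 * h $ Inl 1 + 2 * y $ Inl 2 * h $ Inl 2))
        + (\<omega> (usq y) * y $ Inl b * h $ Inl c + (\<omega> (usq y) * h $ Inl b
        + f * (2 * y $ Inl 1 * h $ Inl 1 + 2 * y $ Inl 2 * h $ Inl 2) * y $ Inl b) * y $ Inl c))
        + h $ Inl a * (\<alpha> * \<psi> (usq y) + \<omega> (usq y) * y $ Inl b * y $ Inl c)))) (at y)"
    by (intro has_derivative_add has_derivative_mult has_derivative_mult_right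
        radial_has_derivative assms component_has_derivative)
  from partial_deriv_eqI[OF this] show ?thesis
    using exhaust_2[of k] by (auto simp: axis_nth algebra_simps)
qed

text \<open>
  Here \<open>Q / D\<close> is the function \<open>W\<close> with \<open>V (r\<^sub>+ + u) = u * W u\<close>, and \<open>2 * pi * \<kappa>\<close> is the period of the
  angle. Divisibility of \<open>4 D\<^sup>2 - \<kappa>\<^sup>2 Q\<^sup>2\<close> by \<open>u\<close> means \<open>\<kappa> * W 0 = 2\<close>: there is no conical singularity on
  the axis. The quotient \<open>T\<close> provides the coefficient \<open>B = (4 - \<kappa>\<^sup>2 W\<^sup>2) / (u W)\<close> of the metric in a form
  without division by \<open>u\<close>.
\<close>

locale polar_plane =
  fixes \<kappa> rp :: real and Q D T :: "real poly"
  assumes \<kappa>: "\<kappa> > 0" and rp: "rp > 0"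
    and Q: "\<And>u. u \<ge> 0 \<Longrightarrow> poly Q u > 0" and D: "\<And>u. u \<ge> 0 \<Longrightarrow> poly D u > 0"
    and match: "\<And>u. 4 * (poly D u)^2 - \<kappa>^2 * (poly Q u)^2 = u * poly T u"
begin

text \<open>A numeral appended to the name of a radial function marks a derivative with respect to \<open>u\<close>.\<close>

definition "W = ratio (Q, D)"
definition "W1 = ratio (ratio_deriv (Q, D))"
definition "W2 = ratio (ratio_deriv (ratio_deriv (Q, D)))"
definition "B = ratio (T, D * Q)"
definition "B1 = ratio (ratio_deriv (T, D * Q))"
definition "B2 = ratio (ratio_deriv (ratio_deriv (T, D * Q)))"

lemma W_pos: "u \<ge> 0 \<Longrightarrow> W u > 0"
  using Q D by (simp add: W_def ratio_def)

lemma W_nz: "u \<ge> 0 \<Longrightarrow> W u \<noteq> 0" using W_pos by (metis less_irrefl)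

lemma derivs:
  assumes "u \<ge> 0"
  shows "(W has_real_derivative W1 u) (at u)" "(W1 has_real_derivative W2 u) (at u)"
    "(B has_real_derivative B1 u) (at u)" "(B1 has_real_derivative B2 u) (at u)"
  using Q[OF assms] D[OF assms]
  by (auto simp: W_def W1_def W2_def B_def B1_def B2_def intro!: ratio_has_derivative)

lemma B_product: "u \<ge> 0 \<Longrightarrow> u * B u * W u = 4 - \<kappa>^2 * (W u)^2"
proof -
  assume u: "u \<ge> 0"
  have "u * B u * W u = (u * poly T u) / (poly D u)^2"
    using Q[OF u] D[OF u] by (simp add: B_def W_def ratio_def power2_eq_square)
  also have "\<dots> = 4 - \<kappa>^2 * (W u)^2"
    using D[OF u] by (simp add: W_def ratio_def diff_divide_distrib power_divide flip: match)
  finally show ?thesis .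
qed

lemma B_product_deriv:
  assumes u: "u \<ge> 0"
  shows "B u * W u + u * (B1 u * W u + B u * W1 u) = - 2 * \<kappa>^2 * W u * W1 u"
proof -
  have "((\<lambda>u. u * B u * W u - (4 - \<kappa>^2 * (W u)^2)) has_real_derivative
      (B u * W u + u * (B1 u * W u + B u * W1 u) + 2 * \<kappa>^2 * W u * W1 u)) (at u)"
    by (auto intro!: derivative_eq_intros derivs[OF u] simp: algebra_simps)
  from zero_derivative_on_halfline[OF this] show ?thesis using B_product u by simp
qed

text \<open>The radial coefficients of the connection of the plane part, see \<open>christoffel_plane\<close> below.\<close>

definition "conn_p u = W1 u / W u"
definition "conn_q u = W u * (B u - \<kappa>^2 * W1 u) / 4"
definition "conn_t u = (W u * B1 u - 2 * B u * W1 u) / 4"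
definition "conn_p1 u = (W2 u * W u - (W1 u)^2) / (W u)^2"
definition "conn_q1 u = (W1 u * (B u - \<kappa>^2 * W1 u) + W u * (B1 u - \<kappa>^2 * W2 u)) / 4"
definition "conn_t1 u = (W u * B2 u - W1 u * B1 u - 2 * B u * W2 u) / 4"

lemma conn_coeff_derivs:
  assumes u: "u \<ge> 0"
  shows "(conn_p has_real_derivative conn_p1 u) (at u)" "(conn_q has_real_derivative conn_q1 u) (at u)"
    "(conn_t has_real_derivative conn_t1 u) (at u)"
  unfolding conn_p_def[abs_def] conn_q_def[abs_def] conn_t_def[abs_def] conn_p1_def conn_q1_def conn_t1_def
  using W_nz[OF u]
  by (auto intro!: derivative_eq_intros derivs[OF u] simp: power2_eq_square) (simp_all add: algebra_simps)?

text \<open>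
  The plane part has determinant \<open>\<kappa>\<^sup>2 W (\<kappa>\<^sup>2 W + u B) = 4 \<kappa>\<^sup>2\<close>. The trace of its connection is the
  gradient of half the logarithm of the determinant, hence zero.
\<close>

lemma trace_free: "u \<ge> 0 \<Longrightarrow> 3 * conn_p u + conn_q u + u * conn_t u = 0"
proof -
  assume u: "u \<ge> 0"
  have "W u * (4 * (3 * conn_p u + conn_q u + u * conn_t u)) =
      12 * W1 u + W u * (B u * W u + u * (B1 u * W u + B u * W1 u)) - \<kappa>^2 * (W u)^2 * W1 u - 3 * W1 u * (u * B u * W u)"
    using W_nz[OF u] by (simp add: conn_p_def conn_q_def conn_t_def field_simps power2_eq_square)
  also have "\<dots> = 0"
    unfolding B_product[OF u] B_product_deriv[OF u] by (simp add: algebra_simps power2_eq_square)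
  finally show ?thesis using W_nz[OF u] by simp
qed

lemma trace_free1: "u \<ge> 0 \<Longrightarrow> 3 * conn_p1 u + conn_q1 u + conn_t u + u * conn_t1 u = 0"
proof -
  assume u: "u \<ge> 0"
  have "((\<lambda>u. 3 * conn_p u + conn_q u + u * conn_t u) has_real_derivative
      (3 * conn_p1 u + conn_q1 u + conn_t u + u * conn_t1 u)) (at u)"
    by (auto intro!: derivative_eq_intros conn_coeff_derivs[OF u])
  from zero_derivative_on_halfline[OF this] show ?thesis using trace_free u by simp
qed

text \<open>
  The matrix of \<open>\<kappa>\<^sup>2 W \<bar>dx\<bar>\<^sup>2 + B (x \<bullet> dx)\<^sup>2 + r\<^sup>2 \<bar>d\<theta>\<bar>\<^sup>2\<close>.
\<close>

definition polar_metric :: "real^(2 + 'm::finite) \<Rightarrow> real^(2 + 'm)^(2 + 'm)" where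
  "polar_metric y = (\<chi> i j. case i of
      Inl a \<Rightarrow> (case j of Inl b \<Rightarrow> (if a = b then \<kappa>^2 else 0) * W (usq y) + B (usq y) * y $ Inl a * y $ Inl b | Inr _ \<Rightarrow> 0)
    | Inr i' \<Rightarrow> (case j of Inl _ \<Rightarrow> 0 | Inr j' \<Rightarrow> if i' = j' then (rp + usq y)^2 else 0))"

text \<open>The inverse matrix, with the constant determinant of the plane part in the denominator.\<close>

definition polar_cometric :: "real^(2 + 'm::finite) \<Rightarrow> real^(2 + 'm)^(2 + 'm)" where
  "polar_cometric y = (\<chi> i j. case i of
      Inl a \<Rightarrow> (case j of Inl b \<Rightarrow> ((if a = b then 4 else 0) / W (usq y) - B (usq y) * y $ Inl a * y $ Inl b) / (4 * \<kappa>^2) | Inr _ \<Rightarrow> 0)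
    | Inr i' \<Rightarrow> (case j of Inl _ \<Rightarrow> 0 | Inr j' \<Rightarrow> if i' = j' then 1 / (rp + usq y)^2 else 0))"

lemma polar_metric_nth:
  "polar_metric y $ Inl a $ Inl b = (if a = b then \<kappa>^2 else 0) * W (usq y) + B (usq y) * y $ Inl a * y $ Inl b"
  "polar_metric y $ Inl a $ Inr j = 0" "polar_metric y $ Inr i $ Inl b = 0"
  "polar_metric y $ Inr i $ Inr j = (if i = j then (rp + usq y)^2 else 0)"
  by (simp_all add: polar_metric_def)

lemma polar_cometric_nth [simp]:
  "polar_cometric y $ Inl a $ Inl b = ((if a = b then 4 else 0) / W (usq y) - B (usq y) * y $ Inl a * y $ Inl b) / (4 * \<kappa>^2)"
  "polar_cometric y $ Inl a $ Inr j = 0" "polar_cometric y $ Inr i $ Inl b = 0"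
  "polar_cometric y $ Inr i $ Inr j = (if i = j then 1 / (rp + usq y)^2 else 0)"
  by (simp_all add: polar_cometric_def)

lemma r_pos: "rp + usq y > 0" using rp usq_nonneg[of y] by linarith

lemma polar_metric_sym: "polar_metric y $ i $ j = polar_metric y $ j $ i"
  by (cases i; cases j) (auto simp: polar_metric_nth)

lemma polar_metric_inverse: "polar_metric y ** polar_cometric y = mat 1"
proof -
  have "(polar_metric y ** polar_cometric y) $ i $ j = mat 1 $ i $ j" for i j :: "2 + 'a"
  proof (cases i)
    case i: (Inl a)
    show ?thesis
    proof (cases j)
      case j: (Inl b)
      define x z u where "x = y $ Inl 1" and "z = y $ Inl 2" and "u = usq y"
      have u: "u = x * x + z * z" by (simp add: u_def usq_def x_def z_def power2_eq_square)
      have inv: "4 / W u = \<kappa>^2 * W u + u * B u" "W u * (\<kappa>^2 * W u + u * B u) = 4"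
        using B_product[of u] W_nz[of u] by (simp_all add: u_def field_simps power2_eq_square)
      have k: "4 * \<kappa>^2 \<noteq> 0" using \<kappa> by simp
      have diag: "(\<kappa>^2 * W u + B u * p * p) * ((4 / W u - B u * p * p) / (4 * \<kappa>^2))
          + (B u * p * q) * ((- (B u * q * p)) / (4 * \<kappa>^2)) = 1"
        if "u = p * p + q * q" for p q
      proof -
        have "(\<kappa>^2 * W u + B u * p * p) * (4 / W u - B u * p * p) + (B u * p * q) * (- (B u * q * p))
            = \<kappa>^2 * (W u * (\<kappa>^2 * W u + u * B u)) + (B u * p)^2 * (u - (p * p + q * q))"
          unfolding inv(1) by (simp add: algebra_simps power2_eq_square)
        also have "\<dots> = 4 * \<kappa>^2" unfolding inv(2) using that by simp
        finally have "(\<kappa>^2 * W u + B u * p * p) * (4 / W u - B u * p * p) + (B u * p * q) * (- (B u * q * p)) = 4 * \<kappa>^2" .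
        then show ?thesis using k by (metis add_divide_distrib divide_self times_divide_eq_right)
      qed
      have off: "(\<kappa>^2 * W u + B u * p * p) * ((- (B u * p * q)) / (4 * \<kappa>^2))
          + (B u * p * q) * ((4 / W u - B u * q * q) / (4 * \<kappa>^2)) = 0"
        if "u = p * p + q * q" for p q
      proof -
        have "(\<kappa>^2 * W u + B u * p * p) * (- (B u * p * q)) + (B u * p * q) * (4 / W u - B u * q * q)
            = (B u)^2 * p * q * (u - (p * p + q * q))"
          unfolding inv(1) by (simp add: algebra_simps power2_eq_square)
        also have "\<dots> = 0" using that by simp
        finally have "(\<kappa>^2 * W u + B u * p * p) * (- (B u * p * q)) + (B u * p * q) * (4 / W u - B u * q * q) = 0" .
        then show ?thesis by (metis add_divide_distrib div_0 times_divide_eq_right)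
      qed
      show ?thesis
        using exhaust_2[of a] exhaust_2[of b] diag[of x z] diag[of z x] off[of x z] off[of z x] u
        by (auto simp: i j matrix_matrix_mult_def sum_plane_torus polar_metric_nth mat_def add.commute
            simp flip: x_def z_def u_def)
    qed (simp add: i matrix_matrix_mult_def sum_plane_torus polar_metric_nth mat_def)
  next
    case (Inr i')
    then show ?thesis using r_pos[of y]
      by (cases j) (auto simp: matrix_matrix_mult_def sum_plane_torus polar_metric_nth mat_def if_distrib if_distribR cong: if_cong)
  qed
  then show ?thesis by (simp add: vec_eq_iff)
qed

end

lemma sum_delta_delta:
  fixes c d :: real
  shows "(\<Sum>k\<in>(UNIV :: 'k::finite set). (if i = k then c else 0) * (if j = k then d else 0)) = (if i = j then c * d else 0)"
proof -
  have "(\<Sum>k\<in>UNIV. (if i = k then c else 0) * (if j = k then d else 0))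
      = (\<Sum>k\<in>UNIV. if k = i then (if i = j then c * d else 0) else 0)"
    by (rule sum.cong) auto
  then show ?thesis by simp
qed

context polar_plane
begin

lemma Ck_on_usq: "Ck_on k UNIV usq"
  unfolding usq_def[abs_def] power2_eq_square
  by (intro Ck_on_add Ck_on_mult Ck_on_component)

lemma Ck_on_ratio:
  assumes "\<And>u. u \<ge> 0 \<Longrightarrow> poly (snd x) u \<noteq> 0"
  shows "Ck_on k UNIV (\<lambda>y. ratio x (usq y))"
  unfolding ratio_def divide_inverse
  by (intro Ck_on_mult Ck_on_inverse Ck_on_poly Ck_on_usq) (simp add: assms)

lemma Ck_on_W: "Ck_on k UNIV (\<lambda>y. W (usq y))"
  unfolding W_def by (rule Ck_on_ratio) (use D in force)

lemma Ck_on_B: "Ck_on k UNIV (\<lambda>y. B (usq y))"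
  unfolding B_def by (rule Ck_on_ratio) (use D Q in force)

lemma smooth_polar_metric: "smooth_on UNIV (\<lambda>y. polar_metric y $ i $ j)"
proof -
  have "Ck_on k UNIV (\<lambda>y. (rp + usq y)^2)" for k
    unfolding power2_eq_square by (intro Ck_on_mult Ck_on_add Ck_on_const Ck_on_usq)
  then have b: "Ck_on k UNIV (\<lambda>y. if c then (rp + usq y)^2 else 0)" for k c
    by (cases c) (simp_all add: Ck_on_const)
  have a: "Ck_on k UNIV (\<lambda>y. c * W (usq y) + B (usq y) * y $ Inl a * y $ Inl b)" for k c a b
    by (intro Ck_on_add Ck_on_mult Ck_on_const Ck_on_W Ck_on_B Ck_on_component)
  show ?thesis unfolding smooth_on_def
    by (cases i; cases j; simp only: polar_metric_nth) (simp_all only: a b Ck_on_const simp_thms)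
qed

lemma smooth_polar_cometric: "smooth_on UNIV (\<lambda>y. polar_cometric y $ i $ j)"
proof -
  have a: "Ck_on k UNIV (\<lambda>y. 1 / (rp + usq y)^2)" for k
    unfolding power2_eq_square divide_inverse
    by (intro Ck_on_mult Ck_on_inverse Ck_on_add Ck_on_const Ck_on_usq) (use r_pos in \<open>metis less_irrefl mult_eq_0_iff\<close>)
  then have c: "Ck_on k UNIV (\<lambda>y. if c then 1 / (rp + usq y)^2 else 0)" for k c
    by (cases c) (simp_all add: Ck_on_const)
  have b: "Ck_on k UNIV (\<lambda>y. (c / W (usq y) - B (usq y) * y $ Inl a * y $ Inl b) / (4 * \<kappa>^2))" for k c a b
    unfolding divide_inverse
    by (intro Ck_on_diff Ck_on_mult Ck_on_inverse Ck_on_const Ck_on_W Ck_on_B Ck_on_component)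
       (simp add: W_nz)
  show ?thesis unfolding smooth_on_def
    by (cases i; cases j; simp only: polar_cometric_nth) (simp_all only: a b c Ck_on_const simp_thms)
qed

lemma matrix_inv_polar_metric: "matrix_inv (polar_metric y) = polar_cometric y"
  by (rule matrix_inv_eqI[OF polar_metric_inverse])

lemma invertible_polar_metric: "invertible (polar_metric y)"
  using polar_metric_inverse invertible_right_inverse by blast

lemma Ck_on_christoffel: "Ck_on n UNIV (christoffel polar_metric k i j)"
proof -
  have "Ck_on n UNIV (partial_deriv l (\<lambda>y. polar_metric y $ a $ b))" for l a b
    using smooth_on_UNIV_partial[OF smooth_polar_metric] unfolding smooth_on_def by blast
  moreover have "Ck_on n UNIV (\<lambda>y. polar_cometric y $ a $ b)" for a b
    using smooth_polar_cometric unfolding smooth_on_def by blast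
  ultimately show ?thesis
    unfolding christoffel_def[abs_def] matrix_inv_polar_metric
    by (intro Ck_on_mult Ck_on_const Ck_on_sum Ck_on_diff Ck_on_add)
qed

lemma partial_polar_metric:
  "partial_deriv (Inl c) (\<lambda>y. polar_metric y $ Inl a $ Inl b) y =
      (if a = b then 2 * \<kappa>^2 * W1 (usq y) * y $ Inl c else 0) + 2 * B1 (usq y) * y $ Inl c * y $ Inl a * y $ Inl b
      + B (usq y) * ((if a = c then y $ Inl b else 0) + (if b = c then y $ Inl a else 0))"
  "partial_deriv (Inr i) (\<lambda>y. polar_metric y $ Inl a $ Inl b) y = 0"
  "partial_deriv (Inl c) (\<lambda>y. polar_metric y $ Inr i $ Inr j) y = (if i = j then 4 * (rp + usq y) * y $ Inl c else 0)"
  "partial_deriv (Inr k) (\<lambda>y. polar_metric y $ Inr i $ Inr j) y = 0"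
  "partial_deriv l (\<lambda>y. polar_metric y $ Inl a $ Inr j) y = 0"
  "partial_deriv l (\<lambda>y. polar_metric y $ Inr i $ Inl b) y = 0"
proof -
  note d = derivs[OF usq_nonneg]
  have r: "((\<lambda>u. (rp + u)^2) has_real_derivative 2 * (rp + u)) (at u)" for u
    by (auto intro!: derivative_eq_intros)
  have c: "partial_deriv l (\<lambda>y. 0) y = 0" for l
    by (simp add: partial_deriv_eqI[OF has_derivative_const])
  show "partial_deriv (Inl c) (\<lambda>y. polar_metric y $ Inl a $ Inl b) y =
      (if a = b then 2 * \<kappa>^2 * W1 (usq y) * y $ Inl c else 0) + 2 * B1 (usq y) * y $ Inl c * y $ Inl a * y $ Inl b
      + B (usq y) * ((if a = c then y $ Inl b else 0) + (if b = c then y $ Inl a else 0))"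
    unfolding polar_metric_nth by (subst partial_radial_tensor2(1)[OF d(1) d(3)]) simp
  show "partial_deriv (Inr i) (\<lambda>y. polar_metric y $ Inl a $ Inl b) y = 0"
    unfolding polar_metric_nth by (rule partial_radial_tensor2(2)[OF d(1) d(3)])
  show "partial_deriv (Inl c) (\<lambda>y. polar_metric y $ Inr i $ Inr j) y = (if i = j then 4 * (rp + usq y) * y $ Inl c else 0)"
    "partial_deriv (Inr k) (\<lambda>y. polar_metric y $ Inr i $ Inr j) y = 0"
    unfolding polar_metric_nth
    by (cases "i = j"; simp only: if_True if_False simp_thms partial_radial[OF r] c; simp)+
  show "partial_deriv l (\<lambda>y. polar_metric y $ Inl a $ Inr j) y = 0"
    "partial_deriv l (\<lambda>y. polar_metric y $ Inr i $ Inl b) y = 0"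
    unfolding polar_metric_nth by (rule c)+
qed

text \<open>
  The angular eigenvalue of the plane part is \<open>\<kappa>\<^sup>2 W\<close>, and the radial one is \<open>\<kappa>\<^sup>2 W + u B\<close>.
\<close>

lemma radial_coefficient: "u \<ge> 0 \<Longrightarrow> 4 / W u = \<kappa>^2 * W u + u * B u"
  using B_product[of u] W_nz[of u] by (simp add: field_simps power2_eq_square)

lemma plane_determinant: "u \<ge> 0 \<Longrightarrow> W u * (\<kappa>^2 * W u + u * B u) = 4"
  using B_product[of u] by (simp add: field_simps power2_eq_square)

text \<open>
  The lowered symbol is \<open>\<kappa>\<^sup>2 W' (x\<^sub>b \<delta>\<^sub>c\<^sub>d + x\<^sub>c \<delta>\<^sub>b\<^sub>d - x\<^sub>d \<delta>\<^sub>b\<^sub>c) + B' x\<^sub>b x\<^sub>c x\<^sub>d + B \<delta>\<^sub>b\<^sub>c x\<^sub>d\<close>; raising \<open>d\<close>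
  leaves three radial functions.
\<close>

lemma christoffel_plane:
  "christoffel polar_metric (Inl a) (Inl b) (Inl c) y =
     conn_p (usq y) * ((if a = c then 1 else 0) * y $ Inl b + (if a = b then 1 else 0) * y $ Inl c)
     + y $ Inl a * ((if b = c then 1 else 0) * conn_q (usq y) + conn_t (usq y) * y $ Inl b * y $ Inl c)"
proof -
  define u x where "u = usq y" and "x = (\<lambda>a. y $ Inl a)"
  define \<delta> where "\<delta> = (\<lambda>a b::2. if a = b then 1 else 0 :: real)"
  have u: "u = x 1 * x 1 + x 2 * x 2" "u \<ge> 0" by (simp_all add: u_def usq_def x_def power2_eq_square)
  have ux: "usq y = u" "\<And>a. y $ Inl a = x a" by (simp_all add: u_def x_def)
  have k: "\<kappa>^2 \<noteq> 0" using \<kappa> by simp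
  define L where "L = (\<lambda>d. \<kappa>^2 * W1 u * (x b * \<delta> c d + x c * \<delta> b d - x d * \<delta> b c) + B1 u * x b * x c * x d + B u * \<delta> b c * x d)"
  have low: "partial_deriv (Inl b) (\<lambda>y. polar_metric y $ Inl c $ Inl d) y
      + partial_deriv (Inl c) (\<lambda>y. polar_metric y $ Inl b $ Inl d) y
      - partial_deriv (Inl d) (\<lambda>y. polar_metric y $ Inl b $ Inl c) y = 2 * L d" for d
    using exhaust_2[of b] exhaust_2[of c] exhaust_2[of d]
    by (auto simp: partial_polar_metric L_def \<delta>_def algebra_simps ux)
  have "christoffel polar_metric (Inl a) (Inl b) (Inl c) y
      = (\<Sum>d\<in>UNIV. polar_cometric y $ Inl a $ Inl d * L d)"
    unfolding christoffel_def matrix_inv_polar_metric sum_plane_torus low sum_2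
    by (simp del: polar_cometric_nth(1))
  also have "\<dots> = (\<Sum>d\<in>UNIV. (\<delta> a d * (4 / W u) - B u * x a * x d) * L d) / (4 * \<kappa>^2)"
    unfolding sum_divide_distrib
    by (intro sum.cong refl) (simp add: \<delta>_def ux)
  also have "\<dots> = conn_p u * (\<delta> a c * x b + \<delta> a b * x c) + x a * (\<delta> b c * conn_q u + conn_t u * x b * x c)"
  proof -
    have p: "conn_p u = W1 u * (\<kappa>^2 * W u + u * B u) / 4"
      using W_nz[OF u(2)] radial_coefficient[OF u(2)] by (simp add: conn_p_def flip: radial_coefficient[OF u(2)])
    have \<delta>: "\<delta> e 1 * f 1 + \<delta> e 2 * f 2 = f e" for e and f :: "2 \<Rightarrow> real"
      using exhaust_2[of e] by (auto simp: \<delta>_def)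
    have "(\<Sum>d\<in>UNIV. x d * L d) = \<kappa>^2 * W1 u * (x b * (\<delta> c 1 * x 1 + \<delta> c 2 * x 2)
        + x c * (\<delta> b 1 * x 1 + \<delta> b 2 * x 2) - (x 1 * x 1 + x 2 * x 2) * \<delta> b c)
        + (B1 u * x b * x c + B u * \<delta> b c) * (x 1 * x 1 + x 2 * x 2)"
      by (simp add: sum_2 L_def algebra_simps)
    also have "\<dots> = \<kappa>^2 * W1 u * (2 * x b * x c - u * \<delta> b c) + (B1 u * x b * x c + B u * \<delta> b c) * u"
      unfolding \<delta> u(1)[symmetric] by simp
    finally have xL: "(\<Sum>d\<in>UNIV. x d * L d)
      = \<kappa>^2 * W1 u * (2 * x b * x c - u * \<delta> b c) + (B1 u * x b * x c + B u * \<delta> b c) * u" .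
    have "(\<Sum>d\<in>UNIV. (\<delta> a d * (4 / W u) - B u * x a * x d) * L d)
       = (4 / W u) * (\<delta> a 1 * L 1 + \<delta> a 2 * L 2) - B u * x a * (\<Sum>d\<in>UNIV. x d * L d)"
      by (simp add: sum_2 algebra_simps)
    also have "\<dots> = 4 * \<kappa>^2 * (conn_p u * (\<delta> a c * x b + \<delta> a b * x c) + x a * (\<delta> b c * conn_q u + conn_t u * x b * x c))"
    proof -
      have sym: "\<delta> c a = \<delta> a c" "\<delta> b a = \<delta> a b" by (simp_all add: \<delta>_def)
      show ?thesis
        unfolding \<delta>[of a L] xL unfolding radial_coefficient[OF u(2)] p conn_q_def conn_t_def L_def sym
        by (simp add: algebra_simps power2_eq_square add_divide_distrib diff_divide_distrib)
    qed
    finally have "(\<Sum>d\<in>UNIV. (\<delta> a d * (4 / W u) - B u * x a * x d) * L d)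
       = 4 * \<kappa>^2 * (conn_p u * (\<delta> a c * x b + \<delta> a b * x c) + x a * (\<delta> b c * conn_q u + conn_t u * x b * x c))" .
    then show ?thesis using k by simp
  qed
  finally show ?thesis by (simp add: \<delta>_def u_def x_def)
qed

text \<open>
  The torus directions see the plane only through the warping factor \<open>r = r\<^sub>+ + u\<close>, which has
  differential \<open>2 x\<close> and gradient \<open>W x / 2\<close>.
\<close>

lemma christoffel_torus:
  "christoffel polar_metric (Inl a) (Inr i) (Inr j) y =
     (if i = j then - (W (usq y) * (rp + usq y) / 2) * y $ Inl a else 0)"
  "christoffel polar_metric (Inr i) (Inr j) (Inl a) y = (if i = j then 2 / (rp + usq y) * y $ Inl a else 0)"
  "christoffel polar_metric (Inr i) (Inl a) (Inr j) y = (if i = j then 2 / (rp + usq y) * y $ Inl a else 0)"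
  "christoffel polar_metric (Inl a) (Inl b) (Inr i) y = 0"
  "christoffel polar_metric (Inl a) (Inr i) (Inl b) y = 0"
  "christoffel polar_metric (Inr i) (Inl a) (Inl b) y = 0"
  "christoffel polar_metric (Inr i) (Inr j) (Inr k) y = 0"
proof -
  have r: "rp + usq y \<noteq> 0" using r_pos[of y] by simp
  note simps = christoffel_def matrix_inv_polar_metric sum_plane_torus partial_polar_metric
  show "christoffel polar_metric (Inl a) (Inr i) (Inr j) y =
     (if i = j then - (W (usq y) * (rp + usq y) / 2) * y $ Inl a else 0)"
  proof -
    define u x where "u = usq y" and "x = (\<lambda>a. y $ Inl a)"
    have u: "u = x 1 * x 1 + x 2 * x 2" "u \<ge> 0" by (simp_all add: u_def usq_def x_def power2_eq_square)
  have ux: "usq y = u" "\<And>a. y $ Inl a = x a" by (simp_all add: u_def x_def)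
    have k: "\<kappa>^2 \<noteq> 0" using \<kappa> by simp
    have low: "partial_deriv (Inr i) (\<lambda>y. polar_metric y $ Inr j $ Inl d) y
      + partial_deriv (Inr j) (\<lambda>y. polar_metric y $ Inr i $ Inl d) y
      - partial_deriv (Inl d) (\<lambda>y. polar_metric y $ Inr i $ Inr j) y
      = (if i = j then - 4 * (rp + u) * x d else 0)" for d
      by (simp add: partial_polar_metric ux algebra_simps)
    have "christoffel polar_metric (Inl a) (Inr i) (Inr j) y = (if i = j then
       - 2 * (rp + u) * (((if a = 1 then 4 else 0) / W u - B u * x a * x 1) * x 1
        + ((if a = 2 then 4 else 0) / W u - B u * x a * x 2) * x 2) / (4 * \<kappa>^2) else 0)"
      unfolding christoffel_def matrix_inv_polar_metric sum_plane_torus low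
      by (simp only: polar_cometric_nth ux) (simp add: add_divide_distrib diff_divide_distrib algebra_simps)
    also have "((if a = 1 then 4 else 0) / W u - B u * x a * x 1) * x 1
        + ((if a = 2 then 4 else 0) / W u - B u * x a * x 2) * x 2 = x a * (4 / W u - u * B u)"
      using exhaust_2[of a] by (auto simp: u(1) algebra_simps)
    also have "4 / W u - u * B u = \<kappa>^2 * W u" using radial_coefficient[OF u(2)] by simp
    moreover have "- 2 * (rp + u) * (x a * (\<kappa>^2 * W u)) / (4 * \<kappa>^2) = - (W u * (rp + u) / 2) * x a"
      using k by (simp add: field_simps)
    ultimately show ?thesis by (simp add: u_def x_def)
  qed
  have q: "1 / \<rho>^2 * (4 * \<rho> * \<xi>) = 4 / \<rho> * \<xi>" if "\<rho> \<noteq> 0" for \<rho> \<xi> :: real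
    using that by (simp add: power2_eq_square)
  have low: "partial_deriv (Inr j) (\<lambda>y. polar_metric y $ Inl a $ Inr k) y
      + partial_deriv (Inl a) (\<lambda>y. polar_metric y $ Inr j $ Inr k) y
      - partial_deriv (Inr k) (\<lambda>y. polar_metric y $ Inr j $ Inl a) y
      = (if j = k then 4 * (rp + usq y) * y $ Inl a else 0)"
    "partial_deriv (Inl a) (\<lambda>y. polar_metric y $ Inr j $ Inr k) y
      + partial_deriv (Inr j) (\<lambda>y. polar_metric y $ Inl a $ Inr k) y
      - partial_deriv (Inr k) (\<lambda>y. polar_metric y $ Inl a $ Inr j) y
      = (if j = k then 4 * (rp + usq y) * y $ Inl a else 0)" for j k
    by (simp_all add: partial_polar_metric)
  show "christoffel polar_metric (Inr i) (Inr j) (Inl a) y = (if i = j then 2 / (rp + usq y) * y $ Inl a else 0)"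
    "christoffel polar_metric (Inr i) (Inl a) (Inr j) y = (if i = j then 2 / (rp + usq y) * y $ Inl a else 0)"
    unfolding christoffel_def matrix_inv_polar_metric sum_plane_torus low polar_cometric_nth sum_delta_delta q[OF r]
    by simp_all
  show "christoffel polar_metric (Inl a) (Inl b) (Inr i) y = 0"
    "christoffel polar_metric (Inl a) (Inr i) (Inl b) y = 0"
    "christoffel polar_metric (Inr i) (Inl a) (Inl b) y = 0"
    "christoffel polar_metric (Inr i) (Inr j) (Inr k) y = 0"
    by (simp_all add: simps)
qed

end

section \<open>Scalar curvature\<close>

definition kronecker :: "2 \<Rightarrow> 2 \<Rightarrow> real" where "kronecker a b = (if a = b then 1 else 0)"

lemma kronecker_simps [simp]: "kronecker 1 1 = 1" "kronecker 2 2 = 1" "kronecker 1 2 = 0" "kronecker 2 1 = 0"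
  by (simp_all add: kronecker_def)

text \<open>
  The general form of the Christoffel symbols with upper index \<open>a\<close> of a rotationally symmetric metric of
  the plane. Working with numbers \<open>p\<close>, \<open>q\<close>, \<open>t\<close> separates the index contractions from the
  calculus of radial functions.
\<close>

definition conn :: "real \<Rightarrow> real \<Rightarrow> real \<Rightarrow> (2 \<Rightarrow> real) \<Rightarrow> 2 \<Rightarrow> 2 \<Rightarrow> 2 \<Rightarrow> real" where
  "conn p q t x a b c = p * (kronecker a c * x b + kronecker a b * x c) + x a * (kronecker b c * q + t * x b * x c)"

lemma conn_trace:
  assumes "3 * p + q + ((x 1)^2 + (x 2)^2) * t = 0"
  shows "conn p q t x 1 1 d + conn p q t x 2 2 d = 0"
proof -
  have "conn p q t x 1 1 d + conn p q t x 2 2 d = x d * (3 * p + q + ((x 1)^2 + (x 2)^2) * t)"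
    using exhaust_2[of d] by (auto simp: conn_def algebra_simps power2_eq_square)
  then show ?thesis using assms by simp
qed

lemma conn_square:
  assumes "3 * p + q + u * t = 0" "u = (x 1)^2 + (x 2)^2"
  shows "(\<Sum>a\<in>UNIV. \<Sum>d\<in>UNIV. conn p q t x a c d * conn p q t x d b a)
     = 2 * u * p * q * kronecker b c + (8 * p^2 + 2 * u * p * t) * x b * x c"
proof -
  have q: "q = - 3 * p - u * t" using assms(1) by simp
  show ?thesis
    using exhaust_2[of b] exhaust_2[of c] unfolding q assms(2)
    by (elim disjE; simp only: sum_2 conn_def kronecker_simps) (simp_all add: algebra_simps power2_eq_square)
qed

lemma conn_contract:
  "(\<Sum>d\<in>UNIV. x d * conn p q t x d b c) = ((x 1)^2 + (x 2)^2) * q * kronecker b c + (2 * p + ((x 1)^2 + (x 2)^2) * t) * x b * x c"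
  using exhaust_2[of b] exhaust_2[of c]
  by (auto simp: sum_2 conn_def algebra_simps power2_eq_square)

text \<open>
  The partial derivative of \<open>conn\<close> in direction \<open>k\<close> when \<open>p\<close>, \<open>q\<close>, \<open>t\<close> are functions of
  \<open>u = x\<^sub>1\<^sup>2 + x\<^sub>2\<^sup>2\<close> with derivatives \<open>p'\<close>, \<open>q'\<close>, \<open>t'\<close>.
\<close>

definition dconn :: "real \<Rightarrow> real \<Rightarrow> real \<Rightarrow> real \<Rightarrow> real \<Rightarrow> real \<Rightarrow> (2 \<Rightarrow> real) \<Rightarrow> 2 \<Rightarrow> 2 \<Rightarrow> 2 \<Rightarrow> 2 \<Rightarrow> real" where
  "dconn p q t p' q' t' x k a b c =
      2 * p' * x k * (kronecker a c * x b + kronecker a b * x c)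
      + p * (kronecker a c * kronecker b k + kronecker a b * kronecker c k)
      + kronecker a k * (kronecker b c * q + t * x b * x c)
      + x a * (2 * kronecker b c * q' * x k + 2 * t' * x k * x b * x c + t * (kronecker b k * x c + kronecker c k * x b))"

lemma dconn_trace:
  assumes "3 * p + q + ((x 1)^2 + (x 2)^2) * t = 0" "3 * p' + q' + t + ((x 1)^2 + (x 2)^2) * t' = 0"
  shows "dconn p q t p' q' t' x c 1 b 1 + dconn p q t p' q' t' x c 2 b 2 = 0"
proof -
  have "dconn p q t p' q' t' x c 1 b 1 + dconn p q t p' q' t' x c 2 b 2
    = kronecker b c * (3 * p + q + ((x 1)^2 + (x 2)^2) * t) + 2 * x b * x c * (3 * p' + q' + t + ((x 1)^2 + (x 2)^2) * t')"
    using exhaust_2[of b] exhaust_2[of c]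
    by (elim disjE; simp only: dconn_def kronecker_simps) (simp_all add: algebra_simps power2_eq_square)
  then show ?thesis using assms by simp
qed

lemma dconn_divergence:
  assumes "u = (x 1)^2 + (x 2)^2"
  shows "(\<Sum>a\<in>UNIV. dconn p q t p' q' t' x a a b c)
    = (2 * p + 2 * q + 2 * u * q') * kronecker b c + (4 * p' + 4 * t + 2 * u * t') * x b * x c"
  using exhaust_2[of b] exhaust_2[of c] unfolding assms
  by (elim disjE; simp only: sum_2 dconn_def kronecker_simps) (simp_all add: algebra_simps power2_eq_square)

context polar_plane
begin

lemma christoffel_plane_conn:
  "christoffel polar_metric (Inl a) (Inl b) (Inl c) y =
     conn (conn_p (usq y)) (conn_q (usq y)) (conn_t (usq y)) (\<lambda>a. y $ Inl a) a b c"
  unfolding christoffel_plane conn_def kronecker_def ..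

lemma partial_christoffel_plane:
  fixes y :: "real^(2 + 'm::finite)"
  shows "partial_deriv (Inl k) (christoffel polar_metric (Inl a) (Inl b) (Inl c)) y =
     dconn (conn_p (usq y)) (conn_q (usq y)) (conn_t (usq y)) (conn_p1 (usq y)) (conn_q1 (usq y)) (conn_t1 (usq y)) (\<lambda>a. y $ Inl a) k a b c"
proof -
  have eq: "christoffel polar_metric (Inl a) (Inl b) (Inl c) = (\<lambda>y :: real^(2 + 'm). conn_p (usq y) * (kronecker a c * y $ Inl b + kronecker a b * y $ Inl c)
     + y $ Inl a * (kronecker b c * conn_q (usq y) + conn_t (usq y) * y $ Inl b * y $ Inl c))"
    by (rule ext) (simp add: christoffel_plane kronecker_def)
  show ?thesis
    unfolding dconn_def eq
    by (simp only: partial_radial_tensor3[OF conn_coeff_derivs(1)[OF usq_nonneg] conn_coeff_derivs(2)[OF usq_nonneg] conn_coeff_derivs(3)[OF usq_nonneg]])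
       (simp add: kronecker_def algebra_simps)
qed

lemma partial_christoffel_torus:
  "partial_deriv (Inl c) (christoffel polar_metric (Inr i) (Inl b) (Inr i)) y =
     - 4 / (rp + usq y)^2 * y $ Inl c * y $ Inl b + kronecker b c * (2 / (rp + usq y))"
  "partial_deriv (Inl b) (christoffel polar_metric (Inl a) (Inr i) (Inr i)) y =
     - (W1 (usq y) * (rp + usq y) + W (usq y)) * y $ Inl b * y $ Inl a - kronecker a b * (W (usq y) * (rp + usq y) / 2)"
proof -
  have r: "rp + usq y \<noteq> 0" using r_pos[of y] by simp
  have L: "((\<lambda>u. 2 / (rp + u)) has_real_derivative - 2 / (rp + usq y)^2) (at (usq y))"
    using r by (auto intro!: derivative_eq_intros simp: power2_eq_square)
  have N: "((\<lambda>u. - (W u * (rp + u) / 2)) has_real_derivative - (W1 (usq y) * (rp + usq y) + W (usq y)) / 2) (at (usq y))"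
    by (auto intro!: derivative_eq_intros derivs simp: add_divide_distrib)
  have eq: "christoffel polar_metric (Inr i) (Inl b) (Inr i) = (\<lambda>y. 2 / (rp + usq y) * y $ Inl b)"
    "christoffel polar_metric (Inl a) (Inr i) (Inr i) = (\<lambda>y. - (W (usq y) * (rp + usq y) / 2) * y $ Inl a)"
    by (auto simp: christoffel_torus)
  show "partial_deriv (Inl c) (christoffel polar_metric (Inr i) (Inl b) (Inr i)) y =
     - 4 / (rp + usq y)^2 * y $ Inl c * y $ Inl b + kronecker b c * (2 / (rp + usq y))"
    unfolding eq partial_radial_tensor1[OF L] by (simp add: kronecker_def)
  show "partial_deriv (Inl b) (christoffel polar_metric (Inl a) (Inr i) (Inr i)) y =
     - (W1 (usq y) * (rp + usq y) + W (usq y)) * y $ Inl b * y $ Inl a - kronecker a b * (W (usq y) * (rp + usq y) / 2)"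
    unfolding eq partial_radial_tensor1[OF N] by (simp add: kronecker_def)
qed

lemma partial_christoffel_zero:
  "partial_deriv l (christoffel polar_metric (Inr i) (Inl a) (Inl b)) y = 0"
  "partial_deriv l (christoffel polar_metric (Inl a) (Inr i) (Inl b)) y = 0"
  "partial_deriv l (christoffel polar_metric (Inr i) (Inr j) (Inr k)) y = 0"
proof -
  have "partial_deriv l f y = 0" if "f = (\<lambda>y. 0)" for f
    unfolding that by (rule partial_deriv_eqI[OF has_derivative_const])
  moreover have "christoffel polar_metric (Inr i) (Inl a) (Inl b) = (\<lambda>y. 0)"
    "christoffel polar_metric (Inl a) (Inr i) (Inl b) = (\<lambda>y. 0)"
    "christoffel polar_metric (Inr i) (Inr j) (Inr k) = (\<lambda>y. 0)"
    by (auto simp: christoffel_torus)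
  ultimately show "partial_deriv l (christoffel polar_metric (Inr i) (Inl a) (Inl b)) y = 0"
    "partial_deriv l (christoffel polar_metric (Inl a) (Inr i) (Inl b)) y = 0"
    "partial_deriv l (christoffel polar_metric (Inr i) (Inr j) (Inr k)) y = 0" by blast+
qed

text \<open>
  In the Ricci tensor, a sum over the two plane directions gives the curvature of the plane part, and each
  of the \<open>m\<close> torus directions gives the same contribution of the Hessian of \<open>r\<close>.
\<close>

lemma ricci_plane:
  fixes y :: "real^(2 + 'm::finite)"
  defines "u \<equiv> usq y" and "m \<equiv> real CARD('m)"
  shows "ricci polar_metric (Inl b) (Inl c) y =
     kronecker b c * (2 * conn_p u + 2 * conn_q u + 2 * u * conn_q1 u - 2 * u * conn_p u * conn_q u + m * (2 / (rp + u)) * (u * conn_q u - 1))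
     + (4 * conn_p1 u + 4 * conn_t u + 2 * u * conn_t1 u - 8 * (conn_p u)^2 - 2 * u * conn_p u * conn_t u
        + m * (2 / (rp + u)) * (2 * conn_p u + u * conn_t u)) * y $ Inl b * y $ Inl c"
proof -
  define x where "x = (\<lambda>a. y $ Inl a)"
  define \<Gamma> where "\<Gamma> = conn (conn_p u) (conn_q u) (conn_t u) x"
  define d where "d = dconn (conn_p u) (conn_q u) (conn_t u) (conn_p1 u) (conn_q1 u) (conn_t1 u) x"
  have u: "u = (x 1)^2 + (x 2)^2" "u \<ge> 0" by (simp_all add: u_def x_def usq_def)
  have tr: "3 * conn_p u + conn_q u + u * conn_t u = 0" "3 * conn_p1 u + conn_q1 u + conn_t u + u * conn_t1 u = 0"
    using trace_free trace_free1 u(2) by auto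
  have r: "rp + u \<noteq> 0" using r_pos[of y] by (simp add: u_def)
  have dsum: "d c 1 b 1 + d c 2 b 2 = 0" and \<Gamma>sum: "\<And>e. \<Gamma> 1 1 e + \<Gamma> 2 2 e = 0"
    using dconn_trace conn_trace tr u(1) unfolding d_def \<Gamma>_def by blast+
  have plane: "(\<Sum>a\<in>UNIV. d a a b c - d c a b a + (\<Sum>e\<in>UNIV. \<Gamma> a a e * \<Gamma> e b c - \<Gamma> a c e * \<Gamma> e b a))
     = kronecker b c * (2 * conn_p u + 2 * conn_q u + 2 * u * conn_q1 u - 2 * u * conn_p u * conn_q u)
     + (4 * conn_p1 u + 4 * conn_t u + 2 * u * conn_t1 u - 8 * (conn_p u)^2 - 2 * u * conn_p u * conn_t u) * x b * x c"
  proof -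
    have "(\<Sum>a\<in>UNIV. d a a b c - d c a b a + (\<Sum>e\<in>UNIV. \<Gamma> a a e * \<Gamma> e b c - \<Gamma> a c e * \<Gamma> e b a))
      = (\<Sum>a\<in>UNIV. d a a b c) - (d c 1 b 1 + d c 2 b 2)
       + ((\<Gamma> 1 1 1 + \<Gamma> 2 2 1) * \<Gamma> 1 b c + (\<Gamma> 1 1 2 + \<Gamma> 2 2 2) * \<Gamma> 2 b c)
       - (\<Sum>a\<in>UNIV. \<Sum>e\<in>UNIV. \<Gamma> a c e * \<Gamma> e b a)"
      by (simp add: sum_2 algebra_simps)
    also have "\<dots> = (\<Sum>a\<in>UNIV. d a a b c) - (\<Sum>a\<in>UNIV. \<Sum>e\<in>UNIV. \<Gamma> a c e * \<Gamma> e b a)"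
      unfolding dsum \<Gamma>sum by simp
    also have "\<dots> = kronecker b c * (2 * conn_p u + 2 * conn_q u + 2 * u * conn_q1 u - 2 * u * conn_p u * conn_q u)
     + (4 * conn_p1 u + 4 * conn_t u + 2 * u * conn_t1 u - 8 * (conn_p u)^2 - 2 * u * conn_p u * conn_t u) * x b * x c"
      unfolding d_def \<Gamma>_def dconn_divergence[OF u(1)] conn_square[OF tr(1) u(1)]
      by (simp add: algebra_simps)
    finally show ?thesis .
  qed
  have contr: "x 1 * \<Gamma> 1 b c + x 2 * \<Gamma> 2 b c = u * conn_q u * kronecker b c + (2 * conn_p u + u * conn_t u) * x b * x c"
    unfolding \<Gamma>_def using conn_contract[of x] by (simp add: sum_2 u(1))
  have torus: "- (- 4 / (rp + u)^2 * x c * x b + kronecker b c * (2 / (rp + u)))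
      + (2 / (rp + u) * x 1 * \<Gamma> 1 b c + 2 / (rp + u) * x 2 * \<Gamma> 2 b c) - (2 / (rp + u) * x c) * (2 / (rp + u) * x b)
     = 2 / (rp + u) * (kronecker b c * (u * conn_q u - 1) + (2 * conn_p u + u * conn_t u) * x b * x c)"
  proof -
    have "2 / (rp + u) * x 1 * \<Gamma> 1 b c + 2 / (rp + u) * x 2 * \<Gamma> 2 b c = 2 / (rp + u) * (x 1 * \<Gamma> 1 b c + x 2 * \<Gamma> 2 b c)"
      by (simp add: algebra_simps)
    then show ?thesis unfolding contr by (simp add: power2_eq_square algebra_simps)
  qed
  have "ricci polar_metric (Inl b) (Inl c) y =
     (\<Sum>a\<in>UNIV. d a a b c - d c a b a + (\<Sum>e\<in>UNIV. \<Gamma> a a e * \<Gamma> e b c - \<Gamma> a c e * \<Gamma> e b a))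
     + (\<Sum>i\<in>(UNIV::'m set). - (- 4 / (rp + u)^2 * x c * x b + kronecker b c * (2 / (rp + u)))
      + (2 / (rp + u) * x 1 * \<Gamma> 1 b c + 2 / (rp + u) * x 2 * \<Gamma> 2 b c) - (2 / (rp + u) * x c) * (2 / (rp + u) * x b))"
  proof -
    have s1: "(\<Sum>j\<in>UNIV. christoffel polar_metric (Inr i) (Inr i) (Inr j) y * christoffel polar_metric (Inr j) (Inl b) (Inl c) y
        - christoffel polar_metric (Inr i) (Inl c) (Inr j) y * christoffel polar_metric (Inr j) (Inl b) (Inr i) y)
        = - ((2 / (rp + u) * x c) * (2 / (rp + u) * x b))" for i :: 'm
    proof -
      have "(\<Sum>j\<in>UNIV. christoffel polar_metric (Inr i) (Inr i) (Inr j) y * christoffel polar_metric (Inr j) (Inl b) (Inl c) y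
        - christoffel polar_metric (Inr i) (Inl c) (Inr j) y * christoffel polar_metric (Inr j) (Inl b) (Inr i) y)
        = (\<Sum>j\<in>UNIV. if j = i then - ((2 / (rp + u) * x c) * (2 / (rp + u) * x b)) else 0)"
        by (rule sum.cong) (auto simp: christoffel_torus u_def x_def)
      then show ?thesis by simp
    qed
    show ?thesis
      unfolding ricci_def sum_plane_torus s1
      by (simp only: sum_2 christoffel_plane_conn christoffel_torus partial_christoffel_plane partial_christoffel_torus partial_christoffel_zero
          \<Gamma>_def[symmetric] d_def[symmetric] u_def[symmetric] x_def[symmetric] mult_zero_left mult_zero_right if_True simp_thms)
         (simp add: \<Gamma>_def d_def u_def x_def)
  qed
  also have "\<dots> = kronecker b c * (2 * conn_p u + 2 * conn_q u + 2 * u * conn_q1 u - 2 * u * conn_p u * conn_q u)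
     + (4 * conn_p1 u + 4 * conn_t u + 2 * u * conn_t1 u - 8 * (conn_p u)^2 - 2 * u * conn_p u * conn_t u) * x b * x c
     + m * (2 / (rp + u) * (kronecker b c * (u * conn_q u - 1) + (2 * conn_p u + u * conn_t u) * x b * x c))"
    unfolding plane torus by (simp add: m_def)
  finally show ?thesis by (simp add: x_def algebra_simps)
qed

lemma ricci_torus:
  fixes y :: "real^(2 + 'm::finite)"
  defines "u \<equiv> usq y" and "m \<equiv> real CARD('m)"
  shows "ricci polar_metric (Inr i) (Inr i) y =
     - W u * (rp + u) - u * (W1 u * (rp + u) + W u) - (m - 2) * u * W u"
proof -
  define x where "x = (\<lambda>a. y $ Inl a)"
  define \<Gamma> where "\<Gamma> = conn (conn_p u) (conn_q u) (conn_t u) x"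
  define L N where "L = 2 / (rp + u)" and "N = - (W u * (rp + u) / 2)"
  have u: "u = (x 1)^2 + (x 2)^2" "u \<ge> 0" by (simp_all add: u_def x_def usq_def)
  have tr: "3 * conn_p u + conn_q u + u * conn_t u = 0" using trace_free u(2) by auto
  have r: "rp + u \<noteq> 0" using r_pos[of y] by (simp add: u_def)
  have \<Gamma>sum: "\<Gamma> 1 1 e + \<Gamma> 2 2 e = 0" for e
    using conn_trace tr u(1) unfolding \<Gamma>_def by blast
  have LN: "L * N = - W u" using r by (simp add: L_def N_def)
  have ux: "usq y = u" "y $ Inl a = x a" for a by (simp_all add: u_def x_def)
  have a: "(\<Sum>l\<in>UNIV. christoffel polar_metric (Inl a) (Inl a) (Inr l) y * christoffel polar_metric (Inr l) (Inr i) (Inr i) y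
       - christoffel polar_metric (Inl a) (Inr i) (Inr l) y * christoffel polar_metric (Inr l) (Inr i) (Inl a) y)
     = - (N * x a * (L * x a))" for a
  proof -
    have "(\<Sum>l\<in>UNIV. christoffel polar_metric (Inl a) (Inl a) (Inr l) y * christoffel polar_metric (Inr l) (Inr i) (Inr i) y
       - christoffel polar_metric (Inl a) (Inr i) (Inr l) y * christoffel polar_metric (Inr l) (Inr i) (Inl a) y)
      = (\<Sum>l\<in>UNIV. if l = i then - (N * x a * (L * x a)) else 0)"
      by (rule sum.cong) (auto simp: christoffel_torus L_def N_def ux)
    then show ?thesis by simp
  qed
  have b: "christoffel polar_metric (Inr k) (Inr k) (Inl e) y * christoffel polar_metric (Inl e) (Inr i) (Inr i) y
       - christoffel polar_metric (Inr k) (Inr i) (Inl e) y * christoffel polar_metric (Inl e) (Inr i) (Inr k) y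
     = L * x e * (N * x e) - (if k = i then L * x e * (N * x e) else 0)" for k e
    by (auto simp: christoffel_torus L_def N_def ux)
  have "ricci polar_metric (Inr i) (Inr i) y =
     (\<Sum>a\<in>UNIV. partial_deriv (Inl a) (christoffel polar_metric (Inl a) (Inr i) (Inr i)) y)
     + ((\<Gamma> 1 1 1 + \<Gamma> 2 2 1) * (N * x 1) + (\<Gamma> 1 1 2 + \<Gamma> 2 2 2) * (N * x 2))
     - (N * x 1 * (L * x 1) + N * x 2 * (L * x 2))
     + (\<Sum>k\<in>(UNIV::'m set). (L * x 1 * (N * x 1) + L * x 2 * (N * x 2)) - (if k = i then L * x 1 * (N * x 1) + L * x 2 * (N * x 2) else 0))"
  proof -
    have c: "(\<Sum>l\<in>UNIV. christoffel polar_metric (Inr k) (Inr k) (Inr l) y * christoffel polar_metric (Inr l) (Inr i) (Inr i) y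
       - christoffel polar_metric (Inr k) (Inr i) (Inr l) y * christoffel polar_metric (Inr l) (Inr i) (Inr k) y) = 0" for k
      by (simp add: christoffel_torus)
    have e: "christoffel polar_metric (Inl a) (Inl a) (Inl e) y * christoffel polar_metric (Inl e) (Inr i) (Inr i) y
       - christoffel polar_metric (Inl a) (Inr i) (Inl e) y * christoffel polar_metric (Inl e) (Inr i) (Inl a) y
      = \<Gamma> a a e * (N * x e)" for a e
      by (simp add: christoffel_torus christoffel_plane_conn \<Gamma>_def N_def ux)
    have d: "0 - 0 + (p - (if k = i then p else 0) + (q - (if k = i then q else 0)) + 0)
        = p + q - (if k = i then p + q else (0::real))" for k p q
      by simp
    show ?thesis
      unfolding ricci_def sum_plane_torus a b c e partial_christoffel_zero d
      by (simp only: sum_2 distrib_right)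
  qed
  also have "\<dots> = (\<Sum>a\<in>UNIV. partial_deriv (Inl a) (christoffel polar_metric (Inl a) (Inr i) (Inr i)) y)
     + (m - 2) * (L * N) * u"
    unfolding \<Gamma>sum by (simp add: sum_subtractf m_def u(1) algebra_simps power2_eq_square)
  also have "(\<Sum>a\<in>UNIV. partial_deriv (Inl a) (christoffel polar_metric (Inl a) (Inr i) (Inr i)) y)
     = - W u * (rp + u) - u * (W1 u * (rp + u) + W u)"
    unfolding partial_christoffel_torus ux by (simp add: sum_2 u(1) algebra_simps power2_eq_square)
  finally show ?thesis by (simp add: LN)
qed


text \<open>The Gauss curvature \<open>- V'' / 2\<close> of the plane part, for \<open>V = u * W u\<close>.\<close>

definition gauss_curvature :: "real \<Rightarrow> real" where "gauss_curvature u = - W1 u - u * W2 u / 2"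

lemma conn_p_eq: "u \<ge> 0 \<Longrightarrow> conn_p u = W1 u * (\<kappa>^2 * W u + u * B u) / 4"
  by (simp add: conn_p_def flip: radial_coefficient)

text \<open>
  The Ricci tensor of the plane part is its Gauss curvature times the metric: this lemma compares the
  coefficients of \<open>\<delta>\<^sub>b\<^sub>c\<close>, the next one those of \<open>x\<^sub>b x\<^sub>c\<close>. The latter only matter multiplied by \<open>u\<close>,
  which avoids second derivatives of the coefficient \<open>B\<close>.
\<close>

lemma plane_ricci_delta:
  assumes u: "u \<ge> 0"
  shows "2 * conn_p u + 2 * conn_q u + 2 * u * conn_q1 u - 2 * u * conn_p u * conn_q u = gauss_curvature u * \<kappa>^2 * W u"
proof -
  have pq: "conn_p u * conn_q u = W1 u * (B u - \<kappa>^2 * W1 u) / 4"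
    using W_nz[OF u] by (simp add: conn_p_def conn_q_def)
  have "2 * conn_p u + 2 * conn_q u + 2 * u * conn_q1 u - 2 * u * (conn_p u * conn_q u)
     = (W1 u * (\<kappa>^2 * W u + u * B u) + (B u * W u + u * (B1 u * W u + B u * W1 u)) - u * B u * W1 u
        - \<kappa>^2 * W u * W1 u - u * \<kappa>^2 * W u * W2 u) / 2"
    unfolding pq unfolding conn_p_eq[OF u] conn_q_def conn_q1_def by (simp add: field_simps)
  also have "\<dots> = gauss_curvature u * \<kappa>^2 * W u"
    unfolding B_product_deriv[OF u] gauss_curvature_def by (simp add: field_simps)
  finally show ?thesis by (simp add: mult.assoc)
qed

lemma plane_ricci_radial:
  assumes u: "u \<ge> 0"
  shows "u * (4 * conn_p1 u + 4 * conn_t u + 2 * u * conn_t1 u - 8 * (conn_p u)^2 - 2 * u * conn_p u * conn_t u) = gauss_curvature u * (u * B u)"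
proof -
  have t: "u * conn_t u = - 3 * conn_p u - conn_q u" "u * conn_t1 u = - 3 * conn_p1 u - conn_q1 u - conn_t u"
    using trace_free[OF u] trace_free1[OF u] by simp_all
  have pp: "conn_p1 u + (conn_p u)^2 = W2 u / W u"
    using W_nz[OF u] by (simp add: conn_p_def conn_p1_def power2_eq_square field_simps)
  have "u * (4 * conn_p1 u + 4 * conn_t u + 2 * u * conn_t1 u - 8 * (conn_p u)^2 - 2 * u * conn_p u * conn_t u)
     = 4 * u * conn_p1 u + 4 * (u * conn_t u) + 2 * u * (u * conn_t1 u) - 8 * u * (conn_p u)^2 - 2 * u * conn_p u * (u * conn_t u)"
    by (simp add: algebra_simps)
  also have "\<dots> = - 2 * u * conn_p1 u + 2 * (u * conn_t u) - 2 * u * conn_q1 u - 2 * u * (conn_p u)^2 + 2 * u * conn_p u * conn_q u"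
  proof -
    have q: "conn_q u = - 3 * conn_p u - u * conn_t u" using t(1) by simp
    show ?thesis unfolding t(2) unfolding q by (simp add: algebra_simps power2_eq_square)
  qed
  also have "\<dots> = - (2 * conn_p u + 2 * conn_q u + 2 * u * conn_q1 u - 2 * u * conn_p u * conn_q u) - 4 * conn_p u - 2 * u * (conn_p1 u + (conn_p u)^2)"
    unfolding t(1) by (simp add: algebra_simps)
  also have "\<dots> = - gauss_curvature u * \<kappa>^2 * W u + gauss_curvature u * (4 / W u)"
    unfolding plane_ricci_delta[OF u] pp unfolding conn_p_def gauss_curvature_def using W_nz[OF u] by (simp add: field_simps)
  also have "\<dots> = gauss_curvature u * (u * B u)"
    unfolding radial_coefficient[OF u] by (simp add: algebra_simps)
  finally show ?thesis .
qed

text \<open>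
  In terms of \<open>V = u * W u\<close> this is the classical formula \<open>- V'' - 2 m V' / r - m (m - 1) V / r\<^sup>2\<close>
  for a warped product.
\<close>

lemma scalar_curvature_polar_metric:
  fixes y :: "real^(2 + 'm::finite)"
  defines "u \<equiv> usq y" and "m \<equiv> real CARD('m)"
  shows "scalar_curvature polar_metric y =
     - (2 * W1 u + u * W2 u) - 2 * m * (W u + u * W1 u) / (rp + u) - m * (m - 1) * u * W u / (rp + u)^2"
proof -
  define x where "x = (\<lambda>a. y $ Inl a)"
  have u: "u = (x 1)^2 + (x 2)^2" "u \<ge> 0" by (simp_all add: u_def x_def usq_def)
  have r: "rp + u \<noteq> 0" using r_pos[of y] by (simp add: u_def)
  define A V where "A = \<kappa>^2 * W u" and "V = \<kappa>^2 * W u + u * B u"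
  have V: "4 / W u = V" "A * V = 4 * \<kappa>^2"
    using radial_coefficient[OF u(2)] plane_determinant[OF u(2)] by (simp_all add: V_def A_def mult.assoc)
  have k: "\<kappa>^2 \<noteq> 0" using \<kappa> by simp
  define p R where "p = 2 * conn_p u + 2 * conn_q u + 2 * u * conn_q1 u - 2 * u * conn_p u * conn_q u + m * (2 / (rp + u)) * (u * conn_q u - 1)"
    and "R = 4 * conn_p1 u + 4 * conn_t u + 2 * u * conn_t1 u - 8 * (conn_p u)^2 - 2 * u * conn_p u * conn_t u
        + m * (2 / (rp + u)) * (2 * conn_p u + u * conn_t u)"
  define Z where "Z = - W u * (rp + u) - u * (W1 u * (rp + u) + W u) - (m - 2) * u * W u"
  have plane: "(\<Sum>a\<in>UNIV. \<Sum>b\<in>UNIV. polar_cometric y $ Inl a $ Inl b * ricci polar_metric (Inl a) (Inl b) y)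
     = ((2 * A + u * B u) * p + A * (u * R)) / (4 * \<kappa>^2)"
  proof -
    have "(\<Sum>a\<in>UNIV. \<Sum>b\<in>UNIV. polar_cometric y $ Inl a $ Inl b * ricci polar_metric (Inl a) (Inl b) y)
      = (\<Sum>a\<in>UNIV. \<Sum>b\<in>UNIV. (kronecker a b * V - B u * x a * x b) * (kronecker a b * p + R * x a * x b)) / (4 * \<kappa>^2)"
      unfolding sum_divide_distrib
      by (intro sum.cong refl)
         (simp add: ricci_plane kronecker_def u_def x_def p_def R_def m_def flip: V(1))
    also have "(\<Sum>a\<in>UNIV. \<Sum>b\<in>UNIV. (kronecker a b * V - B u * x a * x b) * (kronecker a b * p + R * x a * x b))
      = V * (2 * p + ((x 1)^2 + (x 2)^2) * R) - B u * (((x 1)^2 + (x 2)^2) * p + ((x 1)^2 + (x 2)^2)^2 * R)"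
      by (simp add: sum_2 algebra_simps power2_eq_square)
    also have "\<dots> = (2 * A + u * B u) * p + A * (u * R)"
      unfolding u(1)[symmetric] V_def A_def by (simp add: algebra_simps power2_eq_square)
    finally show ?thesis .
  qed
  have t: "u * conn_t u = - 3 * conn_p u - conn_q u" using trace_free[OF u(2)] by simp
  have "(2 * A + u * B u) * p + A * (u * R) =
     (2 * A + u * B u) * (gauss_curvature u * A) + A * (gauss_curvature u * (u * B u))
     + m * (2 / (rp + u)) * ((2 * A + u * B u) * (u * conn_q u - 1) + A * (u * (2 * conn_p u + u * conn_t u)))"
  proof -
    have p: "p = gauss_curvature u * A + m * (2 / (rp + u)) * (u * conn_q u - 1)"
      unfolding p_def plane_ricci_delta[OF u(2)] A_def by (simp add: mult.assoc)
    have R: "u * R = gauss_curvature u * (u * B u) + m * (2 / (rp + u)) * (u * (2 * conn_p u + u * conn_t u))"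
      unfolding R_def distrib_left plane_ricci_radial[OF u(2)] by (simp add: mult_ac)
    define c where "c = m * (2 / (rp + u))"
    show ?thesis unfolding p R c_def[symmetric] by (simp add: algebra_simps)
  qed
  also have "(2 * A + u * B u) * (gauss_curvature u * A) + A * (gauss_curvature u * (u * B u)) = gauss_curvature u * (2 * (A * V))"
    unfolding A_def V_def by (simp add: algebra_simps)
  also have "(2 * A + u * B u) * (u * conn_q u - 1) + A * (u * (2 * conn_p u + u * conn_t u))
     = - 2 * \<kappa>^2 * (W u + u * W1 u)"
  proof -
    have q: "V * conn_q u = B u - \<kappa>^2 * W1 u" and p: "A * conn_p u = \<kappa>^2 * W1 u"
      using W_nz[OF u(2)] by (simp_all add: conn_q_def conn_p_def A_def flip: V(1))
    have "(2 * A + u * B u) * (u * conn_q u - 1) + A * (u * (2 * conn_p u + u * conn_t u))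
       = u * (V * conn_q u) - (2 * A + u * B u) - u * (A * conn_p u)"
      unfolding t by (simp add: V_def A_def algebra_simps)
    also have "\<dots> = - 2 * \<kappa>^2 * (W u + u * W1 u)"
      unfolding q p by (simp add: A_def algebra_simps)
    finally show ?thesis .
  qed
  finally have "((2 * A + u * B u) * p + A * (u * R)) / (4 * \<kappa>^2)
     = (gauss_curvature u * (2 * (4 * \<kappa>^2)) + m * (2 / (rp + u)) * (- 2 * \<kappa>^2 * (W u + u * W1 u))) / (4 * \<kappa>^2)"
    unfolding V(2) by simp
  also have "\<dots> = 2 * gauss_curvature u - m * (W u + u * W1 u) / (rp + u)"
  proof -
    have "(g * (2 * (4 * c)) + m * (2 / \<rho>) * (- 2 * c * w)) / (4 * c) = 2 * g - m * w / \<rho>"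
      if "c \<noteq> 0" for g c w \<rho> :: real
    proof -
      have "g * (2 * (4 * c)) + m * (2 / \<rho>) * (- 2 * c * w) = (2 * g - m * w / \<rho>) * (4 * c)"
        by (simp add: algebra_simps)
      then show ?thesis using that by simp
    qed
    then show ?thesis using k by blast
  qed
  finally have plane': "((2 * A + u * B u) * p + A * (u * R)) / (4 * \<kappa>^2)
     = 2 * gauss_curvature u - m * (W u + u * W1 u) / (rp + u)" .
  have torus: "(\<Sum>i\<in>(UNIV :: 'm set). \<Sum>j\<in>UNIV. polar_cometric y $ Inr i $ Inr j * ricci polar_metric (Inr i) (Inr j) y)
     = m * (Z / (rp + u)^2)"
  proof -
    have "(\<Sum>j\<in>UNIV. polar_cometric y $ Inr i $ Inr j * ricci polar_metric (Inr i) (Inr j) y) = Z / (rp + u)^2" for i :: 'm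
    proof -
      have "(\<Sum>j\<in>UNIV. polar_cometric y $ Inr i $ Inr j * ricci polar_metric (Inr i) (Inr j) y)
        = (\<Sum>j\<in>UNIV. if j = i then Z / (rp + u)^2 else 0)"
        by (rule sum.cong) (auto simp: ricci_torus u_def m_def Z_def)
      then show ?thesis by simp
    qed
    then show ?thesis by (simp add: m_def)
  qed
  have Z: "m * (Z / (rp + u)^2) = - m * (W u + u * W1 u) / (rp + u) - m * (m - 1) * u * W u / (rp + u)^2"
  proof -
    have "Z = - ((rp + u) * (W u + u * W1 u)) - (m - 1) * u * W u" by (simp add: Z_def algebra_simps)
    then have "Z / (rp + u)^2 = - ((rp + u) * (W u + u * W1 u)) / (rp + u)^2 - (m - 1) * u * W u / (rp + u)^2"
      by (simp add: diff_divide_distrib)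
    also have "- ((rp + u) * (W u + u * W1 u)) / (rp + u)^2 = - ((W u + u * W1 u) / (rp + u))"
      using r by (simp add: power2_eq_square)
    finally have z: "Z / (rp + u)^2 = - ((W u + u * W1 u) / (rp + u)) - (m - 1) * u * W u / (rp + u)^2" .
    show ?thesis unfolding z right_diff_distrib[of m "- ((W u + u * W1 u) / (rp + u))"]
      by (simp only: times_divide_eq_right mult_minus_left mult_minus_right mult.assoc minus_divide_left)
  qed
  have "scalar_curvature polar_metric y =
     (\<Sum>a\<in>UNIV. \<Sum>b\<in>UNIV. polar_cometric y $ Inl a $ Inl b * ricci polar_metric (Inl a) (Inl b) y)
     + (\<Sum>i\<in>(UNIV :: 'm set). \<Sum>j\<in>UNIV. polar_cometric y $ Inr i $ Inr j * ricci polar_metric (Inr i) (Inr j) y)"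
    unfolding scalar_curvature_def matrix_inv_polar_metric sum_plane_torus polar_cometric_nth(2,3) sum_2
    by simp
  then show ?thesis unfolding plane plane' torus Z by (simp add: gauss_curvature_def)
qed

end

lemma riemannian_metric_plane_torus:
  fixes P :: "'m::finite \<Rightarrow> real" and H :: "real^(2 + 'm) \<Rightarrow> real^(2 + 'm)^(2 + 'm)"
  assumes P: "\<forall>i. P i > 0" and smooth: "\<And>i j. smooth_on UNIV (\<lambda>y. H y $ i $ j)"
    and sym: "\<And>y. transpose (H y) = H y" and pos: "\<And>y v. v \<noteq> 0 \<Longrightarrow> v \<bullet> (H y *v v) > 0"
    and periodic: "\<And>y k. H (y + lattice_shift P k) = H y"
  shows "riemannian_metric (plane_torus_atlas P) (\<lambda>c. H)"
  unfolding riemannian_metric_def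
proof (intro conjI ballI allI impI)
  show "smooth_on (chart_image c) (\<lambda>y. H y $ i $ j)" for c :: "((real^2) \<times> (real^'m) set, 2 + 'm) chart" and i j
    using smooth Ck_on_subset unfolding smooth_on_def by blast
next
  fix c d y assume "c \<in> plane_torus_atlas P" "d \<in> plane_torus_atlas P" and y: "y \<in> chart_overlap c d"
  then obtain c' d' where cd: "c = plane_torus_chart P c'" "d = plane_torus_chart P d'"
    by (auto simp: plane_torus_atlas_def)
  obtain k where k: "y \<in> shift_overlap P c' d' k"
    using y unfolding cd plane_torus_overlap[OF P] by blast
  have "((\<lambda>y. y + lattice_shift P k) has_derivative (\<lambda>h. h)) (at y)"
    by (auto intro!: derivative_eq_intros)
  then have "(transition c d has_derivative (\<lambda>h. h)) (at y)"
    by (rule has_derivative_transform_within_open[OF _ open_shift_overlap k])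
       (simp add: cd plane_torus_transition[OF P])
  then have "frechet_derivative (transition c d) (at y) = id"
    by (simp add: frechet_derivative_at[symmetric] id_def)
  then have "jacobian (transition c d) (at y) = mat 1"
    by (simp add: jacobian_def matrix_id_mat_1)
  moreover have "H (transition c d y) = H y"
    unfolding cd plane_torus_transition[OF P k] by (rule periodic)
  ultimately show "H y = transpose (jacobian (transition c d) (at y))
                  ** H (transition c d y) ** jacobian (transition c d) (at y)"
    by (simp add: transpose_mat)
qed (use sym pos in auto)

context polar_plane
begin

lemma polar_metric_form:
  fixes y v :: "real^(2 + 'm::finite)"
  shows "v \<bullet> (polar_metric y *v v) =
    \<kappa>^2 * W (usq y) * ((v $ Inl 1)^2 + (v $ Inl 2)^2) + B (usq y) * (y $ Inl 1 * v $ Inl 1 + y $ Inl 2 * v $ Inl 2)^2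
    + (rp + usq y)^2 * (\<Sum>i\<in>UNIV. (v $ Inr i)^2)"
proof -
  have "(\<Sum>j\<in>UNIV. (if i = j then (rp + usq y)^2 else 0) * v $ Inr i * v $ Inr j) = (rp + usq y)^2 * (v $ Inr i)^2" for i :: 'm
  proof -
    have "(\<Sum>j\<in>UNIV. (if i = j then (rp + usq y)^2 else 0) * v $ Inr i * v $ Inr j)
       = (\<Sum>j\<in>UNIV. if j = i then (rp + usq y)^2 * (v $ Inr i)^2 else 0)"
      by (rule sum.cong) (auto simp: power2_eq_square)
    then show ?thesis by simp
  qed
  then show ?thesis
    unfolding quadratic_form_sum sum_plane_torus polar_metric_nth
    by (simp add: sum_distrib_left) (simp add: algebra_simps power2_eq_square)
qed

lemma cauchy_schwarz_plane:
  "(x * v + z * w)^2 \<le> (x^2 + z^2) * (v^2 + w^2)" for x z v w :: real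
proof -
  have "(x^2 + z^2) * (v^2 + w^2) - (x * v + z * w)^2 = (x * w - z * v)^2"
    by (simp add: algebra_simps power2_eq_square)
  then show ?thesis by (metis diff_ge_0_iff_ge zero_le_power2)
qed

text \<open>
  The assumptions bound all eigenvalues below by \<open>a\<close>. For \<open>B < 0\<close> the radial direction is the worst one, and
  the Cauchy-Schwarz inequality reduces to it.
\<close>

lemma polar_metric_lower_bound:
  fixes y v :: "real^(2 + 'm::finite)"
  assumes a: "a \<ge> 0" "a \<le> \<kappa>^2 * W (usq y)" "a \<le> 4 / W (usq y)" "a \<le> (rp + usq y)^2"
  shows "a * (v \<bullet> v) \<le> v \<bullet> (polar_metric y *v v)"
proof -
  define u s d where "u = usq y" and "s = (v $ Inl 1)^2 + (v $ Inl 2)^2"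
    and "d = y $ Inl 1 * v $ Inl 1 + y $ Inl 2 * v $ Inl 2"
  have s: "s \<ge> 0" and u: "u \<ge> 0" by (simp_all add: s_def u_def)
  have cs: "d^2 \<le> u * s" using cauchy_schwarz_plane by (simp add: d_def u_def usq_def s_def)
  have "a * s \<le> \<kappa>^2 * W u * s + B u * d^2"
  proof (cases "B u \<ge> 0")
    case True
    have "a * s \<le> \<kappa>^2 * W u * s" using a(2) s by (intro mult_right_mono) (simp_all add: u_def)
    then show ?thesis using True by (simp add: add_increasing2)
  next
    case False
    have "a * s \<le> (4 / W u) * s" using a(3) s by (intro mult_right_mono) (simp_all add: u_def)
    also have "\<dots> = \<kappa>^2 * W u * s + B u * (u * s)"
      unfolding radial_coefficient[OF u] by (simp add: algebra_simps)
    also have "\<dots> \<le> \<kappa>^2 * W u * s + B u * d^2"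
      using False cs by (intro add_left_mono mult_left_mono_neg) auto
    finally show ?thesis .
  qed
  moreover have "a * (\<Sum>i\<in>UNIV. (v $ Inr i)^2) \<le> (rp + u)^2 * (\<Sum>i\<in>UNIV. (v $ Inr i)^2)"
    using a(4) by (intro mult_right_mono) (simp_all add: u_def sum_nonneg)
  moreover have "v \<bullet> v = s + (\<Sum>i\<in>UNIV. (v $ Inr i)^2)"
    by (simp add: inner_vec_def sum_plane_torus s_def power2_eq_square)
  ultimately show ?thesis
    unfolding polar_metric_form by (simp add: s_def d_def u_def distrib_left)
qed

text \<open>
  The rate of change of \<open>u = \<bar>x\<bar>\<^sup>2\<close> along a curve with velocity \<open>v\<close> is \<open>2 (x \<bullet> v)\<close>; its square is at
  most \<open>V\<close> times the energy, since the norm of the gradient of \<open>u\<close> is \<open>sqrt V\<close>.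
\<close>

lemma polar_metric_radial_bound:
  fixes y v :: "real^(2 + 'm::finite)"
  shows "4 * (y $ Inl 1 * v $ Inl 1 + y $ Inl 2 * v $ Inl 2)^2 \<le> usq y * W (usq y) * (v \<bullet> (polar_metric y *v v))"
proof -
  define u s d where "u = usq y" and "s = (v $ Inl 1)^2 + (v $ Inl 2)^2"
    and "d = y $ Inl 1 * v $ Inl 1 + y $ Inl 2 * v $ Inl 2"
  have u: "u \<ge> 0" by (simp add: u_def)
  have cs: "d^2 \<le> u * s" using cauchy_schwarz_plane by (simp add: d_def u_def usq_def s_def)
  have uW: "u * W u \<ge> 0" using u W_pos[OF u] by simp
  have "4 * d^2 = W u * (\<kappa>^2 * W u + u * B u) * d^2" by (simp add: plane_determinant[OF u])
  also have "\<dots> = W u * \<kappa>^2 * W u * d^2 + u * W u * B u * d^2" by (simp add: algebra_simps)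
  also have "\<dots> \<le> W u * \<kappa>^2 * W u * (u * s) + u * W u * B u * d^2"
    using cs W_pos[OF u] by (intro add_right_mono mult_left_mono) auto
  also have "\<dots> = u * W u * (\<kappa>^2 * W u * s + B u * d^2)" by (simp add: algebra_simps)
  also have "\<dots> \<le> u * W u * (\<kappa>^2 * W u * s + B u * d^2 + (rp + u)^2 * (\<Sum>i\<in>UNIV. (v $ Inr i)^2))"
  proof (rule mult_left_mono[OF _ uW])
    have "(rp + u)^2 * (\<Sum>i\<in>UNIV. (v $ Inr i)^2) \<ge> 0" by (intro mult_nonneg_nonneg sum_nonneg) auto
    then show "\<kappa>^2 * W u * s + B u * d^2 \<le> \<kappa>^2 * W u * s + B u * d^2 + (rp + u)^2 * (\<Sum>i\<in>UNIV. (v $ Inr i)^2)"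
      by simp
  qed
  finally show ?thesis unfolding polar_metric_form by (simp add: u_def s_def d_def)
qed

lemma polar_metric_pos:
  fixes y v :: "real^(2 + 'm::finite)"
  assumes "v \<noteq> 0"
  shows "v \<bullet> (polar_metric y *v v) > 0"
proof -
  define a where "a = min (\<kappa>^2 * W (usq y)) (min (4 / W (usq y)) ((rp + usq y)^2))"
  have a: "a > 0" using W_pos[OF usq_nonneg[of y]] \<kappa> r_pos[of y] by (simp add: a_def)
  have "a * (v \<bullet> v) \<le> v \<bullet> (polar_metric y *v v)"
    using a by (intro polar_metric_lower_bound) (auto simp: a_def)
  moreover have "a * (v \<bullet> v) > 0" using a assms by simp
  ultimately show ?thesis by linarith
qed

lemma polar_metric_shift: "polar_metric (y + lattice_shift P k) = polar_metric y"
proof -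
  have c: "lattice_shift P k $ Inl a = 0" for a by (simp add: lattice_shift_def)
  then have "usq (y + lattice_shift P k) = usq y" by (simp add: usq_def c)
  then have "polar_metric (y + lattice_shift P k) $ i $ j = polar_metric y $ i $ j" for i j
    by (cases i; cases j) (simp_all add: polar_metric_nth c)
  then show ?thesis by (simp add: vec_eq_iff)
qed

lemma riemannian_polar_metric:
  assumes "\<forall>i. P i > 0"
  shows "riemannian_metric (plane_torus_atlas P) (\<lambda>c. polar_metric)"
  by (rule riemannian_metric_plane_torus[OF assms smooth_polar_metric _ polar_metric_pos polar_metric_shift])
     (simp add: transpose_def vec_eq_iff polar_metric_sym)

lemma continuous_on_W: "continuous_on {0..M} W"
  by (rule DERIV_continuous_on[of _ _ W1]) (auto intro: has_field_derivative_at_within derivs)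

lemma coefficients_bounded_below:
  assumes "M \<ge> 0"
  shows "\<exists>a>0. \<forall>u\<in>{0..M}. a \<le> \<kappa>^2 * W u \<and> a \<le> 4 / W u \<and> a \<le> (rp + u)^2"
proof -
  have ne: "{0..M} \<noteq> {}" using assms by simp
  obtain u1 where u1: "u1 \<in> {0..M}" "\<And>u. u \<in> {0..M} \<Longrightarrow> W u1 \<le> W u"
    using continuous_attains_inf[OF compact_Icc ne continuous_on_W] by blast
  obtain u2 where u2: "u2 \<in> {0..M}" "\<And>u. u \<in> {0..M} \<Longrightarrow> W u \<le> W u2"
    using continuous_attains_sup[OF compact_Icc ne continuous_on_W] by blast
  have pos: "W u1 > 0" "W u2 > 0" using u1 u2 W_pos by auto
  define a where "a = min (\<kappa>^2 * W u1) (min (4 / W u2) (rp^2))"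
  have "a > 0" using pos \<kappa> rp by (simp add: a_def)
  moreover have "a \<le> \<kappa>^2 * W u \<and> a \<le> 4 / W u \<and> a \<le> (rp + u)^2" if u: "u \<in> {0..M}" for u
  proof -
    have Wu: "W u > 0" using u W_pos by simp
    have "\<kappa>^2 * W u1 \<le> \<kappa>^2 * W u" using u1(2)[OF u] by (intro mult_left_mono) auto
    moreover have "4 / W u2 \<le> 4 / W u" using u2(2)[OF u] Wu by (intro divide_left_mono) (auto simp: pos)
    moreover have "rp^2 \<le> (rp + u)^2" using u rp by (intro power_mono) auto
    ultimately show ?thesis by (auto simp: a_def min_def)
  qed
  ultimately show ?thesis by blast
qed

text \<open>
  The radial speed of a curve of energy \<open>E\<close> is at most \<open>sqrt (V E)\<close>. Since \<open>V\<close> grows at most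
  quadratically, \<open>ln (1 + u)\<close> grows at most linearly in time, so in bounded time the curve stays
  over a compact part of the plane, where the energy controls the whole velocity.
\<close>

lemma flow_line_a_priori_bound:
  fixes z0 :: "(real^(2 + 'm::finite)) \<times> (real^(2 + 'm))"
  assumes growth: "\<And>u. u \<ge> 0 \<Longrightarrow> u * W u \<le> C * (1 + u)^2" and \<Theta>: "\<Theta> \<ge> 0"
  shows "\<exists>R. \<forall>\<tau> z. 0 \<le> \<tau> \<longrightarrow> \<tau> \<le> \<Theta> \<longrightarrow> z 0 = z0 \<longrightarrow>
        (\<forall>t\<in>{-\<tau>..\<tau>}. (z has_vector_derivative geodesic_field polar_metric (z t)) (at t within {-\<tau>..\<tau>})) \<longrightarrow>
        (\<forall>t\<in>{-\<tau>..\<tau>}. norm (z t) < R)"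
proof -
  define E where "E = snd z0 \<bullet> (polar_metric (fst z0) *v snd z0)"
  have E: "E \<ge> 0"
    using polar_metric_pos[of "snd z0" "fst z0"] by (cases "snd z0 = 0") (simp_all add: E_def)
  have C: "C \<ge> 0" using growth[of 1] W_pos[of 1] by simp
  define K where "K = sqrt (C * E)"
  have K: "K \<ge> 0" "K^2 = C * E" using C E by (simp_all add: K_def)
  define M where "M = exp (ln (1 + usq (fst z0)) + K * \<Theta>)"
  have "M \<ge> 0" by (simp add: M_def)
  then obtain a where a: "a > 0" "\<And>u. u \<in> {0..M} \<Longrightarrow> a \<le> \<kappa>^2 * W u \<and> a \<le> 4 / W u \<and> a \<le> (rp + u)^2"
    using coefficients_bounded_below by blast
  define S where "S = sqrt (E / a)"
  have S: "S \<ge> 0" using E a(1) by (simp add: S_def)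
  show ?thesis
  proof (intro exI[of _ "norm (fst z0) + S * \<Theta> + S + 1"] allI impI ballI)
    fix \<tau> z t
    assume \<tau>: "0 \<le> \<tau>" "\<tau> \<le> \<Theta>" and z0: "z 0 = z0" and t: "t \<in> {-\<tau>..\<tau>}"
      and z: "\<forall>t\<in>{-\<tau>..\<tau>}. (z has_vector_derivative geodesic_field polar_metric (z t)) (at t within {-\<tau>..\<tau>})"
    define I where "I = {-\<tau>..\<tau>}"
    have I: "convex I" "0 \<in> I" using \<tau> by (simp_all add: I_def)
    define x v where "x = (\<lambda>t. fst (z t))" and "v = (\<lambda>t. snd (z t))"
    have xv: "(x has_vector_derivative v s) (at s within I)" if "s \<in> I" for s
      using flow_components(1)[OF bspec[OF z]] that by (simp add: I_def x_def v_def)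
    have en: "((\<lambda>t. v t \<bullet> (polar_metric (x t) *v v t)) has_real_derivative 0) (at s within I)" if "s \<in> I" for s
      unfolding quadratic_form_sum x_def v_def
      using that z unfolding I_def
      by (intro energy_constant smooth_on_UNIV_differentiable smooth_polar_metric polar_metric_sym invertible_polar_metric) auto
    have energy: "v s \<bullet> (polar_metric (x s) *v v s) = E" if s: "s \<in> I" for s
    proof -
      obtain c where c: "\<And>s. s \<in> I \<Longrightarrow> v s \<bullet> (polar_metric (x s) *v v s) = c"
        using has_field_derivative_zero_constant[OF I(1) en] by blast
      show ?thesis using c[OF s] c[OF I(2)] by (simp add: E_def x_def v_def z0)
    qed
    define d where "d s = x s $ Inl 1 * v s $ Inl 1 + x s $ Inl 2 * v s $ Inl 2" for s
    have "((\<lambda>s. ln (1 + usq (x s))) has_real_derivative 2 * d s / (1 + usq (x s))) (at s within I)" if s: "s \<in> I" for s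
    proof -
      have "((\<lambda>s. usq (x s)) has_derivative (\<lambda>h. 2 * x s $ Inl 1 * (h *\<^sub>R v s) $ Inl 1 + 2 * x s $ Inl 2 * (h *\<^sub>R v s) $ Inl 2)) (at s within I)"
        by (rule has_derivative_compose[OF xv[OF s, unfolded has_vector_derivative_def] usq_has_derivative])
      then have "((\<lambda>s. usq (x s)) has_real_derivative 2 * d s) (at s within I)"
        unfolding has_field_derivative_def
        by (rule has_derivative_eq_rhs) (simp add: fun_eq_iff d_def algebra_simps)
      moreover have "1 + usq (x s) > 0" using usq_nonneg[of "x s"] by linarith
      ultimately show ?thesis by (auto intro!: derivative_eq_intros)
    qed
    moreover have "norm (2 * d s / (1 + usq (x s))) \<le> K" if s: "s \<in> I" for s
    proof -
      have pos: "1 + usq (x s) > 0" using usq_nonneg[of "x s"] by linarith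
      have "(2 * d s)^2 \<le> usq (x s) * W (usq (x s)) * E"
        using polar_metric_radial_bound[of "x s" "v s"] unfolding energy[OF s] d_def[symmetric] by (simp add: power_mult_distrib)
      also have "\<dots> \<le> C * (1 + usq (x s))^2 * E"
        using growth[OF usq_nonneg] E by (rule mult_right_mono)
      also have "\<dots> = (K * (1 + usq (x s)))^2" using K(2) by (simp add: power_mult_distrib)
      finally have "\<bar>2 * d s\<bar> \<le> K * (1 + usq (x s))"
        using power2_le_imp_le[of "\<bar>2 * d s\<bar>" "K * (1 + usq (x s))"] K(1) pos by simp
      then show ?thesis unfolding real_norm_def abs_divide abs_of_pos[OF pos] pos_divide_le_eq[OF pos] .
    qed
    ultimately have ln: "norm (ln (1 + usq (x s)) - ln (1 + usq (x 0))) \<le> K * norm (s - 0)" if "s \<in> I" for s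
      using field_differentiable_bound[OF I(1) _ _ that I(2), where f = "\<lambda>s. ln (1 + usq (x s))"
          and f' = "\<lambda>s. 2 * d s / (1 + usq (x s))" and B = K] by blast
    have u: "usq (x s) \<in> {0..M}" if s: "s \<in> I" for s
    proof -
      have "K * \<bar>s\<bar> \<le> K * \<Theta>" using s \<tau> K(1) by (intro mult_left_mono) (auto simp: I_def)
      then have "ln (1 + usq (x s)) \<le> ln (1 + usq (fst z0)) + K * \<Theta>"
        using ln[OF s] z0 by (simp add: x_def abs_le_iff)
      then have "1 + usq (x s) \<le> M"
        unfolding M_def using usq_nonneg[of "x s"] by (metis add_pos_nonneg exp_le_cancel_iff exp_ln zero_less_one)
      then show ?thesis by simp
    qed
    have speed: "norm (v s) \<le> S" if s: "s \<in> I" for s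
    proof -
      have "a * (v s \<bullet> v s) \<le> E"
        using polar_metric_lower_bound[of a "x s" "v s"] a u[OF s] energy[OF s] by auto
      then have "(norm (v s))^2 \<le> E / a" using a(1) by (simp add: power2_norm_eq_inner field_simps)
      then show ?thesis unfolding S_def by (rule real_le_rsqrt)
    qed
    have "norm (x t - x 0) \<le> S * norm (t - 0)"
    proof (rule differentiable_bound[OF I(1)])
      show "(x has_derivative (\<lambda>h. h *\<^sub>R v s)) (at s within I)" if "s \<in> I" for s
        using xv[OF that] by (simp add: has_vector_derivative_def)
      show "onorm (\<lambda>h. h *\<^sub>R v s) \<le> S" if "s \<in> I" for s
        using mult_left_mono[OF speed[OF that] abs_ge_zero]
        by (intro onorm_le) (simp add: mult.commute)
    qed (use t I in \<open>auto simp: I_def\<close>)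
    also have "\<dots> \<le> S * \<Theta>" using S t \<tau> by (intro mult_left_mono) auto
    finally have "norm (x t) \<le> norm (fst z0) + S * \<Theta>"
      using norm_triangle_ineq2[of "x t" "x 0"] z0 by (simp add: x_def)
    moreover have "norm (v t) \<le> S" using speed t by (simp add: I_def)
    moreover have "norm (z t) \<le> norm (x t) + norm (v t)"
      using norm_Pair_le[of "x t" "v t"] by (simp add: x_def v_def)
    ultimately show "norm (z t) < norm (fst z0) + S * \<Theta> + S + 1" by linarith
  qed
qed

lemma geodesically_complete_polar_metric:
  fixes P :: "'m::finite \<Rightarrow> real"
  assumes P: "\<forall>i. P i > 0" and growth: "\<And>u. u \<ge> 0 \<Longrightarrow> u * W u \<le> C * (1 + u)^2"
  shows "geodesically_complete (plane_torus_atlas P) (\<lambda>c. polar_metric)"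
proof (rule geodesically_complete_plane_torus[OF P polar_metric_shift])
  show lip: "lipschitz_on_balls (geodesic_field (polar_metric :: real^(2 + 'm) \<Rightarrow> _))"
    by (rule lipschitz_geodesic_field[OF Ck_on_christoffel])
  show "\<exists>z. z 0 = z0 \<and> geodesic_flow_line polar_metric z" for z0 :: "(real^(2 + 'm)) \<times> (real^(2 + 'm))"
    unfolding geodesic_flow_line_def
    by (rule ode_global_solution[OF lip]) (rule flow_line_a_priori_bound[OF growth])
qed

text \<open>
  The scalar curvature is \<open>- (r\<^sup>m V)'' / r\<^sup>m\<close>, so the terms \<open>a * r - b\<close> do not contribute.
\<close>

lemma polar_metric_scalar_curvature_constant:
  fixes y :: "real^(2 + 'm::finite)"
  assumes V: "\<And>u. u \<ge> 0 \<Longrightarrow> (rp + u)^CARD('m) * (u * W u) = c * ((rp + u)^(CARD('m) + 2) + a * (rp + u) - b)"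
  shows "scalar_curvature polar_metric y = - (real CARD('m) + 1) * (real CARD('m) + 2) * c"
proof -
  obtain k where k: "CARD('m) = Suc k" by (metis finite_UNIV_card_ge_0 finite_code gr0_implies_Suc)
  define m where "m = real (Suc k)"
  define f f1 f2 where "f = (\<lambda>u. u * W u)" and "f1 = (\<lambda>u. W u + u * W1 u)" and "f2 = (\<lambda>u. 2 * W1 u + u * W2 u)"
  have df: "(f has_real_derivative f1 u) (at u)" "(f1 has_real_derivative f2 u) (at u)" if "u \<ge> 0" for u
    unfolding f_def f1_def f2_def by (auto intro!: derivative_eq_intros derivs that)
  have pow: "((\<lambda>u. (rp + u)^j) has_real_derivative real j * (rp + u)^(j - 1)) (at u)" for j u
    by (auto intro!: derivative_eq_intros)
  have 1: "m * (rp + u)^k * f u + (rp + u)^Suc k * f1 u = c * ((m + 2) * (rp + u)^(k + 2) + a)" if u: "u \<ge> 0" for u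
  proof -
    have "((\<lambda>u. (rp + u)^Suc k * f u - c * ((rp + u)^(k + 3) + a * (rp + u) - b)) has_real_derivative
       m * (rp + u)^k * f u + (rp + u)^Suc k * f1 u - c * ((m + 2) * (rp + u)^(k + 2) + a)) (at u)"
      by (rule derivative_eq_intros pow df[OF u] refl | simp add: m_def algebra_simps eval_nat_numeral)+
    moreover have "(rp + v)^Suc k * f v - c * ((rp + v)^(k + 3) + a * (rp + v) - b) = 0" if "v \<ge> u" for v
      using V[of v] that u unfolding k f_def by (simp add: eval_nat_numeral)
    ultimately show ?thesis using zero_derivative_on_halfline by fastforce
  qed
  define u where "u = usq y"
  have u: "u \<ge> 0" by (simp add: u_def)
  have 2: "m * (real k * (rp + u)^(k - 1) * f u) + 2 * m * (rp + u)^k * f1 u + (rp + u)^Suc k * f2 u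
     = c * ((m + 2) * ((m + 1) * (rp + u)^Suc k))"
  proof -
    have "((\<lambda>u. m * ((rp + u)^k * f u) + (rp + u)^Suc k * f1 u - c * ((m + 2) * (rp + u)^(k + 2) + a)) has_real_derivative
      m * (real k * (rp + u)^(k - 1) * f u + f1 u * (rp + u)^k) + (real (Suc k) * (rp + u)^(Suc k - 1) * f1 u + f2 u * (rp + u)^Suc k)
        - c * ((m + 2) * (real (k + 2) * (rp + u)^(k + 2 - 1)) + 0)) (at u)"
      by (intro DERIV_diff DERIV_add DERIV_cmult DERIV_mult pow df[OF u] DERIV_const)
    from zero_derivative_on_halfline[OF this] show ?thesis
      using 1 u by (simp add: m_def mult.assoc algebra_simps)
  qed
  define r where "r = rp + u"
  have r: "r > 0" using r_pos[of y] by (simp add: r_def u_def)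
  \<comment> \<open>The factor \<open>r\<^sup>2\<close> covers the case \<open>k = 0\<close>, in which \<open>k - 1\<close> is not the exponent of the derivative.\<close>
  have rk: "r^2 * (real k * r^(k - 1)) = real k * r * r^k"
    by (cases k) (simp_all add: power2_eq_square)
  have "r^k * r^3 * (f2 u + 2 * m * f1 u / r + m * (m - 1) * f u / r^2)
     = r^2 * (m * (real k * r^(k - 1) * f u) + 2 * m * r^k * f1 u + r^Suc k * f2 u)"
  proof -
    have "r^2 * (m * (real k * r^(k - 1) * f u) + 2 * m * r^k * f1 u + r^Suc k * f2 u)
      = m * f u * (r^2 * (real k * r^(k - 1))) + r^2 * (2 * m * r^k * f1 u + r^Suc k * f2 u)"
      by (simp add: algebra_simps)
    also have "\<dots> = r^k * r^3 * (f2 u + 2 * m * f1 u / r + m * (m - 1) * f u / r^2)"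
      unfolding rk using r by (simp add: m_def field_simps power2_eq_square power3_eq_cube)
    finally show ?thesis by simp
  qed
  also have "\<dots> = r^k * r^3 * ((m + 1) * (m + 2) * c)"
    using 2 by (simp add: r_def[symmetric] power2_eq_square power3_eq_cube algebra_simps)
  finally have "f2 u + 2 * m * f1 u / r + m * (m - 1) * f u / r^2 = (m + 1) * (m + 2) * c"
    using r by simp
  then show ?thesis
    unfolding scalar_curvature_polar_metric k
    by (simp add: f_def f1_def f2_def r_def u_def m_def[symmetric] del: of_nat_Suc) (simp add: algebra_simps)
qed

end

section \<open>Polar coordinates around the axis\<close>

lemma iterated_deriv_sqrt_shift:
  "\<exists>c. \<forall>r>p. (deriv ^^ k) (\<lambda>r. sqrt (r - p)) r = c * (r - p) powr (1 / 2 - real k)"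
proof (induction k)
  case 0
  then show ?case by (intro exI[of _ 1]) (auto simp: powr_half_sqrt)
next
  case (Suc k)
  then obtain c where c: "\<And>r. r > p \<Longrightarrow> (deriv ^^ k) (\<lambda>r. sqrt (r - p)) r = c * (r - p) powr (1 / 2 - real k)"
    by blast
  have "(deriv ^^ Suc k) (\<lambda>r. sqrt (r - p)) r = c * (1 / 2 - real k) * (r - p) powr (1 / 2 - real (Suc k))" if r: "r > p" for r
  proof -
    have "((\<lambda>r. c * (r - p) powr (1 / 2 - real k)) has_field_derivative
        c * ((1 / 2 - real k) * (r - p) powr (1 / 2 - real k - 1))) (at r)"
      using r by (auto intro!: derivative_eq_intros)
    then have "((deriv ^^ k) (\<lambda>r. sqrt (r - p)) has_field_derivative
        c * ((1 / 2 - real k) * (r - p) powr (1 / 2 - real k - 1))) (at r)"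
      by (rule has_field_derivative_transform_within_open[where S = "{p<..}"]) (use r c in auto)
    from DERIV_imp_deriv[OF this] show ?thesis by (simp add: algebra_simps)
  qed
  then show ?case by blast
qed

text \<open>
  The square root makes \<open>r - r\<^sub>+\<close> the squared distance from the origin, hence a smooth function on the plane.
\<close>

lemma polar_radius_sqrt: "polar_radius rp (\<lambda>r. sqrt (r - rp))"
  unfolding polar_radius_def
proof (intro conjI allI impI)
  show "bij_betw (\<lambda>r. sqrt (r - rp)) {rp<..} {0<..}"
    by (rule bij_betw_byWitness[where f' = "\<lambda>s. rp + s^2"]) auto
  fix r assume r: "r > rp"
  show "deriv (\<lambda>r. sqrt (r - rp)) r > 0"
  proof -
    have "((\<lambda>r. sqrt (r - rp)) has_field_derivative 1 / (2 * sqrt (r - rp))) (at r)"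
      using r by (auto intro!: derivative_eq_intros simp: field_simps)
    then show ?thesis using r by (simp add: DERIV_imp_deriv)
  qed
  fix k
  obtain c where c: "\<And>r. r > rp \<Longrightarrow> (deriv ^^ k) (\<lambda>r. sqrt (r - rp)) r = c * (r - rp) powr (1 / 2 - real k)"
    using iterated_deriv_sqrt_shift by blast
  have "((\<lambda>r. c * (r - rp) powr (1 / 2 - real k)) has_field_derivative
        c * ((1 / 2 - real k) * (r - rp) powr (1 / 2 - real k - 1))) (at r)"
    using r by (auto intro!: derivative_eq_intros)
  then have "((deriv ^^ k) (\<lambda>r. sqrt (r - rp)) has_field_derivative
        c * ((1 / 2 - real k) * (r - rp) powr (1 / 2 - real k - 1))) (at r)"
    by (rule has_field_derivative_transform_within_open[where S = "{rp<..}"]) (use r c in auto)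
  then show "(deriv ^^ k) (\<lambda>r. sqrt (r - rp)) field_differentiable (at r)"
    unfolding field_differentiable_def by blast
qed

lemma has_derivative_vecI:
  fixes f :: "'a::real_normed_vector \<Rightarrow> real^'n::finite"
  assumes "\<And>k. ((\<lambda>x. f x $ k) has_derivative (\<lambda>h. f' h $ k)) (at a within S)"
  shows "(f has_derivative f') (at a within S)"
  unfolding has_derivative_componentwise_within[of f]
  using assms by (auto simp: Basis_vec_def cart_eq_inner_axis)

text \<open>The polar map lifted to the universal covering of the product of the plane and the torus.\<close>

definition polar_lift :: "real \<Rightarrow> real \<Rightarrow> real^(2 + 'm::finite) \<Rightarrow> real^(2 + 'm)" where
  "polar_lift rp \<kappa> y = (\<chi> k. case k of
      Inl a \<Rightarrow> sqrt (y $ Inl 1 - rp) * (if a = 1 then cos (y $ Inl 2 / \<kappa>) else sin (y $ Inl 2 / \<kappa>))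
    | Inr i \<Rightarrow> y $ Inr i)"

lemma polar_map_eq_proj_lift:
  assumes "\<beta> = 2 * pi * \<kappa>"
  shows "polar_map \<beta> P (\<lambda>r. sqrt (r - rp)) y = plane_torus_proj P (polar_lift rp \<kappa> y)"
proof -
  have "2 * pi * y $ Inl 2 / \<beta> = y $ Inl 2 / \<kappa>" using assms by simp
  then show ?thesis
    unfolding polar_map_def plane_torus_proj_def
    by (simp add: plane_part_def torus_part_def polar_lift_def vec_eq_iff forall_2)
qed

definition polar_jacobian :: "real \<Rightarrow> real \<Rightarrow> real^(2 + 'm::finite) \<Rightarrow> real^(2 + 'm)^(2 + 'm)" where
  "polar_jacobian rp \<kappa> y = (\<chi> k j. case k of
      Inl a \<Rightarrow> (case j of
          Inl b \<Rightarrow> if b = 1 then (if a = 1 then cos (y $ Inl 2 / \<kappa>) else sin (y $ Inl 2 / \<kappa>)) / (2 * sqrt (y $ Inl 1 - rp))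
                   else sqrt (y $ Inl 1 - rp) / \<kappa> * (if a = 1 then - sin (y $ Inl 2 / \<kappa>) else cos (y $ Inl 2 / \<kappa>))
        | Inr _ \<Rightarrow> 0)
    | Inr i \<Rightarrow> (if j = Inr i then 1 else 0))"

lemma polar_lift_has_derivative:
  assumes r: "y $ Inl 1 > rp" and \<kappa>: "\<kappa> \<noteq> 0"
  shows "(polar_lift rp \<kappa> has_derivative (\<lambda>h. polar_jacobian rp \<kappa> y *v h)) (at y)"
proof (rule has_derivative_vecI)
  fix k :: "2 + 'a"
  define s where "s = sqrt (y $ Inl 1 - rp)"
  have s: "s > 0" using r by (simp add: s_def)
  have 1: "((\<lambda>y. sqrt (y $ Inl 1 - rp)) has_derivative (\<lambda>h. 1 / (2 * s) * h $ Inl 1)) (at y)"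
  proof -
    have "(sqrt has_derivative (*) (1 / (2 * s))) (at (y $ Inl 1 - rp))"
      using DERIV_real_sqrt[of "y $ Inl 1 - rp"] r by (simp add: has_field_derivative_def s_def field_simps)
    moreover have "((\<lambda>y. y $ Inl 1 - rp) has_derivative (\<lambda>h. h $ Inl 1)) (at y)"
      by (auto intro!: derivative_eq_intros component_has_derivative)
    ultimately show ?thesis by (rule has_derivative_compose[rotated])
  qed
  have 2: "((\<lambda>y. y $ Inl 2 / \<kappa>) has_derivative (\<lambda>h. h $ Inl 2 / \<kappa>)) (at y)"
    unfolding divide_inverse by (intro has_derivative_mult_left component_has_derivative)
  have 3: "((\<lambda>y. cos (y $ Inl 2 / \<kappa>)) has_derivative (\<lambda>h. - sin (y $ Inl 2 / \<kappa>) * (h $ Inl 2 / \<kappa>))) (at y)"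
    "((\<lambda>y. sin (y $ Inl 2 / \<kappa>)) has_derivative (\<lambda>h. cos (y $ Inl 2 / \<kappa>) * (h $ Inl 2 / \<kappa>))) (at y)"
    using has_derivative_compose[OF 2 DERIV_cos[unfolded has_field_derivative_def]]
      has_derivative_compose[OF 2 DERIV_sin[unfolded has_field_derivative_def]] by simp_all
  show "((\<lambda>x. polar_lift rp \<kappa> x $ k) has_derivative (\<lambda>h. (polar_jacobian rp \<kappa> y *v h) $ k)) (at y)"
  proof (cases k)
    case k: (Inl a)
    have J: "(polar_jacobian rp \<kappa> y *v h) $ Inl a =
       s * ((if a = 1 then - sin (y $ Inl 2 / \<kappa>) else cos (y $ Inl 2 / \<kappa>)) * (h $ Inl 2 / \<kappa>))
       + 1 / (2 * s) * h $ Inl 1 * (if a = 1 then cos (y $ Inl 2 / \<kappa>) else sin (y $ Inl 2 / \<kappa>))" for h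
      by (simp add: matrix_vector_mult_def sum_plane_torus polar_jacobian_def s_def[symmetric] mult_ac)
    show ?thesis
      using has_derivative_mult[OF 1 3(1)] has_derivative_mult[OF 1 3(2)]
      unfolding k J by (auto simp: polar_lift_def s_def)
  next
    case k: (Inr i)
    have "(polar_jacobian rp \<kappa> y *v h) $ Inr i = h $ Inr i" for h
    proof -
      have "(\<Sum>j\<in>UNIV. (if Inr j = (Inr i :: 2 + 'a) then 1 else 0) * h $ Inr j) = (\<Sum>j\<in>UNIV. if j = i then h $ Inr j else 0)"
        by (rule sum.cong) auto
      then show ?thesis by (simp add: matrix_vector_mult_def sum_plane_torus polar_jacobian_def)
    qed
    then show ?thesis using component_has_derivative unfolding k by (simp add: polar_lift_def)
  qed
qed

lemma congruence_nth:
  fixes A J :: "real^'n::finite^'n"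
  shows "(transpose J ** A ** J) $ i $ j = (\<Sum>k\<in>UNIV. \<Sum>l\<in>UNIV. J $ k $ i * A $ k $ l * J $ l $ j)"
proof -
  have "(transpose J ** A ** J) $ i $ j = (\<Sum>l\<in>UNIV. \<Sum>k\<in>UNIV. J $ k $ i * A $ k $ l * J $ l $ j)"
    by (simp add: matrix_matrix_mult_def transpose_def sum_distrib_right)
  then show ?thesis by (subst sum.swap) simp
qed

context polar_plane
begin

lemma usq_polar_lift: "y $ Inl 1 > rp \<Longrightarrow> usq (polar_lift rp \<kappa> y) = y $ Inl 1 - rp"
  by (simp add: usq_def polar_lift_def power_mult_distrib flip: distrib_left)

text \<open>
  The columns of the Jacobian are radial of length \<open>1 / (2 * sqrt u)\<close> and tangential of length
  \<open>sqrt u / \<kappa>\<close>, so the plane eigenvalues \<open>4 / W\<close> and \<open>\<kappa>\<^sup>2 W\<close> pull back to \<open>1 / (u W) = 1 / V\<close> and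
  \<open>u W = V\<close>.
\<close>

lemma pullback_polar_lift:
  fixes y :: "real^(2 + 'm::finite)"
  assumes r: "y $ Inl 1 > rp" and V: "\<And>u. u > 0 \<Longrightarrow> V (rp + u) = u * W u"
  shows "transpose (polar_jacobian rp \<kappa> y) ** polar_metric (polar_lift rp \<kappa> y) ** polar_jacobian rp \<kappa> y = warped_metric V y"
proof -
  define s u c d where "s = sqrt (y $ Inl 1 - rp)" and "u = y $ Inl 1 - rp"
    and "c = cos (y $ Inl 2 / \<kappa>)" and "d = sin (y $ Inl 2 / \<kappa>)"
  have s: "s > 0" "s * s = u" and u: "u > 0" using r by (simp_all add: s_def u_def)
  have cd: "c * c + d * d = 1" by (simp add: c_def d_def flip: power2_eq_square)
  have VW: "V (y $ Inl 1) = u * W u" using V[OF u] by (simp add: u_def)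
  have W: "W u \<noteq> 0" using W_nz u by simp
  define J where "J = polar_jacobian rp \<kappa> y"
  define H where "H = polar_metric (polar_lift rp \<kappa> y)"
  have J: "J $ Inl 1 $ Inl 1 = c / (2 * s)" "J $ Inl 2 $ Inl 1 = d / (2 * s)"
    "J $ Inl 1 $ Inl 2 = - (s * d / \<kappa>)" "J $ Inl 2 $ Inl 2 = s * c / \<kappa>"
    "J $ Inl a $ Inr j = 0" "J $ Inr i $ Inl b = 0" "J $ Inr i $ Inr j = (if i = j then 1 else 0)" for a b i j
    by (auto simp: J_def polar_jacobian_def s_def c_def d_def)
  have H: "H $ Inl 1 $ Inl 1 = \<kappa>^2 * W u + B u * (s * c) * (s * c)" "H $ Inl 2 $ Inl 2 = \<kappa>^2 * W u + B u * (s * d) * (s * d)"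
    "H $ Inl 1 $ Inl 2 = B u * (s * c) * (s * d)" "H $ Inl 2 $ Inl 1 = B u * (s * d) * (s * c)"
    "H $ Inl a $ Inr j = 0" "H $ Inr i $ Inl b = 0" "H $ Inr i $ Inr j = (if i = j then (y $ Inl 1)^2 else 0)" for a b i j
    using usq_polar_lift[OF r]
    by (simp_all add: H_def polar_metric_nth u_def) (simp_all add: polar_lift_def s_def c_def d_def)
  have "(transpose J ** H ** J) $ i $ j = warped_metric V y $ i $ j" for i j
  proof (cases i)
    case i: (Inl a)
    show ?thesis
    proof (cases j)
      case j: (Inl b)
      have 11: "(transpose J ** H ** J) $ Inl 1 $ Inl 1 = 1 / V (y $ Inl 1)"
      proof -
        have "(transpose J ** H ** J) $ Inl 1 $ Inl 1
          = (\<kappa>^2 * W u * (c * c + d * d) + B u * (s * s) * (c * c + d * d) * (c * c + d * d)) / (4 * (s * s))"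
          using s(1) unfolding congruence_nth sum_plane_torus J H by (simp add: field_simps)
        also have "\<dots> = (4 / W u) / (4 * u)" unfolding cd s(2) radial_coefficient[OF less_imp_le[OF u]] by (simp add: mult.commute)
        finally show ?thesis by (simp add: VW)
      qed
      have 22: "(transpose J ** H ** J) $ Inl 2 $ Inl 2 = V (y $ Inl 1)"
      proof -
        have "(transpose J ** H ** J) $ Inl 2 $ Inl 2 = s * s * (\<kappa>^2 * W u * (c * c + d * d)) / \<kappa>^2"
          using \<kappa> unfolding congruence_nth sum_plane_torus J H by (simp add: field_simps power2_eq_square)
        then show ?thesis unfolding cd s(2) VW using \<kappa> by simp
      qed
      have 12: "(transpose J ** H ** J) $ Inl 1 $ Inl 2 = 0" "(transpose J ** H ** J) $ Inl 2 $ Inl 1 = 0"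
        using s(1) \<kappa> unfolding congruence_nth sum_plane_torus J H by (simp_all add: field_simps)
      show ?thesis
        using exhaust_2[of a] exhaust_2[of b] 11 22 12 by (auto simp: i j warped_metric_def)
    next
      case j: (Inr j')
      show ?thesis unfolding i j congruence_nth sum_plane_torus J H by (simp add: warped_metric_def)
    qed
  next
    case i: (Inr i')
    show ?thesis
    proof (cases j)
      case j: (Inl b)
      show ?thesis unfolding i j congruence_nth sum_plane_torus J H by (simp add: warped_metric_def)
    next
      case j: (Inr j')
      have "(\<Sum>k\<in>UNIV. \<Sum>l\<in>UNIV. J $ Inr k $ Inr i' * H $ Inr k $ Inr l * J $ Inr l $ Inr j')
        = (\<Sum>k\<in>UNIV. if k = i' then (if i' = j' then (y $ Inl 1)^2 else 0) else 0)"
      proof (rule sum.cong[OF refl])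
        fix k
        have "(\<Sum>l\<in>UNIV. J $ Inr k $ Inr i' * H $ Inr k $ Inr l * J $ Inr l $ Inr j')
          = (\<Sum>l\<in>UNIV. if l = j' then (if k = i' \<and> i' = j' then (y $ Inl 1)^2 else 0) else 0)"
          unfolding J H by (rule sum.cong) auto
        then show "(\<Sum>l\<in>UNIV. J $ Inr k $ Inr i' * H $ Inr k $ Inr l * J $ Inr l $ Inr j')
          = (if k = i' then (if i' = j' then (y $ Inl 1)^2 else 0) else 0)" by simp
      qed
      then have e: "(\<Sum>k\<in>UNIV. \<Sum>l\<in>UNIV. J $ Inr k $ Inr i' * H $ Inr k $ Inr l * J $ Inr l $ Inr j')
        = (if i' = j' then (y $ Inl 1)^2 else 0)" by simp
      have "(transpose J ** H ** J) $ i $ j = (if i' = j' then (y $ Inl 1)^2 else 0)"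
        unfolding i j congruence_nth sum_plane_torus by (simp add: J(5,6) e split del: if_split)
      then show ?thesis by (auto simp: i j warped_metric_def)
    qed
  qed
  then show ?thesis by (simp add: vec_eq_iff J_def H_def)
qed

lemma polar_metric_extends_warped_metric:
  fixes P :: "'m::finite \<Rightarrow> real"
  assumes P: "\<forall>i. P i > 0" and \<beta>: "\<beta> = 2 * pi * \<kappa>" and V: "\<And>u. u > 0 \<Longrightarrow> V (rp + u) = u * W u"
  shows "extends_across_axis rp \<beta> P (warped_metric V) (\<lambda>c. polar_metric)"
  unfolding extends_across_axis_def
proof (intro conjI exI)
  show "riemannian_metric (plane_torus_atlas P) (\<lambda>c. polar_metric)" by (rule riemannian_polar_metric[OF P])
  show "polar_radius rp (\<lambda>r. sqrt (r - rp))" by (rule polar_radius_sqrt)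
  show "pullback_metric_on (plane_torus_atlas P) (\<lambda>c. polar_metric) {y. rp < y $ Inl 1}
      (polar_map \<beta> P (\<lambda>r. sqrt (r - rp))) (warped_metric V)"
    unfolding pullback_metric_on_def
  proof (intro conjI ballI impI)
    fix y :: "real^(2 + 'm)" assume "y \<in> {y. rp < y $ Inl 1}"
    define x where "x = polar_lift rp \<kappa> y"
    have "torus_part x \<in> period_box P (torus_part x)" using P by (simp add: period_box_def)
    then show "polar_map \<beta> P (\<lambda>r. sqrt (r - rp)) y \<in> (\<Union>c\<in>plane_torus_atlas P. fst c)"
      using plane_torus_chart_proj_box(2)[OF P] unfolding plane_torus_atlas_def polar_map_eq_proj_lift[OF \<beta>] x_def by blast
  next
    fix c and y :: "real^(2 + 'm)"
    assume "c \<in> plane_torus_atlas P" and "y \<in> {y. rp < y $ Inl 1}"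
      and dom: "polar_map \<beta> P (\<lambda>r. sqrt (r - rp)) y \<in> fst c"
    then obtain d where c: "c = plane_torus_chart P d" and r: "rp < y $ Inl 1"
      by (auto simp: plane_torus_atlas_def)
    obtain U k where U: "open U" "polar_lift rp \<kappa> y \<in> U"
      "\<And>x. x \<in> U \<Longrightarrow> snd c (plane_torus_proj P x) = x + lattice_shift P k"
      using plane_torus_chart_near[OF P] dom unfolding c polar_map_eq_proj_lift[OF \<beta>] by metis
    define F where "F = snd c \<circ> polar_map \<beta> P (\<lambda>r. sqrt (r - rp))"
    have D: "(polar_lift rp \<kappa> has_derivative (\<lambda>h. polar_jacobian rp \<kappa> y *v h)) (at y)"
      using polar_lift_has_derivative[OF r] \<kappa> by simp
    have "eventually (\<lambda>x. polar_lift rp \<kappa> x \<in> U) (at y)"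
      using has_derivative_continuous[OF D] U(1,2) by (simp add: continuous_at topological_tendstoD)
    then obtain N where N: "open N" "y \<in> N" and N': "\<And>x. x \<in> N \<Longrightarrow> x \<noteq> y \<Longrightarrow> polar_lift rp \<kappa> x \<in> U"
      unfolding eventually_at_topological by blast
    have NU: "polar_lift rp \<kappa> x \<in> U" if "x \<in> N" for x
      using N'[OF that] U(2) by (cases "x = y") auto
    have "((\<lambda>x. polar_lift rp \<kappa> x + lattice_shift P k) has_derivative (\<lambda>h. polar_jacobian rp \<kappa> y *v h)) (at y)"
      using D by (auto intro!: derivative_eq_intros)
    then have F: "(F has_derivative (\<lambda>h. polar_jacobian rp \<kappa> y *v h)) (at y)"
      by (rule has_derivative_transform_within_open[OF _ N(1,2)])
         (simp add: F_def polar_map_eq_proj_lift[OF \<beta>] U(3) NU)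
    then have "jacobian F (at y) = polar_jacobian rp \<kappa> y"
      by (simp add: jacobian_def frechet_derivative_at[symmetric])
    moreover have "snd c (polar_map \<beta> P (\<lambda>r. sqrt (r - rp)) y) = polar_lift rp \<kappa> y + lattice_shift P k"
      by (simp add: polar_map_eq_proj_lift[OF \<beta>] U)
    ultimately show "warped_metric V y = transpose (jacobian (snd c \<circ> polar_map \<beta> P (\<lambda>r. sqrt (r - rp))) (at y))
        ** polar_metric (snd c (polar_map \<beta> P (\<lambda>r. sqrt (r - rp)) y))
        ** jacobian (snd c \<circ> polar_map \<beta> P (\<lambda>r. sqrt (r - rp))) (at y)"
      using pullback_polar_lift[OF r V] by (simp add: F_def polar_metric_shift)
    show "(snd c \<circ> polar_map \<beta> P (\<lambda>r. sqrt (r - rp))) differentiable at y"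
      using F unfolding F_def by (rule differentiableI)
  qed
qed

end

section \<open>Removal of the singularity and completeness\<close>

theorem mainTheorem1:
  fixes n :: nat and S r0 a l rp \<beta> :: real and P :: "'m::finite \<Rightarrow> real" and V :: "real \<Rightarrow> real"
  assumes "n \<ge> 3" and "CARD('m) = n - 2"
    and "S < 0" and "r0 > 0"
    and "l = sqrt (- (real n * (real n - 1)) / S)"
    and "V = potential n l a r0"
    and "rp > 0" and "V rp = 0" and "\<forall>r>0. V r = 0 \<longrightarrow> r \<le> rp"
    and "\<forall>i. P i > 0"
    and "\<beta> = 4 * pi * l^2 / (rp * (real n - 1 + r0^n / rp^n))"
  shows "\<exists>h. extends_across_axis rp \<beta> P (warped_metric V) h \<and>
           geodesically_complete (plane_torus_atlas P) h \<and>
           constant_scalar_curvature (plane_torus_atlas P) h S"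
proof -
  define m where "m = CARD('m)"
  have n: "n = m + 2" and m: "m \<ge> 1" using assms(1,2) by (simp_all add: m_def)
  have nn: "real n * (real n - 1) > 0" using assms(1) by simp
  then have pos: "- (real n * (real n - 1)) / S > 0" using assms(3) by (intro divide_neg_neg) simp_all
  then have l2: "l^2 = - (real n * (real n - 1)) / S" unfolding assms(5) by simp
  have l: "l^2 > 0" unfolding l2 by (rule pos)
  define b where "b = r0^n"
  have b: "b > 0" using assms(4) by (simp add: b_def)
  have rp: "rp > 0" by fact
  define f where "f r = r^n + a * r - b" for r :: real
  have Vf: "V r = f r / (l^2 * r^m)" if "r > 0" for r
  proof -
    have n1: "n - 1 = Suc m" using n by simp
    have "V r = r^2 / l^2 * (1 + a / r^Suc m - b / r^n)"
      unfolding assms(6) potential_def n1 b_def ..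
    also have "1 + a / r^Suc m - b / r^n = f r / (r^m * r^2)"
      using that unfolding f_def n by (simp add: diff_divide_distrib add_divide_distrib power2_eq_square mult_ac)
    also have "r^2 / l^2 * (f r / (r^m * r^2)) = f r / (l^2 * r^m)" using that by simp
    finally show ?thesis .
  qed
  have f0: "f rp = 0" using Vf[OF rp] assms(8) l rp by simp
  then have a: "a = (b - rp^n) / rp" using rp by (simp add: f_def field_simps)
  \<comment> \<open>\<open>f r / r = r\<^sup>n\<^sup>-\<^sup>1 + a - b / r\<close> is strictly increasing.\<close>
  have fpos: "f r > 0" if r: "r > rp" for r
  proof -
    have "f r = f r - r / rp * f rp" using f0 by simp
    also have "\<dots> = r * (r^Suc m - rp^Suc m) + b * (r / rp - 1)"
      using rp unfolding f_def n by (simp add: field_simps)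
    also have "\<dots> > 0"
    proof (intro add_pos_pos mult_pos_pos)
      have "rp^Suc m < r^Suc m" using r rp by (intro power_strict_mono) auto
      then show "r^Suc m - rp^Suc m > 0" by (simp only: diff_gt_0_iff_gt)
    qed (use r rp b in \<open>auto simp: field_simps\<close>)
    finally show ?thesis .
  qed
  \<comment> \<open>\<open>V (rp + u)\<close> is \<open>u\<close> times the quotient of \<open>Q\<close> and \<open>D\<close>.\<close>
  define pp where "pp = [:rp, 1:]^n + smult a [:rp, 1:] - [:b:]"
  have pp: "poly pp u = f (rp + u)" for u by (simp add: pp_def f_def algebra_simps)
  have "poly pp 0 = 0" by (simp add: pp f0)
  then obtain Q where Q: "pp = [:0, 1:] * Q" unfolding poly_eq_0_iff_dvd by auto
  have uQ: "u * poly Q u = f (rp + u)" for u using pp[of u] by (simp add: Q)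
  have Q0: "poly Q 0 = rp^Suc m * (real n - 1 + b / rp^n)"
  proof -
    have "poly Q 0 = poly (pderiv pp) 0" by (simp add: Q pderiv_mult pderiv_pCons)
    also have "\<dots> = real n * rp^Suc m + a"
    proof -
      have "n = Suc (Suc m)" by (simp add: n)
      then have "pderiv ([:rp, 1:]^n) = smult (real n) ([:rp, 1:]^Suc m) * pderiv [:rp, 1:]"
        using pderiv_power_Suc[of "[:rp, 1:]" "Suc m"] by (simp only: of_nat_Suc)
      then show ?thesis
        by (simp add: pp_def pderiv_add pderiv_diff pderiv_smult pderiv_pCons del: power_Suc)
    qed
    also have "\<dots> = rp^Suc m * (real n - 1 + b / rp^n)"
      using rp unfolding a n by (simp add: field_simps)
    finally show ?thesis .
  qed
  have Qpos: "poly Q u > 0" if "u \<ge> 0" for u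
  proof (cases "u = 0")
    case True
    then show ?thesis using Q0 rp b assms(1) by (simp add: add_pos_pos)
  next
    case False
    then have "u > 0" using that by simp
    then have "u * poly Q u > 0" using uQ[of u] fpos[of "rp + u"] by simp
    then show ?thesis using \<open>u > 0\<close> by (rule zero_less_mult_pos)
  qed
  define D where "D = smult (l^2) ([:rp, 1:]^m)"
  have polyD: "poly D u = l^2 * (rp + u)^m" for u by (simp add: D_def)
  have Dpos: "poly D u > 0" if "u \<ge> 0" for u using l rp that by (simp add: polyD)
  define \<kappa> where "\<kappa> = \<beta> / (2 * pi)"
  define q where "q = real n - 1 + b / rp^n"
  have q: "q > 0" using assms(1) b rp by (simp add: q_def add_pos_pos)
  have \<kappa>: "\<kappa> = 2 * l^2 / (rp * q)"
    unfolding \<kappa>_def assms(11) b_def[symmetric] q_def[symmetric] by simp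
  have \<kappa>pos: "\<kappa> > 0" unfolding \<kappa> using l rp q by simp
  have \<beta>: "\<beta> = 2 * pi * \<kappa>" by (simp add: \<kappa>_def)
  define qq where "qq = smult 4 (D^2) - smult (\<kappa>^2) (Q^2)"
  \<comment> \<open>The condition for a smooth axis, which singles out the period.\<close>
  have "poly qq 0 = 0"
  proof -
    have "\<kappa> * poly Q 0 = 2 * poly D 0"
      unfolding \<kappa> Q0 polyD q_def[symmetric] using rp q by (simp add: field_simps)
    then have "(\<kappa> * poly Q 0)^2 = (2 * poly D 0)^2" by simp
    then show ?thesis by (simp add: qq_def power_mult_distrib)
  qed
  then obtain T where T: "qq = [:0, 1:] * T" unfolding poly_eq_0_iff_dvd by auto
  interpret polar_plane \<kappa> rp Q D T
  proof
    show "4 * (poly D u)^2 - \<kappa>^2 * (poly Q u)^2 = u * poly T u" for u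
    proof -
      have "poly qq u = u * poly T u" by (simp add: T)
      then show ?thesis by (simp add: qq_def)
    qed
  qed (use \<kappa>pos rp Qpos Dpos in auto)
  have uW: "u * W u = f (rp + u) / (l^2 * (rp + u)^m)" for u
    using uQ[of u] by (simp add: W_def ratio_def polyD)
  have VW: "V (rp + u) = u * W u" if "u > 0" for u
    unfolding uW using Vf[of "rp + u"] rp that by simp
  have ext: "extends_across_axis rp \<beta> P (warped_metric V) (\<lambda>c. polar_metric)"
    by (rule polar_metric_extends_warped_metric[OF assms(10) \<beta> VW])
  define C where "C = ((rp + 1)^2 + \<bar>a\<bar> * (rp + 1) / rp^m) / l^2"
  have "u * W u \<le> C * (1 + u)^2" if u: "u \<ge> 0" for u
  proof -
    have r: "rp + u > 0" using rp u by simp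
    have ru: "rp + u \<le> (rp + 1) * (1 + u)" using rp u by (simp add: algebra_simps)
    have "f (rp + u) \<le> (rp + u)^2 * (rp + u)^m + \<bar>a\<bar> * (rp + u)"
    proof -
      have "a * (rp + u) \<le> \<bar>a\<bar> * (rp + u)" using r by (intro mult_right_mono) auto
      then show ?thesis using b by (simp add: f_def n power2_eq_square)
    qed
    then have "u * W u \<le> ((rp + u)^2 * (rp + u)^m + \<bar>a\<bar> * (rp + u)) / (l^2 * (rp + u)^m)"
      unfolding uW using l r by (intro divide_right_mono) auto
    also have "\<dots> = ((rp + u)^2 + \<bar>a\<bar> * (rp + u) / (rp + u)^m) / l^2"
      using l r by (simp add: field_simps)
    also have "\<dots> \<le> (((rp + 1) * (1 + u))^2 + \<bar>a\<bar> * ((rp + 1) * (1 + u)^2) / rp^m) / l^2"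
    proof (intro divide_right_mono add_mono frac_le power_mono mult_left_mono)
      have "(1 + u) * 1 \<le> (1 + u) * (1 + u)" using u by (intro mult_left_mono) auto
      then have "(rp + 1) * (1 + u) \<le> (rp + 1) * (1 + u)^2"
        using rp by (intro mult_left_mono) (auto simp: power2_eq_square)
      then show "rp + u \<le> (rp + 1) * (1 + u)^2" using ru by linarith
    qed (use ru rp u l in auto)
    also have "\<dots> = C * (1 + u)^2"
      by (simp add: C_def field_simps power2_eq_square)
    finally show ?thesis .
  qed
  then have compl: "geodesically_complete (plane_torus_atlas P) (\<lambda>c. polar_metric)"
    by (rule geodesically_complete_polar_metric[OF assms(10)])
  have "scalar_curvature polar_metric y = S" for y :: "real^(2 + 'm)"
  proof -
    have "(rp + u)^CARD('m) * (u * W u) = 1 / l^2 * ((rp + u)^(CARD('m) + 2) + a * (rp + u) - b)" if "u \<ge> 0" for u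
      using l rp that unfolding uW f_def n m_def[symmetric] by simp
    then have "scalar_curvature polar_metric y = - (real m + 1) * (real m + 2) * (1 / l^2)"
      unfolding m_def by (rule polar_metric_scalar_curvature_constant)
    also have "- (real m + 1) * (real m + 2) = - (real n * (real n - 1))" by (simp add: n algebra_simps)
    also have "- (real n * (real n - 1)) * (1 / l^2) = - (real n * (real n - 1)) / l^2" by simp
    also have "\<dots> = S" unfolding l2 using assms(1,3) by simp
    finally show ?thesis .
  qed
  then have "constant_scalar_curvature (plane_torus_atlas P) (\<lambda>c. polar_metric) S"
    by (simp add: constant_scalar_curvature_def)
  with ext compl show ?thesis by blast
qed

end
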